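(* Let $G$ be a bounded simply connected domain in $\mathbb{C}$ and let $\phi$ be a conformal mapping from $\mathbb{D}$ onto $G$. Suppose that either 1. $p>1$ and $\phi'\in H^\infty$, or 2. $p>2$ and $\phi'\in H^2$. Then there is a constant $C$, depending only on $G$ (with its fixed conformal mapping $\phi$) and $p$, such that for every real $n>0$ and every function $f$ which is mean $n$-valent in $G$ and satisfies $f\circ\phi\in H^p$, $$\int_G |f'(w)|\,\mathrm{d}\mathcal{A}(w) \le C \sqrt{\log(n+1)}\, \|f\circ \phi\|_{H^p}.$$
   Context: $\mathbb{D}$ is the open unit disc in $\mathbb{C}$, $\mathcal{A}$ is the area (planar Lebesgue) measure, and $H^p$ is the standard Hardy space in $\mathbb{D}$ with norm $\|\cdot\|_{H^p}$. For a function $f$ analytic in a domain $G\subset\mathbb{C}$ and $w\in\mathbb{C}$, let $n(w)$ be the number of solutions of the equation $f(z)=w$ in $G$, counting multiplicities. For a positive real number $n$ (not necessarily an integer), $f$ is called mean $n$-valent in $G$ if for every $R>0$ $$\frac{1}{\pi}\int_0^R\int_0^{2\pi} n(re^{it})\,\mathrm{d}t\, r\,\mathrm{d}r \le nR^2.$$ *)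

theory Defs
  imports "HOL-Complex_Analysis.Complex_Analysis"
begin

definition hardy_mean :: "real \<Rightarrow> (complex \<Rightarrow> complex) \<Rightarrow> real \<Rightarrow> real" where
  "hardy_mean p f r =
     (1 / (2 * pi) * (LBINT t:{0..2*pi}. norm (f (rcis r t)) powr p)) powr (1 / p)"

text \<open>The finite exponents \<open>0 < p < \<infinity>\<close>; the space for \<open>p = \<infinity>\<close> is \<open>hardy_infinity\<close>.\<close>

definition hardy_space :: "real \<Rightarrow> (complex \<Rightarrow> complex) set" where
  "hardy_space p =
     {f. f holomorphic_on ball 0 1 \<and> bdd_above (hardy_mean p f ` {0..<1})}"

text \<open>Meaningful only on \<open>hardy_space p\<close>: elsewhere the real-valued supremum is unspecified.\<close>

definition hardy_norm :: "real \<Rightarrow> (complex \<Rightarrow> complex) \<Rightarrow> real" where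
  "hardy_norm p f = (SUP r\<in>{0..<1}. hardy_mean p f r)"

definition hardy_infinity :: "(complex \<Rightarrow> complex) set" where
  "hardy_infinity = {f. f holomorphic_on ball 0 1 \<and> bounded (f ` ball 0 1)}"

text \<open>
  On an open set, if the solution set is finite then every solution is an isolated zero of
  \<open>\<lambda>u. f u - w\<close>, so that \<open>zorder\<close> is its (positive) multiplicity. If \<open>f\<close> is constantly \<open>w\<close>,
  where \<open>zorder\<close> is not meaningful, the solution set is infinite and the count is \<open>\<infinity>\<close>.
\<close>

definition valency :: "(complex \<Rightarrow> complex) \<Rightarrow> complex set \<Rightarrow> complex \<Rightarrow> ennreal" where
  "valency f G w =
     (if finite {z\<in>G. f z = w}
      then of_nat (\<Sum>z\<in>{z\<in>G. f z = w}. nat (zorder (\<lambda>u. f u - w) z))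
      else \<infinity>)"

definition mean_valent :: "real \<Rightarrow> (complex \<Rightarrow> complex) \<Rightarrow> complex set \<Rightarrow> bool" where
  "mean_valent n f G \<longleftrightarrow>
     f holomorphic_on G \<and>
     (\<forall>R>0. ennreal (1 / pi) *
        (\<integral>\<^sup>+r\<in>{0..R}. (\<integral>\<^sup>+t\<in>{0..2*pi}. valency f G (rcis r t) \<partial>lborel) * ennreal r \<partial>lborel)
        \<le> ennreal (n * R\<^sup>2))"

definition conformal_map :: "(complex \<Rightarrow> complex) \<Rightarrow> complex set \<Rightarrow> complex set \<Rightarrow> bool" where
  "conformal_map \<phi> D G \<longleftrightarrow> \<phi> holomorphic_on D \<and> bij_betw \<phi> D G"

end

theory Submission
  imports Defs
begin

text \<open>
  Write \<open>F(\<zeta>) = f(\<phi>(e\<^sup>\<zeta>))\<close> on the half strip \<open>Re \<zeta> < 0\<close>, \<open>0 \<le> Im \<zeta> < 2 \<pi>\<close>, normalised so that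
  \<open>f \<circ> \<phi>\<close> has Hardy norm 1. The integral of \<open>|f'|\<close> over \<open>G\<close> becomes that of \<open>|F'| w\<close> with
  \<open>w(\<zeta>) = |\<phi>'(e\<^sup>\<zeta>) e\<^sup>\<zeta>|\<close>, and \<open>s = - Re \<zeta>\<close> plays the role of the distance to the unit circle.
  The strip is cut at \<open>s = \<alpha>\<close>, with \<open>\<alpha>\<close> a negative power of \<open>n\<close>.

  For \<open>s \<ge> \<alpha>\<close> one uses Cauchy-Schwarz with the weight \<open>s (1 + |F|\<^sup>2)\<^bsup>q/2-1\<^esup>\<close>, \<open>q = min(p,2)\<close>: the
  factor with \<open>F'\<close> is bounded by a Hardy-Stein inequality, because the Laplacian of
  \<open>(1 + |F|\<^sup>2)\<^bsup>q/2\<^esup>\<close> is at least \<open>q\<^sup>2 (1 + |F|\<^sup>2)\<^bsup>q/2-1\<^esup> |F'|\<^sup>2\<close>, and the other factor is of order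
  \<open>log(1/\<alpha>)\<close>.

  For \<open>s < \<alpha>\<close> one uses Cauchy-Schwarz with the weight \<open>1 / (1 + (2|F|)\<^sup>\<sigma>)\<close>, \<open>\<sigma> > 2\<close>: summing mean
  \<open>n\<close>-valence over the discs of radius \<open>2\<^sup>j\<close> bounds the factor with \<open>F'\<close> by a multiple of \<open>n\<close>, and
  the growth \<open>|f(\<phi>(z))| = O((1 - |z|)\<^bsup>-1/p\<^esup>)\<close> bounds the other one by a positive power of \<open>\<alpha>\<close>,
  which absorbs \<open>n\<close>. For \<open>n < 1\<close> this second estimate is used on the whole strip.
\<close>

subsection \<open>Change of variables in the plane\<close>

text \<open>Logarithmic coordinates turn circles into vertical segments over one period. There the
  second derivative in the angle of a periodic function integrates to zero, so the Laplacian of (1 +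
  |F|^2)^(q/2) integrates to M'', with M(x) its integral over the segment. M is convex and bounded
  for x < 0, and integrating by parts twice produces exactly the weight s. The summand 1 keeps the
  power smooth at zeros of F, where |F|^q in general is not.

  The square root of the logarithm is Cauchy-Schwarz applied to a bounded factor and the integral of
  1/s over [\<alpha>, 1].

  The thresholds for p come from s < \<alpha>: \<sigma> > 2 makes the dyadic sum converge, while
  |\<phi>'|^2 |F|^\<sigma> must stay integrable as s tends to 0. If \<phi>' is bounded, the circle
  means pay for |F|^p and the growth bound only for |F|^(\<sigma>-p), giving s^(-(\<sigma>-p)/p); so
  \<sigma> < 2p, possible when p > 1. If \<phi>' is in H^2, the circle means are spent on
  |\<phi>'|^2 and all of |F|^\<sigma> is bounded pointwise by s^(-\<sigma>/p); so \<sigma> < p,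
  possible when p > 2.\<close>

lemma lborel_complex_distr_vec:
  "distr lborel borel (\<lambda>v::real^2. Complex (v$1) (v$2)) = (lborel :: complex measure)"
proof (rule lborel_eqI[symmetric])
  have cont: "continuous_on UNIV (\<lambda>v::real^2. Complex (v$1) (v$2))"
    unfolding Complex_eq by (intro continuous_intros)
  have meas[measurable]: "(\<lambda>v::real^2. Complex (v$1) (v$2)) \<in> borel_measurable borel"
    using cont by (rule borel_measurable_continuous_onI)
  fix l u :: complex
  assume le: "\<And>b. b \<in> Basis \<Longrightarrow> l \<bullet> b \<le> u \<bullet> b"
  have "Re l \<le> Re u" "Im l \<le> Im u"
    using le[of 1] le[of \<i>] by (auto simp: Basis_complex_def)
  have "(\<lambda>v::real^2. Complex (v$1) (v$2)) -` box l u
     = box (vector [Re l, Im l]) (vector [Re u, Im u])"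
    by (auto simp: in_box_complex_iff mem_box_cart forall_2)
  then have "emeasure (distr lborel borel (\<lambda>v::real^2. Complex (v$1) (v$2))) (box l u)
     = emeasure lborel (box (vector [Re l, Im l]) (vector [Re u, Im u]) :: (real^2) set)"
    by (simp add: emeasure_distr)
  also have "\<dots> = (\<Prod>b\<in>Basis. (vector [Re u, Im u] - vector [Re l, Im l] :: real^2) \<bullet> b)"
    using \<open>Re l \<le> Re u\<close> \<open>Im l \<le> Im u\<close>
    by (intro emeasure_lborel_box) (auto simp: Basis_vec_def inner_axis, metis (full_types) exhaust_2 vector_2(1) vector_2(2))
  also have "\<dots> = ennreal ((Re u - Re l) * (Im u - Im l))"
  proof -
    have B: "Basis = {axis 1 1, axis 2 1 :: real^2}"
      by (auto simp: Basis_vec_def) (metis (full_types) exhaust_2)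
    show ?thesis unfolding B by (subst prod.insert) (auto simp: axis_eq_axis inner_axis)
  qed
  also have "\<dots> = (\<Prod>b\<in>Basis. (u - l) \<bullet> b)"
    by (simp add: Basis_complex_def)
  finally show "emeasure (distr lborel borel (\<lambda>v::real^2. Complex (v$1) (v$2))) (box l u) = (\<Prod>b\<in>Basis. (u - l) \<bullet> b)" .
qed simp

lemma lborel_complex_distr_pair:
  "distr (lborel \<Otimes>\<^sub>M lborel) borel (\<lambda>(x,y). Complex x y) = (lborel :: complex measure)"
proof (rule lborel_eqI[symmetric])
  have cont: "continuous_on UNIV (\<lambda>(x,y). Complex x y)"
    unfolding Complex_eq case_prod_unfold by (intro continuous_intros)
  have meas[measurable]: "(\<lambda>(x,y). Complex x y) \<in> borel_measurable borel"
    using cont by (rule borel_measurable_continuous_onI)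
  fix l u :: complex
  assume le: "\<And>b. b \<in> Basis \<Longrightarrow> l \<bullet> b \<le> u \<bullet> b"
  have le: "Re l \<le> Re u" "Im l \<le> Im u"
    using le[of 1] le[of \<i>] by (auto simp: Basis_complex_def)
  have "(\<lambda>(x,y). Complex x y) -` box l u = {Re l<..<Re u} \<times> {Im l<..<Im u}"
    by (auto simp: in_box_complex_iff)
  then have "emeasure (distr (lborel \<Otimes>\<^sub>M lborel) borel (\<lambda>(x,y). Complex x y)) (box l u)
     = emeasure (lborel \<Otimes>\<^sub>M lborel) ({Re l<..<Re u} \<times> {Im l<..<Im u})"
    using meas by (subst emeasure_distr) (auto simp: lborel_prod)
  also have "\<dots> = ennreal (Re u - Re l) * ennreal (Im u - Im l)"
    using le by (subst lborel.emeasure_pair_measure_Times) auto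
  also have "\<dots> = (\<Prod>b\<in>Basis. (u - l) \<bullet> b)"
    using le by (simp add: Basis_complex_def ennreal_mult)
  finally show "emeasure (distr (lborel \<Otimes>\<^sub>M lborel) borel (\<lambda>(x,y). Complex x y)) (box l u) = (\<Prod>b\<in>Basis. (u - l) \<bullet> b)" .
qed simp

lemma borel_measurable_Complex [measurable]:
  "(\<lambda>(x,y). Complex x y) \<in> borel_measurable (borel \<Otimes>\<^sub>M borel)"
proof -
  have "continuous_on UNIV (\<lambda>(x,y). Complex x y)"
    unfolding Complex_eq case_prod_unfold by (intro continuous_intros)
  then show ?thesis
    by (simp add: borel_measurable_continuous_onI borel_prod)
qed

lemma nn_integral_complex_iterated:
  fixes H :: "complex \<Rightarrow> ennreal"
  assumes [measurable]: "H \<in> borel_measurable borel"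
  shows "(\<integral>\<^sup>+z. H z \<partial>lborel) = (\<integral>\<^sup>+x. \<integral>\<^sup>+y. H (Complex x y) \<partial>lborel \<partial>lborel)"
proof -
  have "(\<integral>\<^sup>+z. H z \<partial>lborel) = (\<integral>\<^sup>+z. H z \<partial>distr (lborel \<Otimes>\<^sub>M lborel) borel (\<lambda>(x,y). Complex x y))"
    by (simp add: lborel_complex_distr_pair)
  also have "\<dots> = (\<integral>\<^sup>+x. \<integral>\<^sup>+y. H (Complex x y) \<partial>lborel \<partial>lborel)"
    by (subst nn_integral_distr) (simp_all add: case_prod_unfold lborel_pair.nn_integral_snd[symmetric] lborel.nn_integral_fst[symmetric])
  finally show ?thesis .
qed

lemma det_matrix_complex:
  fixes T' :: "complex \<Rightarrow> complex \<Rightarrow> complex" and V :: "complex \<Rightarrow> real^2"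
  assumes "W (axis 1 1) = 1" "W (axis 2 1) = \<i>" "\<And>z. V z $ 1 = Re z" "\<And>z. V z $ 2 = Im z"
  shows "det (matrix (\<lambda>h. V (T' (W v) (W h)))) = Re (T' (W v) 1) * Im (T' (W v) \<i>) - Re (T' (W v) \<i>) * Im (T' (W v) 1)"
  unfolding det_2 matrix_def using assms by simp

text \<open>\<open>has_measure_differentiable_image\<close> lives on \<open>real^2\<close>, so
  \<open>T\<close> is conjugated by the mutually inverse coordinate maps \<open>V\<close> and
  \<open>W\<close>, which preserve Lebesgue measure. The columns of the Jacobian matrix are the
  images of 1 and \<open>\<i>\<close>, whence the formula for \<open>D\<close>.\<close>

lemma emeasure_differentiable_image_complex:
  fixes T :: "complex \<Rightarrow> complex" and T' :: "complex \<Rightarrow> complex \<Rightarrow> complex" and D :: "complex \<Rightarrow> real"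
  assumes S: "S \<in> sets borel" and TS: "T ` S \<in> sets borel"
    and der: "\<And>x. x \<in> S \<Longrightarrow> (T has_derivative T' x) (at x within S)"
    and inj: "inj_on T S"
    and D: "\<And>x. x \<in> S \<Longrightarrow> D x = \<bar>Re (T' x 1) * Im (T' x \<i>) - Re (T' x \<i>) * Im (T' x 1)\<bar>"
    and meas: "(\<lambda>x. D x * indicator S x) \<in> borel_measurable borel"
  shows "emeasure lborel (T ` S) = (\<integral>\<^sup>+x\<in>S. ennreal (D x) \<partial>lborel)"
proof -
  define V :: "complex \<Rightarrow> real^2" where "V z = vector [Re z, Im z]" for z
  define W :: "real^2 \<Rightarrow> complex" where "W v = Complex (v$1) (v$2)" for v
  have WV[simp]: "W (V z) = z" and VW[simp]: "V (W v) = v" for z v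
    by (auto simp: V_def W_def vec_eq_iff forall_2)
  have linW: "bounded_linear W"
    unfolding W_def by (intro linear_conv_bounded_linear[THEN iffD1] linearI) (auto simp: complex_eq_iff)
  have linV: "bounded_linear V"
    unfolding V_def by (intro linear_conv_bounded_linear[THEN iffD1] linearI) (auto simp: vec_eq_iff forall_2)
  have mW[measurable]: "W \<in> borel_measurable borel" 
    using linW by (simp add: borel_measurable_continuous_onI linear_continuous_on)
  have mV[measurable]: "V \<in> borel_measurable borel" 
    using linV by (simp add: borel_measurable_continuous_onI linear_continuous_on)
  have im: "V ` A = W -` A" for A
    by (auto simp: image_iff) (metis VW)
  have em: "emeasure lborel A = emeasure lborel (V ` A)" if "A \<in> sets borel" for A
  proof -
    have "emeasure (lborel :: complex measure) A = emeasure (distr lborel borel W) A"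
      unfolding W_def using lborel_complex_distr_vec by simp
    also have "\<dots> = emeasure lborel (V ` A)" using that
      by (subst emeasure_distr) (auto simp: im)
    finally show ?thesis .
  qed
  have VS: "V ` A \<in> sets borel" if "A \<in> sets borel" for A
    using measurable_sets[OF mW that] by (simp add: im)
  define f where "f = (\<lambda>v. V (T (W v)))"
  define f' where "f' = (\<lambda>v h. V (T' (W v) (W h)))"
  have f_der: "(f has_derivative f' v) (at v within V ` S)" if "v \<in> V ` S" for v
  proof -
    have 1: "(W has_derivative W) (at v within V ` S)"
      using linW by (rule bounded_linear_imp_has_derivative)
    have 2: "(T has_derivative T' (W v)) (at (W v) within W ` (V ` S))"
      using der[of "W v"] that by (auto simp: image_image)
    have 3: "(T \<circ> W has_derivative T' (W v) \<circ> W) (at v within V ` S)"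
      by (rule diff_chain_within[OF 1 2])
    have 4: "(V has_derivative V) (at ((T \<circ> W) v) within (T \<circ> W) ` V ` S)"
      using linV by (rule bounded_linear_imp_has_derivative)
    show ?thesis using diff_chain_within[OF 3 4] by (simp add: o_def f_def f'_def)
  qed
  have f_inj: "inj_on f (V ` S)"
    using inj by (auto simp: inj_on_def f_def) (metis WV)
  have det: "\<bar>det (matrix (f' v))\<bar> = D (W v)" if "v \<in> V ` S" for v
  proof -
    have "W (axis 1 1) = 1" "W (axis 2 1) = \<i>"
      by (auto simp: W_def complex_eq_iff axis_def)
    moreover have "W v \<in> S" using that by auto
    moreover have "V z $ 1 = Re z" "V z $ 2 = Im z" for z by (simp_all add: V_def)
    ultimately show ?thesis
      using D[of "W v"] det_matrix_complex[of W V T' v] by (simp add: f'_def)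
  qed
  have fimg: "f ` V ` S = V ` (T ` S)" by (auto simp: f_def image_image)
  have VSl: "V ` S \<in> sets lebesgue" using VS[OF S] by (simp add: lborel_def sets_completionI_sets)
  note key = has_measure_differentiable_image[OF VSl f_der f_inj]
  define K where "K = (\<lambda>v. D (W v) * indicator (V ` S) v)"
  have K: "K = (\<lambda>x. D x * indicator S x) \<circ> W" by (auto simp: K_def fun_eq_iff im indicator_def)
  have Km[measurable]: "K \<in> borel_measurable borel" 
    unfolding K using meas mW by (rule measurable_comp[rotated])
  have K0: "0 \<le> K v" for v using D by (auto simp: K_def indicator_def im)
  have hi: "((\<lambda>v. \<bar>det (matrix (f' v))\<bar>) has_integral m) (V ` S) \<longleftrightarrow> (K has_integral m) UNIV" for m
  proof -
    have "((\<lambda>v. \<bar>det (matrix (f' v))\<bar>) has_integral m) (V ` S) \<longleftrightarrow>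
       ((\<lambda>v. if v \<in> V ` S then \<bar>det (matrix (f' v))\<bar> else 0) has_integral m) UNIV"
      by (simp add: has_integral_restrict_UNIV)
    also have "(\<lambda>v. if v \<in> V ` S then \<bar>det (matrix (f' v))\<bar> else 0) = K"
      using det by (auto simp: K_def fun_eq_iff)
    finally show ?thesis .
  qed
  have nn: "(\<integral>\<^sup>+x\<in>S. ennreal (D x) \<partial>lborel) = (\<integral>\<^sup>+v. ennreal (K v) \<partial>lborel)"
  proof -
    have "(\<integral>\<^sup>+x\<in>S. ennreal (D x) \<partial>lborel) = (\<integral>\<^sup>+x. ennreal (D x * indicator S x) \<partial>lborel)"
      by (intro nn_integral_cong) (auto simp: indicator_def)
    also have "\<dots> = (\<integral>\<^sup>+x. ennreal (D x * indicator S x) \<partial>distr lborel borel W)"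
      unfolding W_def using lborel_complex_distr_vec by simp
    also have "\<dots> = (\<integral>\<^sup>+v. ennreal (K v) \<partial>lborel)"
      using meas by (subst nn_integral_distr) (auto simp: K)
    finally show ?thesis .
  qed
  \<comment> \<open>The theorem on \<open>real^2\<close> is an equivalence for finite values only.
    The infinite case is its other direction: an image of finite measure would make the integral of
    \<open>K\<close> finite.\<close>
  show ?thesis
  proof (cases "(\<integral>\<^sup>+v. ennreal (K v) \<partial>lborel)")
    case (real m)
    have "(K has_integral m) UNIV"
      by (rule nn_integral_has_integral[OF _ K0]) (use real in auto)
    then have "V ` (T ` S) \<in> lmeasurable \<and> measure lebesgue (V ` (T ` S)) = m"
      using key[of m] hi fimg by simp
    then have "emeasure lebesgue (V ` (T ` S)) = m"
      by (metis emeasure_eq_measure2)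
    then show ?thesis unfolding nn em[OF TS] real(2)
      using VS[OF TS] by (simp add: emeasure_completion)
  next
    case top
    have "emeasure lborel (V ` (T ` S)) = \<infinity>"
    proof (rule ccontr)
      assume "emeasure lborel (V ` (T ` S)) \<noteq> \<infinity>"
      then have "V ` (T ` S) \<in> lmeasurable"
        using VS[OF TS] by (intro fmeasurableI) (auto simp: less_top)
      then have "(K has_integral (measure lebesgue (V ` (T ` S)))) UNIV"
        using key[of "measure lebesgue (V ` T ` S)"] hi fimg by simp
      then have "(\<integral>\<^sup>+v. ennreal (K v) \<partial>lborel) = ennreal (measure lebesgue (V ` (T ` S)))"
        by (intro nn_integral_has_integral_lborel) (auto simp: K0)
      then show False using top by simp
    qed
    then show ?thesis using em[OF TS] top nn by simp
  qed
qed

text \<open>The preceding lemma, applied to the part of \<open>S\<close> that \<open>T\<close> sends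
  into a Borel set, says that pushing the density \<open>D\<close> on \<open>S\<close> forward along
  \<open>T\<close> gives Lebesgue measure on the image. Integrating \<open>H\<close> against these
  two equal measures is the claim.\<close>

lemma nn_integral_differentiable_image_complex:
  fixes T :: "complex \<Rightarrow> complex" and T' :: "complex \<Rightarrow> complex \<Rightarrow> complex" and D :: "complex \<Rightarrow> real"
  assumes S[measurable]: "S \<in> sets borel" and TS[measurable]: "T ` S \<in> sets borel"
    and der: "\<And>x. x \<in> S \<Longrightarrow> (T has_derivative T' x) (at x within S)"
    and inj: "inj_on T S"
    and D: "\<And>x. x \<in> S \<Longrightarrow> D x = \<bar>Re (T' x 1) * Im (T' x \<i>) - Re (T' x \<i>) * Im (T' x 1)\<bar>"
    and contD: "continuous_on S D"
    and H[measurable]: "H \<in> borel_measurable borel"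
  shows "(\<integral>\<^sup>+w\<in>T ` S. H w \<partial>lborel) = (\<integral>\<^sup>+x\<in>S. ennreal (D x) * H (T x) \<partial>lborel)"
proof -
  have Dm: "(\<lambda>x. D x * indicator A x) \<in> borel_measurable borel" if "A \<in> sets borel" "A \<subseteq> S" for A
    using borel_measurable_continuous_on_indicator[OF that(1) continuous_on_subset[OF contD that(2)]]
    by (simp add: mult.commute)
  have contT: "continuous_on S T"
    unfolding continuous_on_eq_continuous_within using has_derivative_continuous[OF der] by blast
  \<comment> \<open>\<open>T\<close> is controlled only on \<open>S\<close>; a push-forward needs a
    Borel map on the whole plane, and the values outside \<open>S\<close> have density 0.\<close>
  define T0 where "T0 = (\<lambda>x. if x \<in> S then T x else 0)"
  have T0[measurable]: "T0 \<in> borel_measurable borel"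
    unfolding T0_def using S contT continuous_on_const by (rule borel_measurable_continuous_on_if)
  let ?d = "\<lambda>x. ennreal (D x * indicator S x)"
  have dm[measurable]: "?d \<in> borel_measurable borel" using Dm[OF S] by simp
  have "distr (density lborel ?d) borel T0 = density lborel (indicator (T ` S))"
  proof (rule measure_eqI)
    fix B assume "B \<in> sets (distr (density lborel ?d) borel T0)"
    then have B[measurable]: "B \<in> sets borel" by simp
    let ?A = "S \<inter> T0 -` B"
    have A: "?A \<in> sets borel" using measurable_sets[OF T0 B] by auto
    have img: "T ` ?A = T ` S \<inter> B" by (auto simp: T0_def)
    have "emeasure (distr (density lborel ?d) borel T0) B = (\<integral>\<^sup>+x. ?d x * indicator (T0 -` B) x \<partial>lborel)"
      using measurable_sets[OF T0 B] by (simp add: emeasure_distr emeasure_density)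
    also have "\<dots> = (\<integral>\<^sup>+x\<in>?A. ennreal (D x) \<partial>lborel)"
      by (intro nn_integral_cong) (auto simp: indicator_def)
    also have "\<dots> = emeasure lborel (T ` ?A)"
      by (rule emeasure_differentiable_image_complex[OF A _ _ _ D Dm[OF A], symmetric])
        (auto simp: img intro: has_derivative_subset[OF der] inj_on_subset[OF inj])
    also have "\<dots> = emeasure (density lborel (indicator (T ` S))) B"
      by (simp add: emeasure_density img indicator_inter_arith[symmetric])
    finally show "emeasure (distr (density lborel ?d) borel T0) B = emeasure (density lborel (indicator (T ` S))) B" .
  qed simp
  then have "(\<integral>\<^sup>+w. H w \<partial>density lborel (indicator (T ` S))) = (\<integral>\<^sup>+w. H w \<partial>distr (density lborel ?d) borel T0)"
    by simp
  also have "\<dots> = (\<integral>\<^sup>+x. ?d x * H (T0 x) \<partial>lborel)"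
    by (simp add: nn_integral_distr nn_integral_density)
  also have "\<dots> = (\<integral>\<^sup>+x\<in>S. ennreal (D x) * H (T x) \<partial>lborel)"
    by (intro nn_integral_cong) (auto simp: indicator_def T0_def)
  also have "(\<integral>\<^sup>+w. H w \<partial>density lborel (indicator (T ` S))) = (\<integral>\<^sup>+w\<in>T ` S. H w \<partial>lborel)"
    by (simp add: nn_integral_density mult.commute)
  finally show ?thesis .
qed

lemma nn_integral_holomorphic_image:
  assumes S: "S \<in> sets borel" and TS: "T ` S \<in> sets borel"
    and hol: "T holomorphic_on U" "open U" "S \<subseteq> U"
    and inj: "inj_on T S"
    and H: "H \<in> borel_measurable borel"
  shows "(\<integral>\<^sup>+w\<in>T ` S. H w \<partial>lborel) = (\<integral>\<^sup>+z\<in>S. ennreal ((norm (deriv T z))\<^sup>2) * H (T z) \<partial>lborel)"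
proof (rule nn_integral_differentiable_image_complex[OF S TS _ inj _ _ H, where T' = "\<lambda>z h. deriv T z * h"])
  show "(T has_derivative (\<lambda>h. deriv T z * h)) (at z within S)" if "z \<in> S" for z
    using holomorphic_derivI[OF hol(1,2)] that hol(3)
    by (auto simp: has_field_derivative_def intro: has_derivative_at_withinI)
  show "(norm (deriv T x))\<^sup>2 = \<bar>Re (deriv T x * 1) * Im (deriv T x * \<i>) - Re (deriv T x * \<i>) * Im (deriv T x * 1)\<bar>" for x
    unfolding cmod_power2 by (simp add: power2_eq_square)
  show "continuous_on S (\<lambda>z. (norm (deriv T z))\<^sup>2)"
    using holomorphic_on_imp_continuous_on[OF holomorphic_deriv[OF hol(1,2)]] hol(3)
    by (intro continuous_intros) (auto intro: continuous_on_subset)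
qed

subsection \<open>The area theorem for mean valent functions\<close>

text \<open>The image is the preimage of \<open>S\<close> under the holomorphic inverse of
  \<open>T\<close>, which is defined on the open set of all values of \<open>T\<close> on
  \<open>U\<close>.\<close>

lemma sets_borel_image_holomorphic_inj:
  assumes "T holomorphic_on U" "open U" "inj_on T U" "S \<subseteq> U" "S \<in> sets borel"
  shows "T ` S \<in> sets borel"
proof -
  obtain g where g: "g holomorphic_on (T ` U)" "\<And>z. z \<in> U \<Longrightarrow> g (T z) = z"
    using holomorphic_has_inverse[OF assms(1-3)] by metis
  have "open (T ` U)" using open_mapping_thm3[OF assms(1-3)] .
  have "(\<lambda>w. if w \<in> T ` U then g w else 0) \<in> borel_measurable borel"
    using \<open>open (T ` U)\<close> holomorphic_on_imp_continuous_on[OF g(1)]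
    by (intro borel_measurable_continuous_on_if) auto
  from measurable_sets[OF this assms(5)] have "(\<lambda>w. if w \<in> T ` U then g w else 0) -` S \<inter> T ` U \<in> sets borel"
    using \<open>open (T ` U)\<close> by auto
  also have "(\<lambda>w. if w \<in> T ` U then g w else 0) -` S \<inter> T ` U = T ` S"
    using assms(4) g(2) by (auto simp: image_iff) (metis assms(4) g(2) subsetD)+
  finally show ?thesis .
qed

lemma nn_integral_polar:
  fixes H :: "complex \<Rightarrow> ennreal"
  assumes H[measurable]: "H \<in> borel_measurable borel"
  shows "(\<integral>\<^sup>+w\<in>cball 0 R. H w \<partial>lborel) =
    (\<integral>\<^sup>+r\<in>{0..R}. (\<integral>\<^sup>+t\<in>{0..2*pi}. H (rcis r t) \<partial>lborel) * ennreal r \<partial>lborel)"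
proof -
  \<comment> \<open>Half-open in the angle and without radius 0, so that \<open>T\<close> is
    injective. What is lost, the origin of the plane and the angle \<open>2 * pi\<close>, has
    measure zero.\<close>
  define S where "S = {z. 0 < Re z \<and> Re z \<le> R \<and> 0 \<le> Im z \<and> Im z < 2 * pi}"
  define T where "T = (\<lambda>z. rcis (Re z) (Im z))"
  have mrc[measurable]: "(\<lambda>(r,t). rcis r t) \<in> borel_measurable (borel \<Otimes>\<^sub>M borel)"
  proof -
    have "continuous_on UNIV (\<lambda>(r,t). rcis r t)"
      unfolding case_prod_unfold by (intro continuous_intros)
    then show ?thesis by (simp add: borel_measurable_continuous_onI borel_prod)
  qed
  have S[measurable]: "S \<in> sets borel" unfolding S_def by measurable
  have TS: "T ` S = cball 0 R - {0}"
  proof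
    show "T ` S \<subseteq> cball 0 R - {0}" by (auto simp: T_def S_def)
    show "cball 0 R - {0} \<subseteq> T ` S"
    proof
      fix w assume w: "w \<in> cball (0::complex) R - {0}"
      have "w = T (Complex (cmod w) (Arg2pi w))"
        by (simp add: T_def rcis_def cis_conv_exp flip: Arg2pi_eq)
      moreover have "Complex (cmod w) (Arg2pi w) \<in> S" using w Arg2pi_ge_0[of w] Arg2pi_lt_2pi[of w] by (auto simp: S_def)
      ultimately show "w \<in> T ` S" by blast
    qed
  qed
  have inj: "inj_on T S"
  proof (rule inj_onI)
    fix x y assume x: "x \<in> S" and y: "y \<in> S" and eq: "T x = T y"
    have "Re x = Re y" using arg_cong[OF eq, of cmod] x y by (auto simp: T_def S_def)
    moreover have "Arg2pi (T z) = Im z" if "z \<in> S" for z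
      using that by (intro Arg2pi_unique[of "Re z"]) (auto simp: S_def T_def rcis_def cis_conv_exp)
    ultimately show "x = y" using x y eq by (metis complex_eqI)
  qed
  have "(\<integral>\<^sup>+w\<in>cball 0 R. H w \<partial>lborel) = (\<integral>\<^sup>+w\<in>T ` S. H w \<partial>lborel)"
  proof (rule nn_integral_cong_AE)
    show "AE x in lborel. H x * indicator (cball 0 R) x = H x * indicator (T ` S) x"
      using AE_lborel_singleton[of 0] by eventually_elim (auto simp: TS indicator_def)
  qed
  also have "\<dots> = (\<integral>\<^sup>+z\<in>S. ennreal (Re z) * H (T z) \<partial>lborel)"
  proof (rule nn_integral_differentiable_image_complex[OF S _ _ inj _ _ H, where T' = "\<lambda>z h. Re h *\<^sub>R cis (Im z) + Re z *\<^sub>R Im h *\<^sub>R (\<i> * cis (Im z))"])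
    show "T ` S \<in> sets borel" unfolding TS by measurable
    show "(T has_derivative (\<lambda>h. Re h *\<^sub>R cis (Im z) + Re z *\<^sub>R Im h *\<^sub>R (\<i> * cis (Im z)))) (at z within S)" for z
    proof -
      have "T = (\<lambda>z. Re z *\<^sub>R cis (Im z))" by (simp add: T_def rcis_def fun_eq_iff scaleR_conv_of_real)
      moreover have "((\<lambda>z. Re z *\<^sub>R cis (Im z)) has_derivative (\<lambda>h. Re h *\<^sub>R cis (Im z) + Re z *\<^sub>R Im h *\<^sub>R (\<i> * cis (Im z)))) (at z within S)"
        by (rule derivative_eq_intros refl)+ (simp add: fun_eq_iff add.commute)
      ultimately show ?thesis by simp
    qed
    show "Re x = \<bar>Re (Re 1 *\<^sub>R cis (Im x) + Re x *\<^sub>R Im 1 *\<^sub>R (\<i> * cis (Im x))) *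
             Im (Re \<i> *\<^sub>R cis (Im x) + Re x *\<^sub>R Im \<i> *\<^sub>R (\<i> * cis (Im x))) -
             Re (Re \<i> *\<^sub>R cis (Im x) + Re x *\<^sub>R Im \<i> *\<^sub>R (\<i> * cis (Im x))) *
             Im (Re 1 *\<^sub>R cis (Im x) + Re x *\<^sub>R Im 1 *\<^sub>R (\<i> * cis (Im x)))\<bar>" if "x \<in> S" for x
    proof -
      have "Re x * (cos (Im x) * cos (Im x)) + Re x * (sin (Im x) * sin (Im x)) = Re x"
        by (simp flip: distrib_left)
      then show ?thesis using that by (simp add: S_def algebra_simps)
    qed
    show "continuous_on S Re" by (intro continuous_intros)
  qed
  also have "\<dots> = (\<integral>\<^sup>+x. \<integral>\<^sup>+y. ennreal (Re (Complex x y)) * H (T (Complex x y)) * indicator S (Complex x y) \<partial>lborel \<partial>lborel)"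
    unfolding T_def by (rule nn_integral_complex_iterated) measurable
  also have "\<dots> = (\<integral>\<^sup>+r\<in>{0..R}. (\<integral>\<^sup>+t\<in>{0..2*pi}. H (rcis r t) \<partial>lborel) * ennreal r \<partial>lborel)"
  proof (rule nn_integral_cong)
    fix r :: real
    show "(\<integral>\<^sup>+y. ennreal (Re (Complex r y)) * H (T (Complex r y)) * indicator S (Complex r y) \<partial>lborel)
      = (\<integral>\<^sup>+t\<in>{0..2*pi}. H (rcis r t) \<partial>lborel) * ennreal r * indicator {0..R} r"
    proof (cases "0 < r \<and> r \<le> R")
      case True
      have "(\<integral>\<^sup>+y. ennreal (Re (Complex r y)) * H (T (Complex r y)) * indicator S (Complex r y) \<partial>lborel)
        = (\<integral>\<^sup>+y. (H (rcis r y) * indicator {0..2*pi} y) * ennreal r \<partial>lborel)"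
      proof (rule nn_integral_cong_AE)
        show "AE y in lborel. ennreal (Re (Complex r y)) * H (T (Complex r y)) * indicator S (Complex r y)
           = (H (rcis r y) * indicator {0..2*pi} y) * ennreal r"
          using AE_lborel_singleton[of "2*pi"]
          by eventually_elim (use True in \<open>auto simp: T_def S_def indicator_def mult.commute\<close>)
      qed
      also have "\<dots> = (\<integral>\<^sup>+y\<in>{0..2*pi}. H (rcis r y) \<partial>lborel) * ennreal r"
        by (rule nn_integral_multc) measurable
      finally show ?thesis using True by simp
    next
      case False
      then have "ennreal r * indicator {0..R} r = 0" 
        by (auto simp: indicator_def ennreal_eq_0_iff)
      moreover have "indicator S (Complex r y) = (0::ennreal)" for y using False by (auto simp: S_def indicator_def)
      ultimately show ?thesis by (simp add: mult.assoc)
    qed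
  qed
  finally show ?thesis .
qed

text \<open>A nonzero derivative gives local injectivity, Lindelof reduces the resulting open cover
  to a countable one, and \<open>disjointed\<close> makes it a partition. This reduces the area
  counted with multiplicity to the injective change of variables.\<close>

lemma countable_injective_partition:
  assumes "f holomorphic_on G" "open G"
  obtains D :: "nat \<Rightarrow> complex set" where "disjoint_family D" "\<And>k. D k \<in> sets borel" "\<And>k. inj_on f (D k)"
    "\<And>k. f ` D k \<in> sets borel" "(\<Union>k. D k) = {z\<in>G. deriv f z \<noteq> 0}"
proof -
  let ?G = "{z\<in>G. deriv f z \<noteq> 0}"
  define F where "F = {B. open B \<and> B \<subseteq> ?G \<and> inj_on f B}"
  have cont: "continuous_on G (deriv f)"
    using holomorphic_deriv[OF assms] by (rule holomorphic_on_imp_continuous_on)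
  have oG: "open ?G"
    using continuous_open_preimage[OF cont assms(2), of "-{0}"] by (simp add: vimage_def Int_def open_Compl)
  have U: "\<Union>F = ?G"
  proof
    show "\<Union>F \<subseteq> ?G" by (auto simp: F_def)
    show "?G \<subseteq> \<Union>F"
    proof
      fix z assume z: "z \<in> ?G"
      have "f holomorphic_on ?G" using assms(1) by (rule holomorphic_on_subset) auto
      then obtain r where "r > 0" "ball z r \<subseteq> ?G" "inj_on f (ball z r)"
        using z oG by (elim has_complex_derivative_locally_injective) auto
      then show "z \<in> \<Union>F" by (auto simp: F_def intro!: exI[of _ "ball z r"])
    qed
  qed
  obtain F' where F': "F' \<subseteq> F" "countable F'" "\<Union>F' = \<Union>F"
    using Lindelof[of F] by (auto simp: F_def)
  \<comment> \<open>The empty set is added because \<open>F'\<close> may be empty, for instance for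
    constant \<open>f\<close>, and only a nonempty countable set can be enumerated by all of
    \<open>nat\<close>.\<close>
  define B where "B = from_nat_into (insert {} F')"
  have rB: "range B = insert {} F'"
    unfolding B_def using F'(2) by (intro range_from_nat_into) auto
  then have BF: "B k \<in> F" for k
    using F'(1) rangeI[of B k] by (auto simp: F_def)
  have UB: "(\<Union>k. B k) = ?G" using rB F'(3) U by auto
  have B: "open (B k)" "B k \<subseteq> ?G" "inj_on f (B k)" for k using BF[of k] by (auto simp: F_def)
  show ?thesis
  proof (rule that[of "disjointed B"])
    show "disjoint_family (disjointed B)" by (rule disjoint_family_disjointed)
    show D: "disjointed B k \<in> sets borel" for k
    proof -
      have "range B \<subseteq> sets borel" using borel_open[OF B(1)] by (rule image_subsetI)
      from sets.range_disjointed_sets[OF this] show ?thesis by (rule subsetD) (rule rangeI)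
    qed
    show "inj_on f (disjointed B k)" for k
      using inj_on_subset[OF B(3) disjointed_subset] .
    show "f ` disjointed B k \<in> sets borel" for k
    proof (rule sets_borel_image_holomorphic_inj[OF _ B(1,3) disjointed_subset D])
      show "f holomorphic_on B k" using assms(1) B(2) by (rule holomorphic_on_subset[OF _ order_trans]) auto
    qed
    show "(\<Union>k. disjointed B k) = ?G" using UB by (simp add: UN_disjointed_eq)
  qed
qed

text \<open>Every piece whose image contains \<open>w\<close> holds a solution of
  \<open>f z = w\<close>; disjoint pieces give distinct solutions, and each has multiplicity 1
  because the derivative does not vanish there. Critical solutions only enlarge the right
  side.\<close>

lemma valency_ge_count:
  assumes f: "f holomorphic_on G" "open G" and D: "disjoint_family D" "(\<Union>k. D k) = {z\<in>G. deriv f z \<noteq> 0}"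
  shows "(\<Sum>k. indicator (f ` D k) w) \<le> valency f G w"
proof (cases "finite {z\<in>G. f z = w}")
  case True
  let ?Z = "{z\<in>G. f z = w}"
  have "(\<Sum>k. indicator (f ` D k) w) \<le> (\<Sum>k. \<Sum>z\<in>?Z. indicator (D k) z :: ennreal)"
  proof (rule suminf_le)
    show "indicator (f ` D k) w \<le> (\<Sum>z\<in>?Z. indicator (D k) z :: ennreal)" for k
    proof (cases "w \<in> f ` D k")
      case True
      then obtain z where z: "z \<in> D k" "w = f z" by auto
      then have "z \<in> ?Z" using D(2) by auto
      then have "(indicator (D k) z :: ennreal) \<le> (\<Sum>z\<in>?Z. indicator (D k) z)"
        using \<open>finite ?Z\<close> by (intro member_le_sum) auto
      then show ?thesis using z by simp
    qed simp
  qed auto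
  also have "\<dots> = (\<Sum>z\<in>?Z. \<Sum>k. indicator (D k) z)"
    by (rule suminf_sum) auto
  also have "\<dots> = (\<Sum>z\<in>?Z. indicator {z\<in>G. deriv f z \<noteq> 0} z)"
    by (simp add: suminf_indicator[OF D(1)] D(2))
  also have "\<dots> \<le> (\<Sum>z\<in>?Z. of_nat (nat (zorder (\<lambda>u. f u - w) z)))"
  proof (rule sum_mono)
    fix z assume z: "z \<in> ?Z"
    show "indicator {z\<in>G. deriv f z \<noteq> 0} z \<le> (of_nat (nat (zorder (\<lambda>u. f u - w) z)) :: ennreal)"
    proof (cases "deriv f z = 0")
      case False
      have d: "f field_differentiable at z" using f z holomorphic_on_imp_differentiable_at by blast
      have "zorder (\<lambda>u. f u - w) z = 1"
        by (rule zorder_zero_eqI[where S = G]) (use f z False d in \<open>auto intro!: holomorphic_intros\<close>)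
      then show ?thesis by (simp add: indicator_def)
    qed simp
  qed
  also have "\<dots> = valency f G w" using True by (simp add: valency_def)
  finally show ?thesis .
qed (simp add: valency_def)

text \<open>The left side is the area of the part of the image in the disc of radius
  \<open>R\<close>, counted with multiplicity. Changing variables piece by piece turns it into an
  integral of the number of preimages, and polar coordinates give it the form in which
  \<open>mean_valent\<close> bounds it.\<close>

lemma mean_valent_area:
  assumes mv: "mean_valent n f G" and G: "open G" and R: "R > 0"
  shows "(\<integral>\<^sup>+z\<in>{z\<in>G. cmod (f z) \<le> R}. ennreal ((cmod (deriv f z))\<^sup>2) \<partial>lborel) \<le> ennreal (pi * n * R\<^sup>2)"
proof -
  have f: "f holomorphic_on G" using mv by (simp add: mean_valent_def)
  obtain D :: "nat \<Rightarrow> complex set" where D: "disjoint_family D" "\<And>k. D k \<in> sets borel" "\<And>k. inj_on f (D k)"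
    "\<And>k. f ` D k \<in> sets borel" "(\<Union>k. D k) = {z\<in>G. deriv f z \<noteq> 0}"
    by (rule countable_injective_partition[OF f G]) blast
  let ?I = "\<lambda>w. indicator (cball (0::complex) R) w :: ennreal"
  let ?d = "\<lambda>z. ennreal ((cmod (deriv f z))\<^sup>2)"
  have DG: "D k \<subseteq> G" for k using D(5) by auto
  have contd: "continuous_on (D k) (\<lambda>z. (cmod (deriv f z))\<^sup>2)" for k
    using continuous_on_subset[OF holomorphic_on_imp_continuous_on[OF holomorphic_deriv[OF f G]] DG]
    by (intro continuous_intros)
  have contf: "continuous_on (D k) f" for k
    using continuous_on_subset[OF holomorphic_on_imp_continuous_on[OF f] DG] .
  have meas[measurable]: "(\<lambda>z. ?d z * ?I (f z) * indicator (D k) z) \<in> borel_measurable borel" for k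
  proof -
    define F0 where "F0 = (\<lambda>z. if z \<in> D k then f z else 0)"
    define d0 where "d0 = (\<lambda>z. if z \<in> D k then (cmod (deriv f z))\<^sup>2 else 0)"
    have Dk[measurable]: "D k \<in> sets borel" by (rule D(2))
    have [measurable]: "F0 \<in> borel_measurable borel"
      unfolding F0_def using contf Dk by (intro borel_measurable_continuous_on_if) auto
    have [measurable]: "d0 \<in> borel_measurable borel"
      unfolding d0_def using contd Dk by (intro borel_measurable_continuous_on_if) auto
    have "(\<lambda>z. ennreal (d0 z) * ?I (F0 z) * indicator (D k) z) \<in> borel_measurable borel"
      using Dk by (intro borel_measurable_times_ennreal borel_measurable_indicator
          measurable_compose[OF \<open>F0 \<in> borel_measurable borel\<close> borel_measurable_indicator]) auto
    also have "(\<lambda>z. ennreal (d0 z) * ?I (F0 z) * indicator (D k) z) = (\<lambda>z. ?d z * ?I (f z) * indicator (D k) z)"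
      by (auto simp: fun_eq_iff indicator_def d0_def F0_def)
    finally show ?thesis .
  qed
  \<comment> \<open>Points with zero derivative lie in no \<open>D k\<close>, but the integrand
    vanishes there.\<close>
  have "(\<integral>\<^sup>+z\<in>{z\<in>G. cmod (f z) \<le> R}. ?d z \<partial>lborel) = (\<integral>\<^sup>+z. (\<Sum>k. ?d z * ?I (f z) * indicator (D k) z) \<partial>lborel)"
    unfolding ennreal_suminf_cmult suminf_indicator[OF D(1)] D(5)
    by (intro nn_integral_cong) (auto simp: indicator_def)
  also have "\<dots> = (\<Sum>k. \<integral>\<^sup>+z. ?d z * ?I (f z) * indicator (D k) z \<partial>lborel)"
    using meas by (intro nn_integral_suminf) simp
  also have "\<dots> = (\<Sum>k. \<integral>\<^sup>+w\<in>f ` D k. ?I w \<partial>lborel)"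
    by (intro suminf_cong nn_integral_holomorphic_image[symmetric, OF D(2,4) f G DG D(3)] borel_measurable_indicator) simp
  also have "\<dots> = (\<integral>\<^sup>+w. (\<Sum>k. ?I w * indicator (f ` D k) w) \<partial>lborel)"
    using D(4) by (intro nn_integral_suminf[symmetric] borel_measurable_times_ennreal borel_measurable_indicator) auto
  also have "\<dots> = (\<integral>\<^sup>+w\<in>cball 0 R. (\<Sum>k. indicator (f ` D k) w) \<partial>lborel)"
    by (intro nn_integral_cong) (simp add: mult.commute)
  also have "\<dots> = (\<integral>\<^sup>+r\<in>{0..R}. (\<integral>\<^sup>+t\<in>{0..2*pi}. (\<Sum>k. indicator (f ` D k) (rcis r t)) \<partial>lborel) * ennreal r \<partial>lborel)"
    using D(4) by (intro nn_integral_polar borel_measurable_suminf_order borel_measurable_indicator)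
  also have "\<dots> \<le> (\<integral>\<^sup>+r\<in>{0..R}. (\<integral>\<^sup>+t\<in>{0..2*pi}. valency f G (rcis r t) \<partial>lborel) * ennreal r \<partial>lborel)"
    by (intro nn_integral_mono mult_right_mono valency_ge_count[OF f G D(1,5)]) auto
  also have "\<dots> = ennreal pi * (ennreal (1 / pi) * \<dots>)"
    by (simp add: mult.assoc[symmetric] flip: ennreal_mult)
  also have "\<dots> \<le> ennreal pi * ennreal (n * R\<^sup>2)"
    using mv R by (intro mult_left_mono) (auto simp: mean_valent_def)
  also have "\<dots> = ennreal (pi * n * R\<^sup>2)" 
    by (simp add: mult.assoc flip: ennreal_mult')
  finally show ?thesis .
qed

subsection \<open>The weighted Cauchy-Schwarz argument\<close>

lemma ennreal_le_sqrt:
  assumes "X\<^sup>2 \<le> ennreal Y" "Y \<ge> 0"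
  shows "X \<le> ennreal (sqrt Y)"
proof (cases X)
  case (real r)
  then have "r\<^sup>2 \<le> Y" using assms by (simp add: ennreal_power)
  then show ?thesis using real by (simp add: ennreal_leI real_le_rsqrt)
next
  case top
  then show ?thesis using assms by (simp add: top_unique)
qed

lemma nn_integral_mult_le_sqrt:
  assumes [measurable]: "f \<in> borel_measurable M" "g \<in> borel_measurable M"
    and f: "(\<integral>\<^sup>+x. f x ^ 2 \<partial>M) \<le> ennreal A" and g: "(\<integral>\<^sup>+x. g x ^ 2 \<partial>M) \<le> ennreal B"
    and "A \<ge> 0" "B \<ge> 0"
  shows "(\<integral>\<^sup>+x. f x * g x \<partial>M) \<le> ennreal (sqrt (A * B))"
proof (rule ennreal_le_sqrt)
  have "(\<integral>\<^sup>+x. f x * g x \<partial>M)\<^sup>2 \<le> (\<integral>\<^sup>+x. f x ^ 2 \<partial>M) * (\<integral>\<^sup>+x. g x ^ 2 \<partial>M)"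
    by (rule Cauchy_Schwarz_nn_integral) measurable
  also have "\<dots> \<le> ennreal A * ennreal B" using f g by (rule mult_mono) auto
  also have "\<dots> = ennreal (A * B)" using assms by (simp add: ennreal_mult)
  finally show "(\<integral>\<^sup>+x. f x * g x \<partial>M)\<^sup>2 \<le> ennreal (A * B)" .
qed (use assms in simp)

text \<open>One term of the sum suffices: the least \<open>j\<close> with
  \<open>u \<le> 2 ^ j\<close>. If \<open>j > 0\<close>, minimality gives
  \<open>2 ^ j \<le> 2 * u\<close>, which is why the weight contains \<open>2 * u\<close> and not
  \<open>u\<close>.\<close>

lemma dyadic_weight_le:
  fixes u \<sigma> :: real
  assumes "u \<ge> 0" "\<sigma> > 0"
  shows "ennreal (1 / (1 + (2 * u) powr \<sigma>)) \<le> (\<Sum>j. ennreal (2 powr (- \<sigma> * real j)) * indicator {v. v \<le> 2 ^ j} u)"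
proof -
  have "\<exists>j. u \<le> 2 ^ j" by (metis real_arch_pow linorder_le_less_linear one_less_numeral_iff order_less_imp_le semiring_norm(76))
  define j where "j = (LEAST j. u \<le> 2 ^ j)"
  have j: "u \<le> 2 ^ j" unfolding j_def by (rule LeastI_ex) fact
  have "1 / (1 + (2 * u) powr \<sigma>) \<le> 2 powr (- \<sigma> * real j)"
  proof (cases j)
    case 0
    then show ?thesis by (simp add: divide_simps add_pos_nonneg)
  next
    case (Suc i)
    have "\<not> u \<le> 2 ^ i" using Suc not_less_Least[of i "\<lambda>j. u \<le> 2 ^ j"] by (auto simp: j_def)
    then have "2 ^ j \<le> 2 * u" using Suc by simp
    then have "(2 ^ j) powr \<sigma> \<le> (2 * u) powr \<sigma>" using assms by (intro powr_mono2) auto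
    moreover have "(2 ^ j) powr \<sigma> = 2 powr (\<sigma> * real j)"
      by (simp add: powr_powr mult.commute flip: powr_realpow)
    ultimately have "2 powr (\<sigma> * real j) \<le> 1 + (2 * u) powr \<sigma>" by simp
    then show ?thesis by (simp add: powr_minus field_simps add_pos_nonneg)
  qed
  then have "ennreal (1 / (1 + (2 * u) powr \<sigma>)) \<le> ennreal (2 powr (- \<sigma> * real j)) * indicator {v. v \<le> 2 ^ j} u"
    using j by (simp add: ennreal_leI)
  also have "\<dots> \<le> (\<Sum>j. ennreal (2 powr (- \<sigma> * real j)) * indicator {v. v \<le> 2 ^ j} u)"
  proof -
    have "sum f {j} \<le> suminf f" for f :: "nat \<Rightarrow> ennreal"
      by (rule sum_le_suminf) auto
    from this[of "\<lambda>j. ennreal (2 powr (- \<sigma> * real j)) * indicator {v. v \<le> 2 ^ j} u"] show ?thesis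
      by (simp only: sum.insert finite.emptyI sum.empty empty_iff not_False_eq_True add_0_right)
  qed
  finally show ?thesis .
qed

text \<open>In the dyadic sum the term \<open>j\<close> contributes at most
  \<open>2 powr (- \<sigma> * j)\<close> times \<open>pi * n * 4 ^ j\<close>. This is a geometric
  series of ratio \<open>2 powr (2 - \<sigma>)\<close>, convergent because
  \<open>\<sigma> > 2\<close>.\<close>

lemma mean_valent_weighted_area:
  fixes a u :: "'a \<Rightarrow> real"
  assumes [measurable]: "a \<in> borel_measurable N" "u \<in> borel_measurable N"
    and u: "\<And>x. u x \<ge> 0" and \<sigma>: "\<sigma> > 2" and n: "n \<ge> 0"
    and mv: "\<And>R. R > 0 \<Longrightarrow> (\<integral>\<^sup>+x. ennreal ((a x)\<^sup>2) * indicator {y. y \<le> R} (u x) \<partial>N) \<le> ennreal (pi * n * R\<^sup>2)"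
  shows "(\<integral>\<^sup>+x. ennreal ((a x)\<^sup>2 / (1 + (2 * u x) powr \<sigma>)) \<partial>N) \<le> ennreal (pi * n / (1 - 2 powr (2 - \<sigma>)))"
proof -
  let ?I = "\<lambda>j x. indicator {y. y \<le> (2::real) ^ j} (u x) :: ennreal"
  have "(\<integral>\<^sup>+x. ennreal ((a x)\<^sup>2 / (1 + (2 * u x) powr \<sigma>)) \<partial>N)
     \<le> (\<integral>\<^sup>+x. (\<Sum>j. ennreal (2 powr (- \<sigma> * real j)) * (ennreal ((a x)\<^sup>2) * ?I j x)) \<partial>N)"
  proof (rule nn_integral_mono)
    fix x
    have "ennreal ((a x)\<^sup>2 / (1 + (2 * u x) powr \<sigma>)) = ennreal ((a x)\<^sup>2) * ennreal (1 / (1 + (2 * u x) powr \<sigma>))"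
      by (simp add: field_simps add_pos_nonneg flip: ennreal_mult)
    also have "\<dots> \<le> ennreal ((a x)\<^sup>2) * (\<Sum>j. ennreal (2 powr (- \<sigma> * real j)) * ?I j x)"
      using dyadic_weight_le[OF u, of \<sigma> x] \<sigma> by (intro mult_left_mono) auto
    also have "\<dots> = (\<Sum>j. ennreal (2 powr (- \<sigma> * real j)) * (ennreal ((a x)\<^sup>2) * ?I j x))"
      by (subst ennreal_suminf_cmult[symmetric]) (simp add: mult_ac)
    finally show "ennreal ((a x)\<^sup>2 / (1 + (2 * u x) powr \<sigma>)) \<le> (\<Sum>j. ennreal (2 powr (- \<sigma> * real j)) * (ennreal ((a x)\<^sup>2) * ?I j x))" .
  qed
  also have "\<dots> = (\<Sum>j. ennreal (2 powr (- \<sigma> * real j)) * (\<integral>\<^sup>+x. ennreal ((a x)\<^sup>2) * ?I j x \<partial>N))"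
    by (subst nn_integral_suminf) (simp_all add: nn_integral_cmult)
  also have "\<dots> \<le> (\<Sum>j. ennreal (pi * n * (2 powr (2 - \<sigma>)) ^ j))"
  proof (rule suminf_le)
    fix j
    have "ennreal (2 powr (- \<sigma> * real j)) * (\<integral>\<^sup>+x. ennreal ((a x)\<^sup>2) * ?I j x \<partial>N)
      \<le> ennreal (2 powr (- \<sigma> * real j)) * ennreal (pi * n * (2 ^ j)\<^sup>2)"
      by (intro mult_left_mono mv) auto
    also have "\<dots> = ennreal (pi * n * (2 powr (2 - \<sigma>)) ^ j)"
    proof -
      have "2 powr (- \<sigma> * real j) * (2 ^ j)\<^sup>2 = (2 powr (2 - \<sigma>)) ^ j"
        by (simp add: powr_powr powr_add[symmetric] algebra_simps flip: powr_realpow power_mult)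
      then show ?thesis using n by (simp add: mult_ac flip: ennreal_mult)
    qed
    finally show "ennreal (2 powr (- \<sigma> * real j)) * (\<integral>\<^sup>+x. ennreal ((a x)\<^sup>2) * ?I j x \<partial>N)
      \<le> ennreal (pi * n * (2 powr (2 - \<sigma>)) ^ j)" .
  qed auto
  also have "\<dots> = ennreal (pi * n / (1 - 2 powr (2 - \<sigma>)))"
  proof (rule suminf_ennreal_eq)
    have "2 powr (2 - \<sigma>) < (1::real)" using \<sigma> by (simp add: powr_less_one)
    then have "(\<lambda>j. (2 powr (2 - \<sigma>)) ^ j) sums (1 / (1 - 2 powr (2 - \<sigma>)))"
      by (intro geometric_sums) auto
    from sums_mult[OF this, of "pi * n"] show "(\<lambda>j. pi * n * (2 powr (2 - \<sigma>)) ^ j) sums (pi * n / (1 - 2 powr (2 - \<sigma>)))"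
      by simp
  qed (use n in auto)
  finally show ?thesis .
qed

text \<open>The splitting argument, separated from complex analysis: \<open>a\<close> stands for
  |F'|, \<open>u\<close> for |F|, \<open>w\<close> for the weight coming from the conformal map,
  \<open>s\<close> for the distance to the boundary and \<open>k\<close> for (1 + |F|^2)^(q/2-1).
  \<open>H0\<close> and \<open>H1\<close> are the two Cauchy-Schwarz factors for
  \<open>s \<ge> \<alpha>\<close>; \<open>mv\<close> and \<open>H2\<close> yield those for
  \<open>s < \<alpha>\<close>, and \<open>H3\<close> replaces \<open>H2\<close> when
  \<open>n < 1\<close>.\<close>

lemma nn_integral_le_sqrt_ln:
  fixes a u w s k :: "'a \<Rightarrow> real"
  assumes [measurable]: "a \<in> borel_measurable N" "u \<in> borel_measurable N" "w \<in> borel_measurable N"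
      "s \<in> borel_measurable N" "k \<in> borel_measurable N"
    and nonneg: "\<And>x. a x \<ge> 0" "\<And>x. u x \<ge> 0" "\<And>x. w x \<ge> 0" "\<And>x. k x > 0"
    and s: "\<And>x. x \<in> space N \<Longrightarrow> s x > 0"
    and c: "c0 \<ge> 0" "c1 \<ge> 0" "c2 \<ge> 0" and \<sigma>: "\<sigma> > 2" and \<eta>: "\<eta> > 0" and n: "n > 0"
    and mv: "\<And>R. R > 0 \<Longrightarrow> (\<integral>\<^sup>+x. ennreal ((a x)\<^sup>2) * indicator {y. y \<le> R} (u x) \<partial>N) \<le> ennreal (pi * n * R\<^sup>2)"
    and H0: "(\<integral>\<^sup>+x. ennreal (s x * k x * (a x)\<^sup>2) \<partial>N) \<le> ennreal c0"
    and H1: "\<And>\<alpha>. 0 < \<alpha> \<Longrightarrow> \<alpha> \<le> 1 \<Longrightarrow>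
        (\<integral>\<^sup>+x. ennreal ((w x)\<^sup>2 / (s x * k x)) * indicator {\<alpha>..} (s x) \<partial>N) \<le> ennreal (c1 * (1 - ln \<alpha>))"
    and H2: "\<And>\<alpha>. 0 < \<alpha> \<Longrightarrow> \<alpha> \<le> 1 \<Longrightarrow>
        (\<integral>\<^sup>+x. ennreal ((w x)\<^sup>2 * (1 + (2 * u x) powr \<sigma>)) * indicator {..<\<alpha>} (s x) \<partial>N) \<le> ennreal (c2 * \<alpha> powr \<eta>)"
    and H3: "(\<integral>\<^sup>+x. ennreal ((w x)\<^sup>2 * (1 + (2 * u x) powr \<sigma>)) \<partial>N) \<le> ennreal c2"
  shows "(\<integral>\<^sup>+x. ennreal (a x * w x) \<partial>N)
    \<le> ennreal ((sqrt (c0 * c1 * (2 + 1 / \<eta>)) + sqrt (2 * pi * c2 / (1 - 2 powr (2 - \<sigma>)))) * sqrt (ln (n + 1)))"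
proof -
  define K where "K = 1 / (1 - 2 powr (2 - \<sigma>))"
  have "2 powr (2 - \<sigma>) < (1::real)" using \<sigma> by (simp add: powr_less_one)
  then have K: "K > 0" by (simp add: K_def)
  \<comment> \<open>Applied below with \<open>E = {..<\<alpha>}\<close> for \<open>n \<ge> 1\<close>
    and with \<open>E = UNIV\<close> for \<open>n < 1\<close>.\<close>
  have outer: "(\<integral>\<^sup>+x. ennreal (a x * w x) * indicator E (s x) \<partial>N) \<le> ennreal (sqrt ((pi * n * K) * B))"
    if [measurable]: "E \<in> sets borel" and B: "B \<ge> 0" 
      "(\<integral>\<^sup>+x. ennreal ((w x)\<^sup>2 * (1 + (2 * u x) powr \<sigma>)) * indicator E (s x) \<partial>N) \<le> ennreal B" for E B
  proof -
    let ?v = "\<lambda>x. sqrt (1 + (2 * u x) powr \<sigma>)"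
    have v: "?v x > 0" for x by (simp add: add_pos_nonneg)
    have v2: "(?v x)\<^sup>2 = 1 + (2 * u x) powr \<sigma>" for x by (simp add: add_nonneg_nonneg)
    have "(\<integral>\<^sup>+x. ennreal (a x * w x) * indicator E (s x) \<partial>N)
      = (\<integral>\<^sup>+x. ennreal (a x / ?v x) * (ennreal (w x * ?v x) * indicator E (s x)) \<partial>N)"
    proof (rule nn_integral_cong)
      fix x
      have "ennreal (a x * w x) = ennreal (a x / ?v x) * ennreal (w x * ?v x)"
        using v[of x] nonneg by (subst ennreal_mult[symmetric]) auto
      then show "ennreal (a x * w x) * indicator E (s x) = ennreal (a x / ?v x) * (ennreal (w x * ?v x) * indicator E (s x))"
        by (simp add: mult.assoc)
    qed
    also have "\<dots> \<le> ennreal (sqrt ((pi * n * K) * B))"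
    proof (rule nn_integral_mult_le_sqrt)
      show "(\<integral>\<^sup>+x. (ennreal (a x / ?v x))\<^sup>2 \<partial>N) \<le> ennreal (pi * n * K)"
        using mean_valent_weighted_area[OF assms(1,2) nonneg(2) \<sigma> _ mv] n v nonneg
        by (simp add: ennreal_power power_divide v2 K_def del: real_sqrt_pow2_iff)
      have "(ennreal (w x * ?v x) * indicator E (s x))\<^sup>2 = ennreal ((w x)\<^sup>2 * (1 + (2 * u x) powr \<sigma>)) * indicator E (s x)" for x
        using v[of x] nonneg(3)[of x] by (simp add: power_mult_distrib ennreal_power v2 indicator_def del: real_sqrt_pow2_iff)
      then show "(\<integral>\<^sup>+x. (ennreal (w x * ?v x) * indicator E (s x))\<^sup>2 \<partial>N) \<le> ennreal B"
        using B(2) by simp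
    qed (use n K B in auto)
    finally show ?thesis .
  qed
  have inner: "(\<integral>\<^sup>+x. ennreal (a x * w x) * indicator {\<alpha>..} (s x) \<partial>N) \<le> ennreal (sqrt (c0 * (c1 * (1 - ln \<alpha>))))"
    if \<alpha>: "0 < \<alpha>" "\<alpha> \<le> 1" for \<alpha>
  proof -
    let ?v = "\<lambda>x. sqrt (s x * k x)"
    have "ln \<alpha> \<le> 0" using \<alpha> by simp
    then have "ln \<alpha> \<le> 1" by linarith
    have v: "?v x > 0" if "x \<in> space N" for x using s[OF that] nonneg by simp
    have v2: "(?v x)\<^sup>2 = s x * k x" if "x \<in> space N" for x using v[OF that] by simp
    have "(\<integral>\<^sup>+x. ennreal (a x * w x) * indicator {\<alpha>..} (s x) \<partial>N)
      = (\<integral>\<^sup>+x. ennreal (a x * ?v x) * (ennreal (w x / ?v x) * indicator {\<alpha>..} (s x)) \<partial>N)"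
    proof (rule nn_integral_cong)
      fix x assume x: "x \<in> space N"
      have "ennreal (a x * w x) = ennreal (a x * ?v x) * ennreal (w x / ?v x)"
        using v[OF x] nonneg by (subst ennreal_mult[symmetric]) auto
      then show "ennreal (a x * w x) * indicator {\<alpha>..} (s x) = ennreal (a x * ?v x) * (ennreal (w x / ?v x) * indicator {\<alpha>..} (s x))"
        by (simp add: mult.assoc)
    qed
    also have "\<dots> \<le> ennreal (sqrt (c0 * (c1 * (1 - ln \<alpha>))))"
    proof (rule nn_integral_mult_le_sqrt)
      have "(\<integral>\<^sup>+x. (ennreal (a x * ?v x))\<^sup>2 \<partial>N) = (\<integral>\<^sup>+x. ennreal (s x * k x * (a x)\<^sup>2) \<partial>N)"
      proof (rule nn_integral_cong)
        fix x assume x: "x \<in> space N"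
        show "(ennreal (a x * ?v x))\<^sup>2 = ennreal (s x * k x * (a x)\<^sup>2)"
        proof -
          have "(a x * ?v x)\<^sup>2 = s x * k x * (a x)\<^sup>2"
            unfolding power_mult_distrib v2[OF x] by (rule mult.commute)
          then show ?thesis
            using v[OF x] nonneg(1)[of x] by (simp only: ennreal_power mult_nonneg_nonneg less_imp_le)
        qed
      qed
      then show "(\<integral>\<^sup>+x. (ennreal (a x * ?v x))\<^sup>2 \<partial>N) \<le> ennreal c0" using H0 by simp
      have "(\<integral>\<^sup>+x. (ennreal (w x / ?v x) * indicator {\<alpha>..} (s x))\<^sup>2 \<partial>N)
         = (\<integral>\<^sup>+x. ennreal ((w x)\<^sup>2 / (s x * k x)) * indicator {\<alpha>..} (s x) \<partial>N)"
      proof (rule nn_integral_cong)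
        fix x assume x: "x \<in> space N"
        have "(ennreal (w x / ?v x))\<^sup>2 = ennreal ((w x)\<^sup>2 / (s x * k x))"
          using v[OF x] nonneg(3)[of x] by (simp only: ennreal_power divide_nonneg_nonneg less_imp_le power_divide v2[OF x])
        then show "(ennreal (w x / ?v x) * indicator {\<alpha>..} (s x))\<^sup>2 = ennreal ((w x)\<^sup>2 / (s x * k x)) * indicator {\<alpha>..} (s x)"
          by (simp add: power_mult_distrib indicator_def)
      qed
      then show "(\<integral>\<^sup>+x. (ennreal (w x / ?v x) * indicator {\<alpha>..} (s x))\<^sup>2 \<partial>N) \<le> ennreal (c1 * (1 - ln \<alpha>))"
        using H1[OF \<alpha>] by simp
    qed (use c \<open>ln \<alpha> \<le> 1\<close> in \<open>auto intro!: mult_nonneg_nonneg\<close>)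
    finally show ?thesis .
  qed
  let ?L = "ln (n + 1)"
  have L: "?L > 0" using n by simp
  have eq: "(sqrt (c0 * c1 * (2 + 1 / \<eta>)) + sqrt (2 * pi * c2 / (1 - 2 powr (2 - \<sigma>)))) * sqrt ?L
     = sqrt (c0 * c1 * (2 + 1 / \<eta>) * ?L) + sqrt (2 * pi * c2 * K * ?L)"
    by (subst distrib_right, simp only: real_sqrt_mult[symmetric] K_def) (simp add: field_simps)
  show ?thesis
  proof (cases "n \<ge> 1")
    case False
    \<comment> \<open>As \<open>n\<close> tends to 0 the bound must decay like the square root of
      \<open>n\<close>. The estimate \<open>outer\<close> carries this factor and
      \<open>inner\<close> does not, so \<open>outer\<close> alone is used here.\<close>
    have "n \<le> 2 * ?L"
    proof -
      have "n * 1 \<le> n * (2 / (n + 1))" using n False by (intro mult_left_mono) (auto simp: field_simps)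
      also have "\<dots> = 2 * (1 - inverse (n + 1))" using n by (simp add: field_simps)
      also have "\<dots> \<le> 2 * ?L" using ln_le_minus_one[of "inverse (n + 1)"] n
        by (simp add: ln_inverse)
      finally show ?thesis by simp
    qed
    have "(\<integral>\<^sup>+x. ennreal (a x * w x) \<partial>N) \<le> ennreal (sqrt ((pi * n * K) * c2))"
      using outer[of UNIV c2] H3 c by simp
    also have "\<dots> \<le> ennreal (sqrt (2 * pi * c2 * K * ?L))"
    proof (intro ennreal_leI real_sqrt_le_mono)
      have "pi * c2 * K * n \<le> pi * c2 * K * (2 * ?L)"
        using \<open>n \<le> 2 * ?L\<close> c K by (intro mult_left_mono) auto
      then show "pi * n * K * c2 \<le> 2 * pi * c2 * K * ?L" by (simp add: mult_ac)
    qed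
    also have "\<dots> \<le> ennreal (sqrt (c0 * c1 * (2 + 1 / \<eta>) * ?L) + sqrt (2 * pi * c2 * K * ?L))"
      using c \<eta> L by (intro ennreal_leI) (auto intro!: mult_nonneg_nonneg)
    finally show ?thesis unfolding eq .
  next
    case True
    \<comment> \<open>Chosen so that \<open>n * \<alpha> powr \<eta> = 1\<close>: the part near the
      boundary becomes bounded, while \<open>- ln \<alpha>\<close> is still only a multiple of
      \<open>ln n\<close>.\<close>
    define \<alpha> where "\<alpha> = n powr (- (1 / \<eta>))"
    have \<alpha>: "0 < \<alpha>" "\<alpha> \<le> 1" using True \<eta> powr_mono[of "- (1 / \<eta>)" 0 n]
      by (auto simp: \<alpha>_def)
    have ln\<alpha>: "ln \<alpha> = - ln n / \<eta>" using n by (simp add: \<alpha>_def ln_powr)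
    have "\<alpha> powr \<eta> = n powr (-1)" using \<eta> by (simp only: \<alpha>_def powr_powr) simp
    then have "\<alpha> powr \<eta> = 1 / n" using n by (simp add: powr_minus_divide)
    \<comment> \<open>Since ln(n + 1) is at least 1/2, constants can be absorbed into it; this is
      the 2 in \<open>2 + 1 / \<eta>\<close> and in \<open>2 * pi * c2\<close>.\<close>
    have "1/2 \<le> ln (2::real)" using ln_le_minus_one[of "1 / 2 :: real"] by (simp add: ln_div)
    also have "ln 2 \<le> ?L" using True by simp
    finally have L2: "1 \<le> 2 * ?L" by simp
    have "(\<integral>\<^sup>+x. ennreal (a x * w x) \<partial>N) = 
      (\<integral>\<^sup>+x. ennreal (a x * w x) * indicator {\<alpha>..} (s x) + ennreal (a x * w x) * indicator {..<\<alpha>} (s x) \<partial>N)"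
      by (intro nn_integral_cong) (auto simp: indicator_def)
    also have "\<dots> = (\<integral>\<^sup>+x. ennreal (a x * w x) * indicator {\<alpha>..} (s x) \<partial>N) + (\<integral>\<^sup>+x. ennreal (a x * w x) * indicator {..<\<alpha>} (s x) \<partial>N)"
      by (rule nn_integral_add) measurable
    also have "\<dots> \<le> ennreal (sqrt (c0 * (c1 * (1 - ln \<alpha>)))) + ennreal (sqrt ((pi * n * K) * (c2 * \<alpha> powr \<eta>)))"
      by (intro add_mono inner outer \<alpha> H2) (use c in auto)
    also have "\<dots> \<le> ennreal (sqrt (c0 * c1 * (2 + 1 / \<eta>) * ?L)) + ennreal (sqrt (2 * pi * c2 * K * ?L))"
    proof (intro add_mono ennreal_leI real_sqrt_le_mono)
      have "ln n / \<eta> \<le> ?L / \<eta>" using n \<eta> by (intro divide_right_mono) auto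
      then have "1 - ln \<alpha> \<le> (2 + 1 / \<eta>) * ?L"
        unfolding ln\<alpha> using L2 by (simp add: algebra_simps)
      then have "c0 * c1 * (1 - ln \<alpha>) \<le> c0 * c1 * ((2 + 1 / \<eta>) * ?L)"
        using c by (intro mult_left_mono) auto
      then show "c0 * (c1 * (1 - ln \<alpha>)) \<le> c0 * c1 * (2 + 1 / \<eta>) * ?L" by (simp add: mult_ac)
      have "pi * n * K * (c2 * \<alpha> powr \<eta>) = pi * K * c2 * 1" using n by (simp add: \<open>\<alpha> powr \<eta> = 1 / n\<close>)
      also have "\<dots> \<le> pi * K * c2 * (2 * ?L)" using L2 c K by (intro mult_left_mono) auto
      finally show "pi * n * K * (c2 * \<alpha> powr \<eta>) \<le> 2 * pi * c2 * K * ?L" by (simp add: mult_ac)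
    qed
    also have "\<dots> = ennreal (sqrt (c0 * c1 * (2 + 1 / \<eta>) * ?L) + sqrt (2 * pi * c2 * K * ?L))"
      using c \<eta> L K by (intro ennreal_plus[symmetric]) (auto intro!: mult_nonneg_nonneg)
    finally show ?thesis unfolding eq .
  qed
qed

subsection \<open>Growth of functions with bounded means\<close>

text \<open>The classical kernel up to the factor 1/(2 pi): the denominator is the squared distance
  from \<open>cis t\<close> to \<open>z\<close>. It is written through
  \<open>1 - cnj z * cis t\<close> because that expression is holomorphic in \<open>cis t\<close>,
  which lets the Poisson formula follow from Cauchy's.\<close>

definition poisson_kernel :: "complex \<Rightarrow> real \<Rightarrow> real" where
  "poisson_kernel z t = (1 - (norm z)\<^sup>2) / (norm (1 - cnj z * cis t))\<^sup>2"

lemma norm_one_minus_cnj_cis_ge: "norm (1 - cnj z * cis t) \<ge> 1 - norm z"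
  using norm_triangle_ineq2[of 1 "cnj z * cis t"] by (simp add: norm_mult)

lemma poisson_kernel_nonneg: "norm z < 1 \<Longrightarrow> poisson_kernel z t \<ge> 0"
  unfolding poisson_kernel_def by (intro divide_nonneg_nonneg) (simp_all add: power_le_one)

lemma poisson_kernel_le: 
  assumes "norm z < 1" 
  shows "poisson_kernel z t \<le> 2 / (1 - norm z)"
proof -
  have pos: "0 < 1 - norm z" using assms by simp
  have "poisson_kernel z t \<le> (1 - (norm z)\<^sup>2) / (1 - norm z)\<^sup>2"
    unfolding poisson_kernel_def using norm_one_minus_cnj_cis_ge[of z t] pos
    by (intro divide_left_mono power_mono mult_pos_pos zero_less_power less_le_trans[OF pos]) (simp_all add: power_le_one)
  also have "\<dots> = (1 + norm z) / (1 - norm z)"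
    using pos by (simp add: divide_simps power2_eq_square) (simp add: algebra_simps)
  also have "\<dots> \<le> 2 / (1 - norm z)" using assms by (intro divide_right_mono) auto
  finally show ?thesis .
qed

lemma continuous_on_poisson_kernel: 
  assumes "norm z < 1" shows "continuous_on A (poisson_kernel z)"
proof -
  have "norm (1 - cnj z * cis t) \<noteq> 0" for t using norm_one_minus_cnj_cis_ge[of z t] assms by linarith
  then show ?thesis unfolding poisson_kernel_def by (intro continuous_intros) auto
qed

text \<open>Cauchy's formula at \<open>z\<close> for \<open>\<lambda>w. g w (1 - |z|\<^sup>2) / (1 - cnj z w)\<close>.\<close>

lemma poisson_formula:
  fixes g :: "complex \<Rightarrow> complex"
  assumes g: "g holomorphic_on cball 0 1" and z: "norm z < 1"
  shows "((\<lambda>t. g (cis t) * of_real (poisson_kernel z t)) has_integral (2 * pi * g z)) {0..2*pi}"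
proof -
  define h where "h = (\<lambda>w. g w * (1 - (norm z)\<^sup>2) / (1 - cnj z * w))"
  have nz: "1 - cnj z * w \<noteq> 0" if "norm w \<le> 1" for w
  proof
    assume "1 - cnj z * w = 0"
    then have "norm (cnj z * w) = 1" by simp
    moreover have "norm (cnj z * w) \<le> norm z" using that by (simp add: norm_mult mult_left_le)
    ultimately show False using z by simp
  qed
  have "h holomorphic_on cball 0 1" unfolding h_def using g nz by (intro holomorphic_intros) auto
  then have "((\<lambda>u. h u / (u - z)) has_contour_integral (2 * of_real pi * \<i> * h z)) (part_circlepath 0 1 0 (2*pi))"
    using Cauchy_integral_circlepath_simple[of h 0 1 z] z by (simp add: circlepath_def)
  then have "((\<lambda>t. h (cis t) / (cis t - z) * \<i> * cis t) has_integral (2 * of_real pi * \<i> * h z)) {0..2*pi}"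
    by (subst (asm) has_contour_integral_part_circlepath_iff) (simp_all add: mult_ac)
  moreover have "h z = g z"
  proof -
    have "1 - cnj z * z \<noteq> 0" using nz z by simp
    moreover have "cnj z * z = of_real ((norm z)\<^sup>2)" by (metis complex_norm_square mult.commute)
    ultimately show ?thesis by (simp add: h_def)
  qed
  moreover have "h (cis t) / (cis t - z) * \<i> * cis t = \<i> * (g (cis t) * of_real (poisson_kernel z t))" for t
  proof -
    let ?c = "cis t"
    have c: "?c * cnj ?c = 1" by (simp add: complex_norm_square[symmetric])
    \<comment> \<open>On the unit circle the Cauchy denominator \<open>?c - z\<close> is the
      conjugate of \<open>1 - cnj z * ?c\<close> times \<open>?c\<close>. With the denominator of
      \<open>h\<close> it forms the squared modulus of the Poisson kernel.\<close>
    have "cnj (1 - cnj z * ?c) * ?c = ?c - z * (?c * cnj ?c)" by (simp add: algebra_simps)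
    then have e1: "?c - z = cnj (1 - cnj z * ?c) * ?c" by (simp add: c)
    have n2: "(1 - cnj z * ?c) * cnj (1 - cnj z * ?c) = of_real ((norm (1 - cnj z * ?c))\<^sup>2)"
      by (simp only: complex_norm_square)
    have nz1: "1 - cnj z * ?c \<noteq> 0" using nz by simp
    then have nz2: "cnj (1 - cnj z * ?c) \<noteq> 0" by (metis complex_cnj_zero_iff)
    have "h ?c / (?c - z) * \<i> * ?c = \<i> * (g ?c * (of_real (1 - (norm z)\<^sup>2) / ((1 - cnj z * ?c) * cnj (1 - cnj z * ?c))))"
      unfolding e1 h_def using nz1 nz2 by (simp add: divide_simps del: complex_cnj_diff)
    then show ?thesis unfolding n2 poisson_kernel_def by simp
  qed
  ultimately have "((\<lambda>t. \<i> * (g (cis t) * of_real (poisson_kernel z t))) has_integral (\<i> * (2 * pi * g z))) {0..2*pi}"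
    by (simp add: mult_ac)
  from has_integral_mult_right[OF this, of "- \<i>"] show ?thesis by (simp add: mult.assoc[symmetric])
qed

text \<open>
  Replaces Jensen's inequality in the growth estimate: integrated against the Poisson kernel, with
  \<open>l = (1 - |z|)\<^bsup>-1/p\<^esup>\<close>, it gives the sharp exponent.
\<close>

lemma powr_young:
  fixes t l p :: real
  assumes "t \<ge> 0" "l > 0" "p \<ge> 1"
  shows "t \<le> l + l powr (1 - p) * t powr p"
proof (cases "t \<le> l")
  case True
  then show ?thesis by (simp add: add_increasing2)
next
  case False
  then have "t = t powr (1 - p) * t powr p" using assms by (simp add: powr_add[symmetric])
  also have "\<dots> \<le> l powr (1 - p) * t powr p"
    using False assms by (intro mult_right_mono powr_mono2') auto
  finally show ?thesis using assms by simp
qed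

text \<open>Insert \<open>powr_young\<close> under the Poisson integral with
  \<open>l = d powr (- (1 / p))\<close>, \<open>d = 1 - norm z\<close>. The first summand integrates
  to \<open>2 * pi * l\<close>, as the Poisson formula for the constant 1 shows. In the second the
  kernel is at most \<open>2 / d\<close>, and \<open>l powr (1 - p) * (2 / d) = 2 * l\<close>.
  Together they give the constant 3.\<close>

lemma growth_on_closed_disc:
  assumes g: "g holomorphic_on cball 0 1" and z: "norm z < 1" and p: "p \<ge> 1"
    and I: "integral {0..2*pi} (\<lambda>t. norm (g (cis t)) powr p) \<le> 2 * pi"
  shows "norm (g z) \<le> 3 * (1 - norm z) powr (- (1 / p))"
proof -
  define d where "d = 1 - norm z"
  define l where "l = d powr (- (1 / p))"
  have d: "d > 0" "l > 0" using z by (auto simp: d_def l_def)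
  have contg: "continuous_on {0..2*pi} (\<lambda>t. g (cis t))"
    by (rule continuous_on_compose2[OF holomorphic_on_imp_continuous_on[OF g]]) (auto intro!: continuous_intros)
  note contP = continuous_on_poisson_kernel[OF z, of "{0..2*pi}"]
  have intp: "(\<lambda>t. norm (g (cis t)) powr p) integrable_on {0..2*pi}"
    using p by (intro integrable_continuous_real continuous_on_powr' continuous_intros contg) auto
  have P1: "(poisson_kernel z has_integral 2 * pi) {0..2*pi}"
  proof -
    from has_integral_Re[OF poisson_formula[of "\<lambda>_. 1", OF _ z]] show ?thesis by simp
  qed
  have "2 * pi * norm (g z) = norm (integral {0..2*pi} (\<lambda>t. g (cis t) * of_real (poisson_kernel z t)))"
    using integral_unique[OF poisson_formula[OF g z]] by (simp add: norm_mult)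
  also have "\<dots> \<le> integral {0..2*pi} (\<lambda>t. l * poisson_kernel z t + l powr (1 - p) * (2 / d) * norm (g (cis t)) powr p)"
  proof (rule integral_norm_bound_integral)
    show "(\<lambda>t. g (cis t) * of_real (poisson_kernel z t)) integrable_on {0..2*pi}"
      using poisson_formula[OF g z] by blast
    show "(\<lambda>t. l * poisson_kernel z t + l powr (1 - p) * (2 / d) * norm (g (cis t)) powr p) integrable_on {0..2*pi}"
      using P1 intp by (intro integrable_add integrable_on_mult_right) auto
    fix t
    have "norm (g (cis t) * of_real (poisson_kernel z t)) = norm (g (cis t)) * poisson_kernel z t"
      using poisson_kernel_nonneg[OF z] by (simp add: norm_mult)
    also have "\<dots> \<le> (l + l powr (1 - p) * norm (g (cis t)) powr p) * poisson_kernel z t"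
      using powr_young[of "norm (g (cis t))" l p] d p poisson_kernel_nonneg[OF z] by (intro mult_right_mono) auto
    also have "\<dots> = l * poisson_kernel z t + l powr (1 - p) * norm (g (cis t)) powr p * poisson_kernel z t"
      by (simp add: algebra_simps)
    also have "\<dots> \<le> l * poisson_kernel z t + l powr (1 - p) * norm (g (cis t)) powr p * (2 / d)"
      using poisson_kernel_le[OF z, of t] by (intro add_left_mono mult_left_mono) (auto simp: d_def)
    finally show "norm (g (cis t) * of_real (poisson_kernel z t))
        \<le> l * poisson_kernel z t + l powr (1 - p) * (2 / d) * norm (g (cis t)) powr p"
      by (simp add: mult_ac)
  qed
  also have "\<dots> = l * (2 * pi) + l powr (1 - p) * (2 / d) * integral {0..2*pi} (\<lambda>t. norm (g (cis t)) powr p)"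
  proof -
    have "((\<lambda>t. l * poisson_kernel z t + l powr (1 - p) * (2 / d) * norm (g (cis t)) powr p) has_integral
      (l * (2 * pi) + l powr (1 - p) * (2 / d) * integral {0..2*pi} (\<lambda>t. norm (g (cis t)) powr p))) {0..2*pi}"
      by (intro has_integral_add has_integral_mult_right P1 integrable_integral intp)
    then show ?thesis by (rule integral_unique)
  qed
  also have "\<dots> \<le> l * (2 * pi) + l powr (1 - p) * (2 / d) * (2 * pi)"
    using I d by (intro add_left_mono mult_left_mono) auto
  also have "l powr (1 - p) * (2 / d) = 2 * l"
  proof -
    have "l powr (1 - p) = d powr (- (1 / p) + 1)"
    proof -
      have "- (1 / p) * (1 - p) = - (1 / p) + 1" using p by (simp add: field_simps)
      then show ?thesis by (simp only: l_def powr_powr)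
    qed
    also have "\<dots> = l * d" using d unfolding powr_add l_def by simp
    finally show ?thesis using d by simp
  qed
  finally have "2 * pi * norm (g z) \<le> 2 * pi * (3 * l)" by simp
  then show ?thesis by (simp add: l_def d_def)
qed

text \<open>Dilation by the midpoint \<open>R\<close> of \<open>norm z\<close> and 1 makes the
  function holomorphic on the closed disc and at worst halves the distance of the point to the
  circle. This costs \<open>2 powr (1 / p) \<le> 2\<close>, so 3 becomes 6.\<close>

lemma growth_of_bounded_means:
  assumes g: "g holomorphic_on ball 0 1" and z: "norm z < 1" and p: "p \<ge> 1"
    and I: "\<And>r. 0 < r \<Longrightarrow> r < 1 \<Longrightarrow> integral {0..2*pi} (\<lambda>t. norm (g (rcis r t)) powr p) \<le> 2 * pi"
  shows "norm (g z) \<le> 6 * (1 - norm z) powr (- (1 / p))"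
proof -
  define R where "R = (1 + norm z) / 2"
  have R: "0 < R" "R < 1" "norm z < R" using z norm_ge_zero[of z] unfolding R_def by (simp_all del: norm_ge_zero)
  define h where "h = (\<lambda>w. g (of_real R * w))"
  have "h holomorphic_on cball 0 1"
  proof -
    have "R * norm w < 1" if "norm w \<le> 1" for w :: complex
      using mult_left_le[OF that, of R] R by linarith
    then show ?thesis unfolding h_def
    by (intro holomorphic_on_compose_gen[where f = "\<lambda>w. of_real R * w", unfolded o_def, OF _ g])
      (use R in \<open>auto intro!: holomorphic_intros simp: norm_mult\<close>)
  qed
  moreover have "norm (z / of_real R) < 1" using R by (simp add: norm_divide)
  moreover have "integral {0..2*pi} (\<lambda>t. norm (h (cis t)) powr p) \<le> 2 * pi"
    using I[OF R(1,2)] by (simp add: h_def rcis_def)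
  ultimately have "norm (h (z / of_real R)) \<le> 3 * (1 - norm (z / of_real R)) powr (- (1 / p))"
    using p by (intro growth_on_closed_disc) auto
  also have "h (z / of_real R) = g z" using R by (simp add: h_def)
  also have "(1 - norm (z / of_real R)) powr (- (1 / p)) \<le> ((1 - norm z) / 2) powr (- (1 / p))"
  proof (rule powr_mono2')
    have "(1 - norm z) / 2 = R - norm z" by (simp add: R_def field_simps)
    also have "\<dots> \<le> (R - norm z) / R" using R by (simp add: pos_le_divide_eq mult_left_le)
    also have "\<dots> = 1 - norm (z / of_real R)" using R by (simp add: norm_divide field_simps)
    finally show "(1 - norm z) / 2 \<le> 1 - norm (z / of_real R)" .
  qed (use z p in auto)
  also have "\<dots> = 2 powr (1 / p) * (1 - norm z) powr (- (1 / p))"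
    using z by (simp add: powr_divide powr_minus field_simps)
  also have "\<dots> \<le> 2 * (1 - norm z) powr (- (1 / p))"
    using powr_mono[of "1/p" 1 2] p by (intro mult_right_mono) auto
  finally show ?thesis by simp
qed

subsection \<open>A Hardy-Stein inequality in logarithmic coordinates\<close>

text \<open>\<open>M\<close> is convex and bounded on the negative axis, hence nondecreasing.
  Integrating (X - x) M''(x) by parts over [x0, X] leaves M(X) - M(x0) - (X - x0) M'(x0), which is
  at most M(X). Then X tends to 0 and x0 to minus infinity.\<close>

lemma nn_integral_second_derivative_le:
  fixes M M1 M2 J :: "real \<Rightarrow> real"
  assumes M: "\<And>x. x < 0 \<Longrightarrow> (M has_real_derivative M1 x) (at x)"
    and M1: "\<And>x. x < 0 \<Longrightarrow> (M1 has_real_derivative M2 x) (at x)"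
    and bd: "\<And>x. x < 0 \<Longrightarrow> 0 \<le> M x" "\<And>x. x < 0 \<Longrightarrow> M x \<le> B"
    and J: "\<And>x. 0 \<le> J x" "\<And>x. x < 0 \<Longrightarrow> J x \<le> M2 x"
    and [measurable]: "J \<in> borel_measurable borel"
  shows "(\<integral>\<^sup>+x. ennreal (max 0 (- x) * J x) \<partial>lborel) \<le> ennreal B"
proof -
  have M2: "0 \<le> M2 x" if "x < 0" for x using J[of x] that by linarith
  have mono: "M1 x \<le> M1 y" if "x \<le> y" "y < 0" for x y
  proof (rule DERIV_nonneg_imp_nondecreasing[OF that(1)])
    fix z assume "z \<le> y"
    then show "\<exists>d. (M1 has_real_derivative d) (at z) \<and> 0 \<le> d" using M1[of z] M2[of z] that by auto
  qed
  \<comment> \<open>If \<open>M1 x < 0\<close>, convexity would make \<open>M\<close> unbounded towards \<open>-\<infinity>\<close>.\<close>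
  have M1_nonneg: "0 \<le> M1 x" if x: "x < 0" for x
  proof (rule ccontr)
    assume neg: "\<not> 0 \<le> M1 x"
    have B: "0 \<le> B" using bd[OF x] by linarith
    define y where "y = x - (B + 1) / (- M1 x)"
    have "(B + 1) / (- M1 x) > 0" using neg B by (intro divide_pos_pos) auto
    then have y: "y < x" by (simp add: y_def)
    obtain z where z: "y < z" "z < x" "M x - M y = (x - y) * M1 z"
      using MVT2[OF y, of M M1] M x by force
    have "(x - y) * M1 z \<le> (x - y) * M1 x" using z x y by (intro mult_left_mono mono) auto
    also have "\<dots> = - (B + 1)" using neg by (simp add: y_def)
    finally have "M y \<ge> M x + B + 1" using z by linarith
    then show False using bd(1)[OF x] bd(2)[of y] y x by linarith
  qed
  have main: "(\<integral>\<^sup>+x. ennreal (max 0 (X - x) * J x) * indicator {x0..} x \<partial>lborel) \<le> ennreal B"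
    if x0: "x0 \<le> X" and X: "X < 0" for x0 X
  proof -
    \<comment> \<open>An antiderivative of \<open>(X - x) * M2 x\<close>: the two terms with
      \<open>M1\<close> cancel.\<close>
    define K where "K = (\<lambda>x. (X - x) * M1 x + M x)"
    have "((\<lambda>x. (X - x) * M2 x) has_integral (K X - K x0)) {x0..X}"
    proof (rule fundamental_theorem_of_calculus[OF x0])
      fix x assume "x \<in> {x0..X}"
      then have x: "x < 0" using X by simp
      have "(K has_real_derivative (X - x) * M2 x) (at x)"
        unfolding K_def by (rule derivative_eq_intros M[OF x] M1[OF x] refl)+ (simp add: algebra_simps)
      then show "(K has_vector_derivative (X - x) * M2 x) (at x within {x0..X})"
        by (simp add: has_real_derivative_iff_has_vector_derivative has_vector_derivative_at_within)
    qed
    then have eq: "(\<integral>\<^sup>+x. ennreal (indicator {x0..X} x * ((X - x) * M2 x)) \<partial>lborel) = ennreal (K X - K x0)"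
      using X M2 by (intro nn_integral_has_integral_lebesgue) auto
    have "(\<integral>\<^sup>+x. ennreal (max 0 (X - x) * J x) * indicator {x0..} x \<partial>lborel)
       \<le> (\<integral>\<^sup>+x. ennreal (indicator {x0..X} x * ((X - x) * M2 x)) \<partial>lborel)"
      using J X by (intro nn_integral_mono) (auto simp: indicator_def max_def intro!: ennreal_leI mult_left_mono)
    also have "\<dots> \<le> ennreal B"
    proof -
      have "0 \<le> (X - x0) * M1 x0" using M1_nonneg[of x0] x0 X by (intro mult_nonneg_nonneg) auto
      then have "K X - K x0 \<le> B" using bd(1)[of x0] bd(2)[of X] x0 X by (simp add: K_def)
      then show ?thesis unfolding eq by (rule ennreal_leI)
    qed
    finally show ?thesis .
  qed
  \<comment> \<open>Monotone convergence along X = -1/(m+1) and x0 = -(m+1); both the weight and the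
    domain increase with \<open>m\<close>.\<close>
  define c where "c = (\<lambda>m::nat. inverse (real (Suc m)))"
  define f where "f = (\<lambda>(m::nat) x. ennreal (max 0 (- c m - x) * J x) * indicator {- real (Suc m)..} x)"
  have c0: "c \<longlonglongrightarrow> 0" unfolding c_def by (rule LIMSEQ_inverse_real_of_nat)
  have cdec: "c n \<le> c m" if "m \<le> n" for m n using that by (simp add: c_def)
  have "(\<lambda>m. integral\<^sup>N lborel (f m)) \<longlonglongrightarrow> (\<integral>\<^sup>+x. ennreal (max 0 (- x) * J x) \<partial>lborel)"
  proof (rule nn_integral_LIMSEQ)
    show "incseq f"
    proof (intro monoI le_funI)
      fix m n :: nat and x assume mn: "m \<le> n"
      show "f m x \<le> f n x"
        unfolding f_def using cdec[OF mn] mn J(1)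
        by (intro mult_mono ennreal_leI mult_right_mono max.mono) (auto simp: indicator_def)
    qed
    show "f m \<in> borel_measurable lborel" for m unfolding f_def by measurable
    fix x
    have "(\<lambda>m. ennreal (max 0 (- c m - x) * J x)) \<longlonglongrightarrow> ennreal (max 0 (- 0 - x) * J x)"
      by (intro tendsto_intros c0)
    moreover have "\<forall>\<^sub>F m in sequentially. ennreal (max 0 (- c m - x) * J x) = f m x"
    proof -
      have "\<forall>\<^sub>F m in sequentially. - real (Suc m) \<le> x"
        using eventually_ge_at_top[of "nat \<lceil>- x\<rceil>"] by eventually_elim linarith
      then show ?thesis by eventually_elim (simp add: f_def)
    qed
    ultimately show "(\<lambda>m. f m x) \<longlonglongrightarrow> ennreal (max 0 (- x) * J x)"
      by (subst (asm) tendsto_cong) auto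
  qed
  moreover have "integral\<^sup>N lborel (f m) \<le> ennreal B" for m
  proof -
    have "c m \<le> real (Suc m)" using inverse_le_1_iff[of "real (Suc m)"] by (simp only: c_def) linarith
    moreover have "0 < c m" by (simp add: c_def)
    ultimately show ?thesis unfolding f_def by (intro main) auto
  qed
  ultimately show ?thesis by (intro LIMSEQ_le_const2) auto
qed

section \<open>Derivatives of powers of 1 + |G|^2\<close>

lemma has_real_derivative_inner:
  fixes G H :: "real \<Rightarrow> 'a::real_inner"
  assumes "(G has_vector_derivative G') (at s within S)" "(H has_vector_derivative H') (at s within S)"
  shows "((\<lambda>s. G s \<bullet> H s) has_real_derivative (G s \<bullet> H' + G' \<bullet> H s)) (at s within S)"
proof -
  have "((\<lambda>s. G s \<bullet> H s) has_derivative (\<lambda>h. G s \<bullet> (h *\<^sub>R H') + (h *\<^sub>R G') \<bullet> H s)) (at s within S)"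
    using assms unfolding has_vector_derivative_def by (rule has_derivative_inner)
  moreover have "(\<lambda>h. G s \<bullet> (h *\<^sub>R H') + (h *\<^sub>R G') \<bullet> H s) = (*) (G s \<bullet> H' + G' \<bullet> H s)"
    by (auto simp: fun_eq_iff algebra_simps)
  ultimately show ?thesis by (simp add: has_field_derivative_def)
qed

lemma has_real_derivative_one_plus_norm_powr:
  fixes G :: "real \<Rightarrow> 'a::real_inner"
  assumes "(G has_vector_derivative G') (at s within S)"
  shows "((\<lambda>s. (1 + (norm (G s))\<^sup>2) powr r) has_real_derivative
    2 * r * (1 + (norm (G s))\<^sup>2) powr (r - 1) * (G s \<bullet> G')) (at s within S)"
proof -
  have "((\<lambda>s. 1 + G s \<bullet> G s) has_real_derivative (2 * (G s \<bullet> G'))) (at s within S)"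
    by (rule derivative_eq_intros has_real_derivative_inner[OF assms assms] refl)+ (simp add: inner_commute)
  moreover have "((\<lambda>y. y powr r) has_real_derivative r * (1 + G s \<bullet> G s) powr (r - 1)) (at (1 + G s \<bullet> G s))"
    by (rule has_real_derivative_powr) (simp add: add_pos_nonneg)
  ultimately have "((\<lambda>s. (1 + G s \<bullet> G s) powr r) has_real_derivative
      r * (1 + G s \<bullet> G s) powr (r - 1) * (2 * (G s \<bullet> G'))) (at s within S)"
    by (rule DERIV_chain2[rotated])
  then show ?thesis by (simp add: power2_norm_eq_inner mult_ac)
qed

lemma has_real_derivative_one_plus_norm_powr_2:
  fixes G G' :: "real \<Rightarrow> 'a::real_inner"
  assumes "(G has_vector_derivative G' s) (at s within S)" "(G' has_vector_derivative G'') (at s within S)"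
  shows "((\<lambda>s. q * (1 + (norm (G s))\<^sup>2) powr (q / 2 - 1) * (G s \<bullet> G' s)) has_real_derivative
    q * (q - 2) * (1 + (norm (G s))\<^sup>2) powr (q / 2 - 2) * (G s \<bullet> G' s)\<^sup>2
    + q * (1 + (norm (G s))\<^sup>2) powr (q / 2 - 1) * ((norm (G' s))\<^sup>2 + G s \<bullet> G'')) (at s within S)"
  by (rule derivative_eq_intros has_real_derivative_one_plus_norm_powr[OF assms(1)] has_real_derivative_inner[OF assms] refl)+
    (simp add: power2_norm_eq_inner[of "G' s"] power2_eq_square[of "G s \<bullet> G' s"] algebra_simps)

text \<open>For holomorphic F with \<open>w\<close>, \<open>d\<close>, \<open>d2\<close> the values
  of F, F', F'', the two brackets are the second derivatives of (1 + |F|^2)^(q/2) in the real and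
  imaginary directions. The second has \<open>\<i> * d\<close> and \<open>- d2\<close>, so the terms
  with F'' cancel. The squared inner products add up to |w|^2 |d|^2. As q - 2 is not positive,
  bounding |w|^2 by \<open>N\<close> leaves the coefficient q(q - 2) + 2q = q^2.\<close>

lemma laplacian_one_plus_norm_powr_ge:
  fixes w d d2 :: complex
  assumes q: "0 < q" "q \<le> 2"
  defines "N \<equiv> 1 + (norm w)\<^sup>2"
  shows "q\<^sup>2 * (N powr (q / 2 - 1) * (norm d)\<^sup>2) \<le>
    (q * (q - 2) * N powr (q / 2 - 2) * (w \<bullet> d)\<^sup>2 + q * N powr (q / 2 - 1) * ((norm d)\<^sup>2 + w \<bullet> d2))
    + (q * (q - 2) * N powr (q / 2 - 2) * (w \<bullet> (\<i> * d))\<^sup>2 + q * N powr (q / 2 - 1) * ((norm (\<i> * d))\<^sup>2 + w \<bullet> (- d2)))"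
proof -
  have N: "N > 0" by (simp add: N_def add_pos_nonneg)
  have e: "(w \<bullet> d)\<^sup>2 + (w \<bullet> (\<i> * d))\<^sup>2 = (norm w)\<^sup>2 * (norm d)\<^sup>2"
    unfolding cmod_power2 inner_complex_def by (simp add: power2_eq_square) algebra
  have pN: "N powr (q / 2 - 1) = N powr (q / 2 - 2) * N"
  proof -
    have "N powr (q / 2 - 2 + 1) = N powr (q / 2 - 2) * N" unfolding powr_add using N by simp
    then show ?thesis by simp
  qed
  have "q * (2 - q) * (N powr (q / 2 - 2) * ((norm w)\<^sup>2 * (norm d)\<^sup>2)) \<le> q * (2 - q) * (N powr (q / 2 - 2) * (N * (norm d)\<^sup>2))"
    using q by (intro mult_left_mono mult_right_mono) (auto simp: N_def)
  also have "\<dots> = q * (2 - q) * (N powr (q / 2 - 1) * (norm d)\<^sup>2)" unfolding pN by (simp add: mult_ac)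
  finally have "q * (2 - q) * (N powr (q / 2 - 2) * ((w \<bullet> d)\<^sup>2 + (w \<bullet> (\<i> * d))\<^sup>2)) \<le> q * (2 - q) * (N powr (q / 2 - 1) * (norm d)\<^sup>2)"
    unfolding e .
  then show ?thesis by (simp add: norm_mult algebra_simps power2_eq_square[of q])
qed

lemma continuous_on_Complex_half_plane:
  fixes h :: "complex \<Rightarrow> 'a::topological_space"
  assumes "continuous_on {z. Re z < 0} h"
  shows "continuous_on ({..<0} \<times> A) (\<lambda>(x, t). h (Complex x t))"
  unfolding case_prod_unfold
  by (rule continuous_on_compose2[OF assms]) (auto simp: Complex_eq intro!: continuous_intros)

lemma has_vector_derivative_Complex:
  assumes "(F has_field_derivative d) (at (Complex x t))"
  shows "((\<lambda>x. F (Complex x t)) has_vector_derivative d) (at x)"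
    and "((\<lambda>t. F (Complex x t)) has_vector_derivative \<i> * d) (at t)"
proof -
  have "((\<lambda>x. Complex x t) has_vector_derivative 1) (at x)"
    unfolding Complex_eq by (auto intro!: derivative_eq_intros)
  from field_vector_diff_chain_at[OF this assms] show "((\<lambda>x. F (Complex x t)) has_vector_derivative d) (at x)"
    by (simp add: o_def)
  have "((\<lambda>t. Complex x t) has_vector_derivative \<i>) (at t)"
    unfolding Complex_eq by (auto intro!: derivative_eq_intros)
  from field_vector_diff_chain_at[OF this assms] show "((\<lambda>t. F (Complex x t)) has_vector_derivative \<i> * d) (at t)"
    by (simp add: o_def)
qed

text \<open>\<open>M2\<close>, the second derivative of the segment integrals \<open>M\<close>, is
  the integral of the real-direction part \<open>f2\<close> of the Laplacian. Adding the
  imaginary-direction part \<open>h2\<close> does not change it, by periodicity, and makes the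
  pointwise lower bound available. The convexity lemma then yields \<open>B\<close>, and the factor
  q^2 of the lower bound is divided out.\<close>

lemma hardy_stein_half_plane:
  assumes hol: "F holomorphic_on {z. Re z < 0}"
    and per: "\<And>z. Re z < 0 \<Longrightarrow> F (z + 2 * of_real pi * \<i>) = F z"
    and q: "0 < q" "q \<le> 2"
    and bd: "\<And>x. x < 0 \<Longrightarrow> integral {0..2*pi} (\<lambda>t. (1 + (norm (F (Complex x t)))\<^sup>2) powr (q / 2)) \<le> B"
  shows "(\<integral>\<^sup>+x\<in>{..<0}. (\<integral>\<^sup>+t\<in>{0..2*pi}. ennreal (- x * (1 + (norm (F (Complex x t)))\<^sup>2) powr (q / 2 - 1)
      * (norm (deriv F (Complex x t)))\<^sup>2) \<partial>lborel) \<partial>lborel) \<le> ennreal (B / q\<^sup>2)"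
proof -
  let ?H = "{z. Re z < 0}"
  let ?I = "{0..2*pi}"
  have oH: "open ?H" by (rule open_halfspace_Re_lt)
  define F1 where "F1 = deriv F"
  define F2 where "F2 = deriv F1"
  have hol1: "F1 holomorphic_on ?H" unfolding F1_def using hol oH by (rule holomorphic_deriv)
  have hol2: "F2 holomorphic_on ?H" unfolding F2_def using hol1 oH by (rule holomorphic_deriv)
  have d1: "(F has_field_derivative F1 z) (at z)" if "Re z < 0" for z
    unfolding F1_def using holomorphic_derivI[OF hol oH] that by simp
  have d2: "(F1 has_field_derivative F2 z) (at z)" if "Re z < 0" for z
    unfolding F2_def using holomorphic_derivI[OF hol1 oH] that by simp
  note contF = holomorphic_on_imp_continuous_on[OF hol] holomorphic_on_imp_continuous_on[OF hol1] holomorphic_on_imp_continuous_on[OF hol2]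
  have per1: "F1 (z + 2 * of_real pi * \<i>) = F1 z" if z: "Re z < 0" for z
  proof -
    have "((\<lambda>z. F (z + 2 * of_real pi * \<i>)) has_field_derivative F1 (z + 2 * of_real pi * \<i>) * 1) (at z)"
      by (rule DERIV_chain2[OF d1]) (use z in \<open>auto intro!: derivative_eq_intros\<close>)
    moreover have "\<forall>\<^sub>F z in nhds z. F (z + 2 * of_real pi * \<i>) = F z"
      using eventually_nhds_in_open[OF oH, of z] z by (auto elim!: eventually_mono simp: per)
    ultimately have "(F has_field_derivative F1 (z + 2 * of_real pi * \<i>) * 1) (at z)"
      by (subst (asm) DERIV_cong_ev) auto
    then show ?thesis using d1[OF z] DERIV_unique by fastforce
  qed
  define N where "N = (\<lambda>z. 1 + (norm (F z))\<^sup>2)"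
  have N: "N z > 0" for z by (simp add: N_def add_pos_nonneg)
  have contN: "continuous_on ?H N" unfolding N_def by (intro continuous_intros contF)
  have contNp: "continuous_on ?H (\<lambda>z. N z powr r)" for r
    by (intro continuous_on_powr contN continuous_intros ballI less_imp_neq[OF N, symmetric])
  \<comment> \<open>\<open>f1\<close> and \<open>f2\<close> are the derivatives of \<open>f0\<close>
    in the real direction. \<open>h1\<close> and \<open>h2\<close> are those in the imaginary
    direction, along which F has the derivatives \<open>\<i> * F1\<close> and
    \<open>- F2\<close>.\<close>
  define f0 where "f0 = (\<lambda>z. N z powr (q / 2))"
  define f1 where "f1 = (\<lambda>z. q * N z powr (q / 2 - 1) * (F z \<bullet> F1 z))"
  define f2 where "f2 = (\<lambda>z. q * (q - 2) * N z powr (q / 2 - 2) * (F z \<bullet> F1 z)\<^sup>2 + q * N z powr (q / 2 - 1) * ((norm (F1 z))\<^sup>2 + F z \<bullet> F2 z))"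
  define h1 where "h1 = (\<lambda>z. q * N z powr (q / 2 - 1) * (F z \<bullet> (\<i> * F1 z)))"
  define h2 where "h2 = (\<lambda>z. q * (q - 2) * N z powr (q / 2 - 2) * (F z \<bullet> (\<i> * F1 z))\<^sup>2 + q * N z powr (q / 2 - 1) * ((norm (\<i> * F1 z))\<^sup>2 + F z \<bullet> (- F2 z)))"
  define j where "j = (\<lambda>z. N z powr (q / 2 - 1) * (norm (F1 z))\<^sup>2)"
  have c0: "continuous_on ?H f0" unfolding f0_def by (rule contNp)
  have c1: "continuous_on ?H f1" unfolding f1_def by (intro continuous_intros contNp contF)
  have c2: "continuous_on ?H f2" unfolding f2_def by (intro continuous_intros contNp contF)
  have c3: "continuous_on ?H h2" unfolding h2_def by (intro continuous_intros contNp contF)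
  have cj: "continuous_on ?H j" unfolding j_def by (intro continuous_intros contNp contF)
  have slice: "continuous_on ?I (\<lambda>t. h (Complex x t))" if "x < 0" "continuous_on ?H h" for h :: "complex \<Rightarrow> real" and x
    by (rule continuous_on_compose2[OF that(2)]) (use that(1) in \<open>auto simp: Complex_eq intro!: continuous_intros\<close>)
  have int: "(\<lambda>t. h (Complex x t)) integrable_on ?I" if "x < 0" "continuous_on ?H h" for h :: "complex \<Rightarrow> real" and x
    using slice[OF that] by (rule integrable_continuous_real)
  have df0: "((\<lambda>x. f0 (Complex x t)) has_real_derivative f1 (Complex x t)) (at x)" if "x < 0" for x t
    using has_real_derivative_one_plus_norm_powr[OF has_vector_derivative_Complex(1)[OF d1], of x t "q/2"] that
    by (simp add: f0_def f1_def N_def)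
  have df1: "((\<lambda>x. f1 (Complex x t)) has_real_derivative f2 (Complex x t)) (at x)" if "x < 0" for x t
    using has_real_derivative_one_plus_norm_powr_2[where G = "\<lambda>x. F (Complex x t)" and G' = "\<lambda>x. F1 (Complex x t)" and s = x,
        OF has_vector_derivative_Complex(1)[OF d1] has_vector_derivative_Complex(1)[OF d2], of q] that
    by (simp add: f1_def f2_def N_def)
  have dh1: "((\<lambda>t. h1 (Complex x t)) has_real_derivative h2 (Complex x t)) (at t)" if "x < 0" for x t
  proof -
    have "((\<lambda>t. \<i> * F1 (Complex x t)) has_vector_derivative \<i> * (\<i> * F2 (Complex x t))) (at t)"
      using has_vector_derivative_Complex(2)[OF d2] that by (intro derivative_intros) auto
    then have "((\<lambda>t. \<i> * F1 (Complex x t)) has_vector_derivative - F2 (Complex x t)) (at t)"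
      by (simp add: mult.assoc[symmetric])
    from has_real_derivative_one_plus_norm_powr_2[where G = "\<lambda>t. F (Complex x t)" and G' = "\<lambda>t. \<i> * F1 (Complex x t)" and s = t,
        OF has_vector_derivative_Complex(2)[OF d1] this, of q] that
    show ?thesis by (simp add: h1_def h2_def N_def)
  qed
  have leib: "((\<lambda>x. integral ?I (\<lambda>t. f (Complex x t))) has_real_derivative integral ?I (\<lambda>t. f' (Complex x t))) (at x)"
    if "x < 0" "continuous_on ?H f" "continuous_on ?H f'" 
      "\<And>x t. x < 0 \<Longrightarrow> ((\<lambda>x. f (Complex x t)) has_real_derivative f' (Complex x t)) (at x)" for f f' x
  proof -
    have "((\<lambda>x. integral (cbox 0 (2*pi)) (\<lambda>t. f (Complex x t))) has_real_derivative integral (cbox 0 (2*pi)) (\<lambda>t. f' (Complex x t))) (at x within {..<0})"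
      using that int[OF _ that(2)] continuous_on_Complex_half_plane[OF that(3)]
      by (intro leibniz_rule_field_derivative) (auto intro: has_field_derivative_at_within)
    then show ?thesis using that(1) by (simp add: at_within_open[of x "{..<0}"])
  qed
  define M where "M = (\<lambda>x. integral ?I (\<lambda>t. f0 (Complex x t)))"
  define M1 where "M1 = (\<lambda>x. integral ?I (\<lambda>t. f1 (Complex x t)))"
  define M2 where "M2 = (\<lambda>x. integral ?I (\<lambda>t. f2 (Complex x t)))"
  \<comment> \<open>The value 0 for \<open>x \<ge> 0\<close> makes \<open>J\<close> a Borel function
    on the whole line and is harmless, since the weight \<open>max 0 (- x)\<close> vanishes
    there.\<close>
  define J where "J = (\<lambda>x. if x < 0 then q\<^sup>2 * integral ?I (\<lambda>t. j (Complex x t)) else 0)"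
  \<comment> \<open>\<open>h2\<close> is the second derivative in the angular direction, so its integral over a period vanishes.\<close>
  have h2_0: "integral ?I (\<lambda>t. h2 (Complex x t)) = 0" if x: "x < 0" for x
  proof -
    have "((\<lambda>t. h2 (Complex x t)) has_integral h1 (Complex x (2*pi)) - h1 (Complex x 0)) ?I"
      using dh1[OF x] by (intro fundamental_theorem_of_calculus)
        (auto simp: has_real_derivative_iff_has_vector_derivative has_vector_derivative_at_within)
    moreover have "Complex x (2*pi) = Complex x 0 + 2 * of_real pi * \<i>" by (simp add: complex_eq_iff)
    then have "h1 (Complex x (2*pi)) = h1 (Complex x 0)"
      using per[of "Complex x 0"] per1[of "Complex x 0"] x by (simp add: h1_def N_def)
    ultimately show ?thesis by (simp add: integral_unique)
  qed
  have J_le: "J x \<le> M2 x" if x: "x < 0" for x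
  proof -
    have "J x = integral ?I (\<lambda>t. q\<^sup>2 * j (Complex x t))" using x by (simp add: J_def)
    also have "\<dots> \<le> integral ?I (\<lambda>t. f2 (Complex x t) + h2 (Complex x t))"
    proof (rule integral_le)
      show "q\<^sup>2 * j (Complex x t) \<le> f2 (Complex x t) + h2 (Complex x t)" for t
        using laplacian_one_plus_norm_powr_ge[OF q, of "F (Complex x t)" "F1 (Complex x t)" "F2 (Complex x t)"]
        by (simp only: j_def f2_def h2_def N_def)
    qed (use int[OF x] cj c2 c3 in \<open>auto intro!: integrable_on_mult_right integrable_add\<close>)
    also have "\<dots> = M2 x" using int[OF x c2] int[OF x c3] h2_0[OF x] by (simp add: integral_add M2_def)
    finally show ?thesis .
  qed
  have "(\<integral>\<^sup>+x. ennreal (max 0 (- x) * J x) \<partial>lborel) \<le> ennreal B"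
  proof (rule nn_integral_second_derivative_le)
    show "(M has_real_derivative M1 x) (at x)" if "x < 0" for x
      unfolding M_def M1_def using leib[OF that c0 c1 df0] .
    show "(M1 has_real_derivative M2 x) (at x)" if "x < 0" for x
      unfolding M1_def M2_def using leib[OF that c1 c2 df1] .
    show "0 \<le> M x" if "x < 0" for x
      unfolding M_def by (rule integral_nonneg[OF int[OF that c0]]) (simp add: f0_def)
    show "M x \<le> B" if "x < 0" for x using bd[OF that] by (simp add: M_def f0_def N_def)
    show "0 \<le> J x" for x
    proof (cases "x < 0")
      case True
      have "0 \<le> integral ?I (\<lambda>t. j (Complex x t))"
        by (rule integral_nonneg[OF int[OF True cj]]) (simp add: j_def)
      then show ?thesis by (simp add: J_def)
    qed (simp add: J_def)
    have "continuous_on {..<0} (\<lambda>x. integral (cbox 0 (2*pi)) (\<lambda>t. j (Complex x t)))"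
      by (rule integral_continuous_on_param[OF continuous_on_Complex_half_plane[OF cj]])
    then have "(\<lambda>x. if x \<in> {..<0} then q\<^sup>2 * integral ?I (\<lambda>t. j (Complex x t)) else 0) \<in> borel_measurable borel"
      by (intro borel_measurable_continuous_on_if continuous_intros) auto
    then show "J \<in> borel_measurable borel" by (simp add: J_def)
  qed (rule J_le)
  moreover have "(\<integral>\<^sup>+x\<in>{..<0}. (\<integral>\<^sup>+t\<in>?I. ennreal (- x * N (Complex x t) powr (q / 2 - 1)
      * (norm (F1 (Complex x t)))\<^sup>2) \<partial>lborel) \<partial>lborel) = (\<integral>\<^sup>+x. ennreal (1 / q\<^sup>2) * ennreal (max 0 (- x) * J x) \<partial>lborel)"
  proof (rule nn_integral_cong)
    fix x :: real
    show "(\<integral>\<^sup>+t\<in>?I. ennreal (- x * N (Complex x t) powr (q / 2 - 1) * (norm (F1 (Complex x t)))\<^sup>2) \<partial>lborel) * indicator {..<0} x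
        = ennreal (1 / q\<^sup>2) * ennreal (max 0 (- x) * J x)"
    proof (cases "x < 0")
      case True
      have "((\<lambda>t. - x * j (Complex x t)) has_integral (- x * integral ?I (\<lambda>t. j (Complex x t)))) ?I"
        using int[OF True cj] by (intro has_integral_mult_right integrable_integral)
      then have "(\<integral>\<^sup>+t. ennreal (indicator ?I t * (- x * j (Complex x t))) \<partial>lborel) = ennreal (- x * integral ?I (\<lambda>t. j (Complex x t)))"
        using True by (intro nn_integral_has_integral_lebesgue) (auto simp: j_def mult_nonpos_nonneg)
      moreover have "(\<integral>\<^sup>+t\<in>?I. ennreal (- x * N (Complex x t) powr (q / 2 - 1) * (norm (F1 (Complex x t)))\<^sup>2) \<partial>lborel)
         = (\<integral>\<^sup>+t. ennreal (indicator ?I t * (- x * j (Complex x t))) \<partial>lborel)"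
        by (intro nn_integral_cong) (auto simp: indicator_def j_def mult.assoc)
      moreover have "ennreal (1 / q\<^sup>2) * ennreal (max 0 (- x) * J x) = ennreal (- x * integral ?I (\<lambda>t. j (Complex x t)))"
        using True q by (simp add: J_def max_def flip: ennreal_mult')
      ultimately show ?thesis using True by simp
    qed (simp add: max_def)
  qed
  moreover have "\<dots> = ennreal (1 / q\<^sup>2) * (\<integral>\<^sup>+x. ennreal (max 0 (- x) * J x) \<partial>lborel)"
  proof (rule nn_integral_cmult)
    have "continuous_on {..<0} (\<lambda>x. integral (cbox 0 (2*pi)) (\<lambda>t. j (Complex x t)))"
      by (rule integral_continuous_on_param[OF continuous_on_Complex_half_plane[OF cj]])
    then have "(\<lambda>x. if x \<in> {..<0} then q\<^sup>2 * integral ?I (\<lambda>t. j (Complex x t)) else 0) \<in> borel_measurable borel"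
      by (intro borel_measurable_continuous_on_if continuous_intros) auto
    then have [measurable]: "J \<in> borel_measurable borel" by (simp add: J_def)
    show "(\<lambda>x. ennreal (max 0 (- x) * J x)) \<in> borel_measurable lborel" by measurable
  qed
  ultimately have "(\<integral>\<^sup>+x\<in>{..<0}. (\<integral>\<^sup>+t\<in>?I. ennreal (- x * N (Complex x t) powr (q / 2 - 1)
      * (norm (F1 (Complex x t)))\<^sup>2) \<partial>lborel) \<partial>lborel) \<le> ennreal (1 / q\<^sup>2) * ennreal B"
    by (simp add: mult_left_mono)
  also have "\<dots> = ennreal (B / q\<^sup>2)" by (simp flip: ennreal_mult')
  finally show ?thesis by (simp add: N_def F1_def)
qed

subsection \<open>Integrals over circles\<close>

lemma nn_integral_exp_atLeast_1:
  "(\<integral>\<^sup>+s\<in>{1::real..}. ennreal (exp (- s)) \<partial>lborel) \<le> 1"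
proof -
  have "(\<integral>\<^sup>+s\<in>{1::real..}. ennreal (exp (- s)) \<partial>lborel) = ennreal (0 - (- exp (- 1)))"
  proof (rule nn_integral_FTC_atLeast)
    show "((\<lambda>s::real. - exp (- s)) \<longlongrightarrow> 0) at_top" by real_asymp
  qed (auto intro!: derivative_eq_intros)
  then show ?thesis by simp
qed

text \<open>The source of the logarithm. With s = -x, the exponential is dropped on [\<alpha>, 1],
  leaving the integral of 1/s; for s at least 1 the factor 1/s is dropped instead. The factor
  \<open>exp (2 * x)\<close> comes from the Jacobian of the exponential map.\<close>

lemma nn_integral_exp_over_le:
  fixes \<alpha> :: real
  assumes "0 < \<alpha>" "\<alpha> \<le> 1"
  shows "(\<integral>\<^sup>+x\<in>{..<0}. ennreal (exp (2 * x) / (- x)) * indicator {\<alpha>..} (- x) \<partial>lborel) \<le> ennreal (1 - ln \<alpha>)"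
proof -
  have "(\<integral>\<^sup>+x\<in>{..<0}. ennreal (exp (2 * x) / (- x)) * indicator {\<alpha>..} (- x) \<partial>lborel)
    = (\<integral>\<^sup>+s\<in>{\<alpha>..}. ennreal (exp (- 2 * s) / s) \<partial>lborel)"
    using assms by (subst nn_integral_real_affine[where c = "-1" and t = 0])
      (auto intro!: nn_integral_cong simp: indicator_def)
  also have "\<dots> \<le> (\<integral>\<^sup>+s. ennreal (1 / s) * indicator {\<alpha>..1} s + ennreal (exp (- s)) * indicator {1..} s \<partial>lborel)"
  proof (rule nn_integral_mono)
    fix s :: real
    show "ennreal (exp (- 2 * s) / s) * indicator {\<alpha>..} s
      \<le> ennreal (1 / s) * indicator {\<alpha>..1} s + ennreal (exp (- s)) * indicator {1..} s"
    proof (cases "\<alpha> \<le> s")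
      case True
      then have s: "s > 0" using assms by simp
      show ?thesis
      proof (cases "s \<le> 1")
        case True
        then have "ennreal (exp (- 2 * s) / s) \<le> ennreal (1 / s)"
          using s by (intro ennreal_leI divide_right_mono) auto
        then show ?thesis using \<open>\<alpha> \<le> s\<close> True by (simp add: add_increasing2)
      next
        case False
        have "exp (- 2 * s) / s \<le> exp (- s) / 1" using False by (intro frac_le) auto
        then have "ennreal (exp (- 2 * s) / s) \<le> ennreal (exp (- s))" by (intro ennreal_leI) simp
        then show ?thesis using \<open>\<alpha> \<le> s\<close> False by simp
      qed
    qed simp
  qed
  also have "\<dots> = (\<integral>\<^sup>+s\<in>{\<alpha>..1}. ennreal (1 / s) \<partial>lborel) + (\<integral>\<^sup>+s\<in>{1..}. ennreal (exp (- s)) \<partial>lborel)"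
    by (rule nn_integral_add) measurable
  also have "(\<integral>\<^sup>+s\<in>{\<alpha>..1}. ennreal (1 / s) \<partial>lborel) = ennreal (ln 1 - ln \<alpha>)"
    by (rule nn_integral_FTC_Icc) (use assms in \<open>auto intro!: derivative_eq_intros\<close>)
  also have "ennreal (ln 1 - ln \<alpha>) + (\<integral>\<^sup>+s\<in>{1..}. ennreal (exp (- s)) \<partial>lborel) \<le> ennreal (ln 1 - ln \<alpha>) + 1"
    by (intro add_left_mono nn_integral_exp_atLeast_1)
  also have "\<dots> = ennreal (1 - ln \<alpha>)"
  proof -
    have "ln \<alpha> \<le> 0" using assms by simp
    then show ?thesis by (simp add: add.commute flip: ennreal_plus ennreal_1)
  qed
  finally show ?thesis .
qed

text \<open>Since s < \<alpha> \<le> 1, the summand 1 is at most s^(-\<gamma>), and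
  \<open>\<gamma> < 1\<close> makes that power integrable at 0. The exponent
  \<open>1 - \<gamma>\<close> gained here is what compensates \<open>n\<close>.\<close>

lemma nn_integral_powr_le:
  fixes \<alpha> \<gamma> :: real
  assumes \<alpha>: "0 < \<alpha>" "\<alpha> \<le> 1" and \<gamma>: "0 < \<gamma>" "\<gamma> < 1"
  shows "(\<integral>\<^sup>+x\<in>{..<0}. ennreal (exp (2 * x) * (1 + (- x) powr (- \<gamma>))) * indicator {..<\<alpha>} (- x) \<partial>lborel)
    \<le> ennreal (2 / (1 - \<gamma>) * \<alpha> powr (1 - \<gamma>))"
proof -
  have "(\<integral>\<^sup>+x\<in>{..<0}. ennreal (exp (2 * x) * (1 + (- x) powr (- \<gamma>))) * indicator {..<\<alpha>} (- x) \<partial>lborel)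
    \<le> (\<integral>\<^sup>+x. ennreal (indicator {0..\<alpha>} (- x) * (2 * (- x) powr (- \<gamma>))) \<partial>lborel)"
  proof (rule nn_integral_mono)
    fix x :: real
    show "ennreal (exp (2 * x) * (1 + (- x) powr (- \<gamma>))) * indicator {..<\<alpha>} (- x) * indicator {..<0} x
       \<le> ennreal (indicator {0..\<alpha>} (- x) * (2 * (- x) powr (- \<gamma>)))"
    proof (cases "x < 0 \<and> - x < \<alpha>")
      case True
      have "1 powr (- \<gamma>) \<le> (- x) powr (- \<gamma>)" using True \<alpha> \<gamma> by (intro powr_mono2') auto
      then have "exp (2 * x) * (1 + (- x) powr (- \<gamma>)) \<le> 1 * (2 * (- x) powr (- \<gamma>))"
        using True by (intro mult_mono) auto
      then show ?thesis using True by (simp add: ennreal_leI)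
    qed (auto simp: indicator_def)
  qed
  also have "\<dots> = (\<integral>\<^sup>+s. ennreal (indicator {0..\<alpha>} s * (2 * s powr (- \<gamma>))) \<partial>lborel)"
    by (subst nn_integral_real_affine[where c = "-1" and t = 0]) auto
  also have "\<dots> = ennreal (2 * (\<alpha> powr (- \<gamma> + 1) / (- \<gamma> + 1)))"
  proof (rule nn_integral_has_integral_lebesgue)
    show "((\<lambda>s. 2 * s powr (- \<gamma>)) has_integral (2 * (\<alpha> powr (- \<gamma> + 1) / (- \<gamma> + 1)))) {0..\<alpha>}"
      using \<alpha> \<gamma> by (intro has_integral_mult_right has_integral_powr_from_0) auto
  qed simp
  finally show ?thesis by simp
qed

lemma nn_integral_powr_total_le:
  fixes \<gamma> :: real
  assumes \<gamma>: "0 < \<gamma>" "\<gamma> < 1"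
  shows "(\<integral>\<^sup>+x\<in>{..<0}. ennreal (exp (2 * x) * (1 + (- x) powr (- \<gamma>))) \<partial>lborel) \<le> ennreal (2 / (1 - \<gamma>) + 2)"
proof -
  let ?f = "\<lambda>x. ennreal (exp (2 * x) * (1 + (- x) powr (- \<gamma>)))"
  have "(\<integral>\<^sup>+x\<in>{..<0}. ?f x \<partial>lborel) \<le> (\<integral>\<^sup>+x. ?f x * indicator {..<1} (- x) * indicator {..<0} x
     + 2 * (ennreal (exp (- (- x))) * indicator {1..} (- x)) \<partial>lborel)"
  proof (rule nn_integral_mono)
    fix x :: real
    show "?f x * indicator {..<0} x \<le> ?f x * indicator {..<1} (- x) * indicator {..<0} x
     + 2 * (ennreal (exp (- (- x))) * indicator {1..} (- x))"
    proof (cases "- x \<ge> 1")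
      case True
      have "(- x) powr (- \<gamma>) \<le> 1 powr (- \<gamma>)" using True \<gamma> by (intro powr_mono2') auto
      then have "exp (2 * x) * (1 + (- x) powr (- \<gamma>)) \<le> exp x * 2"
        using True by (intro mult_mono) auto
      then have "?f x \<le> ennreal (2 * exp x)" by (intro ennreal_leI) simp
      also have "\<dots> = 2 * ennreal (exp x)" by (simp add: ennreal_mult)
      finally show ?thesis using True by (simp add: indicator_def)
    qed (auto simp: indicator_def)
  qed
  also have "\<dots> = (\<integral>\<^sup>+x\<in>{..<0}. ?f x * indicator {..<1} (- x) \<partial>lborel)
     + 2 * (\<integral>\<^sup>+x. ennreal (exp (- (- x))) * indicator {1..} (- x) \<partial>lborel)"
    by (subst nn_integral_add) (auto simp: nn_integral_cmult)
  also have "\<dots> \<le> ennreal (2 / (1 - \<gamma>) * 1 powr (1 - \<gamma>)) + 2 * 1"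
  proof (intro add_mono mult_left_mono nn_integral_powr_le \<gamma>)
    have "(\<integral>\<^sup>+x. ennreal (exp (- (- x))) * indicator {1..} (- x) \<partial>lborel) = (\<integral>\<^sup>+s\<in>{1::real..}. ennreal (exp (- s)) \<partial>lborel)"
      by (subst (2) nn_integral_real_affine[where c = "-1" and t = 0]) auto
    then show "(\<integral>\<^sup>+x. ennreal (exp (- (- x))) * indicator {1..} (- x) \<partial>lborel) \<le> 1"
      using nn_integral_exp_atLeast_1 by simp
  qed auto
  also have "\<dots> = ennreal (2 / (1 - \<gamma>) + 2)" using \<gamma> by (simp add: ennreal_plus)
  finally show ?thesis .
qed

text \<open>Converts the distance \<open>1 - exp x\<close> of the point to the circle into s = -x.
  From \<open>exp x \<le> 1 / (1 - x)\<close>, that distance is at least s/(1 + s), hence at least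
  s/2 for s < 1 and at least 1/2 otherwise.\<close>

lemma one_minus_exp_powr_le:
  fixes x \<gamma> :: real
  assumes x: "x < 0" and \<gamma>: "0 < \<gamma>" "\<gamma> \<le> 1"
  shows "(1 - exp x) powr (- \<gamma>) \<le> 2 * (1 + (- x) powr (- \<gamma>))"
proof -
  have "exp x \<le> 1 / (1 - x)"
    using exp_ge_add_one_self[of "- x"] x by (simp add: exp_minus field_simps)
  then have ge: "1 - exp x \<ge> (- x) / (1 - x)" using x by (simp add: field_simps)
  have 2: "2 powr \<gamma> \<le> (2::real)" using powr_mono[of \<gamma> 1 2] \<gamma> by simp
  show ?thesis
  proof (cases "- x \<ge> 1")
    case True
    then have "1 / 2 \<le> (- x) / (1 - x)" by (simp add: field_simps)
    then have "(1 - exp x) powr (- \<gamma>) \<le> (1 / 2) powr (- \<gamma>)"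
      using ge \<gamma> by (intro powr_mono2') linarith+
    also have "\<dots> = 2 powr \<gamma>" by (simp add: powr_divide powr_minus)
    also have "\<dots> \<le> 2 * (1 + (- x) powr (- \<gamma>))"
      using 2 powr_ge_zero[of "- x" "- \<gamma>"] by (simp del: powr_ge_zero)
    finally show ?thesis .
  next
    case False
    then have "(- x) / 2 \<le> (- x) / (1 - x)" using x by (intro divide_left_mono) auto
    then have "(1 - exp x) powr (- \<gamma>) \<le> ((- x) / 2) powr (- \<gamma>)"
      using ge \<gamma> x by (intro powr_mono2') linarith+
    also have "\<dots> = 2 powr \<gamma> * (- x) powr (- \<gamma>)" using x by (simp only: powr_divide powr_minus) (simp add: field_simps)
    also have "\<dots> \<le> 2 * (- x) powr (- \<gamma>)" using 2 by (intro mult_right_mono) auto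
    finally show ?thesis by simp
  qed
qed

text \<open>Used with \<open>r = q / 2\<close> for the Hardy-Stein bound and with
  \<open>r = 1 - min p 2 / 2\<close> for the reciprocal weight. For the latter
  \<open>2 * r \<le> p\<close> holds because \<open>p > 1\<close>.\<close>

lemma one_plus_sq_powr_le:
  fixes y r p :: real
  assumes "0 \<le> y" "0 \<le> r" "r \<le> 1" "2 * r \<le> p"
  shows "(1 + y\<^sup>2) powr r \<le> 2 + 2 * y powr p"
proof -
  have 2: "2 powr r \<le> (2::real)" using powr_mono[of r 1 2] assms by simp
  show ?thesis
  proof (cases "y \<le> 1")
    case True
    then have "(1 + y\<^sup>2) powr r \<le> 2 powr r" using assms by (intro powr_mono2) (auto simp: power_le_one)
    then show ?thesis using 2 powr_ge_zero[of y p] by (simp del: powr_ge_zero)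
  next
    case False
    then have "1 \<le> y\<^sup>2" by simp
    then have "(1 + y\<^sup>2) powr r \<le> (2 * y\<^sup>2) powr r" using assms by (intro powr_mono2) auto
    also have "\<dots> = 2 powr r * y powr (2 * r)"
      using False by (simp add: powr_mult powr_powr flip: powr_numeral)
    also have "\<dots> \<le> 2 * y powr p" using 2 False assms by (intro mult_mono powr_mono) auto
    finally show ?thesis by simp
  qed
qed

section \<open>Circle integrals of functions with bounded Hardy means\<close>

lemma set_nn_integral_le_integral:
  fixes h :: "real \<Rightarrow> real"
  assumes "continuous_on {a..b} h" "\<And>t. 0 \<le> h t" "integral {a..b} h \<le> c"
  shows "(\<integral>\<^sup>+t\<in>{a..b}. ennreal (h t) \<partial>lborel) \<le> ennreal c"
proof -
  have "(h has_integral integral {a..b} h) {a..b}"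
    using integrable_continuous_real[OF assms(1)] by (rule integrable_integral)
  then have "(\<integral>\<^sup>+t. ennreal (indicator {a..b} t * h t) \<partial>lborel) = ennreal (integral {a..b} h)"
    using assms(2) by (intro nn_integral_has_integral_lebesgue) auto
  moreover have "(\<integral>\<^sup>+t\<in>{a..b}. ennreal (h t) \<partial>lborel) = (\<integral>\<^sup>+t. ennreal (indicator {a..b} t * h t) \<partial>lborel)"
    by (intro nn_integral_cong) (auto simp: indicator_def)
  ultimately show ?thesis using assms(3) by (simp add: ennreal_leI)
qed

lemma continuous_on_circle:
  fixes f :: "complex \<Rightarrow> 'a::topological_space"
  assumes "continuous_on (ball 0 1) f" "0 \<le> r" "r < 1"
  shows "continuous_on A (\<lambda>t. f (rcis r t))"
  by (rule continuous_on_compose2[OF assms(1)]) (use assms(2,3) in \<open>auto intro!: continuous_intros\<close>)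

lemma integral_circle_le_of_hardy_mean:
  assumes f: "f holomorphic_on ball 0 1" and r: "0 \<le> r" "r < 1" and p: "p > 0" and A: "hardy_mean p f r \<le> A"
  shows "integral {0..2*pi} (\<lambda>t. norm (f (rcis r t)) powr p) \<le> 2 * pi * A powr p"
proof -
  define I where "I = integral {0..2*pi} (\<lambda>t. norm (f (rcis r t)) powr p)"
  have cont: "continuous_on {0..2*pi} (\<lambda>t. norm (f (rcis r t)) powr p)"
    using p r by (intro continuous_on_powr' continuous_intros continuous_on_circle holomorphic_on_imp_continuous_on f) auto
  have "set_integrable lborel {0..2*pi} (\<lambda>t. norm (f (rcis r t)) powr p)"
    using cont by (intro borel_integrable_atLeastAtMost')
  then have "(LBINT t:{0..2*pi}. norm (f (rcis r t)) powr p) = I"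
    unfolding I_def by (rule set_borel_integral_eq_integral)
  then have "(1 / (2 * pi) * I) powr (1 / p) \<le> A" using A by (simp add: hardy_mean_def)
  then have "((1 / (2 * pi) * I) powr (1 / p)) powr p \<le> A powr p" using p by (intro powr_mono2) auto
  moreover have "0 \<le> I" unfolding I_def using integrable_continuous_real[OF cont] by (intro integral_nonneg) auto
  ultimately have "1 / (2 * pi) * I \<le> A powr p" using p by (simp add: powr_powr)
  then show ?thesis by (simp add: I_def field_simps)
qed

lemma exp_Complex: "exp (Complex x t) = rcis (exp x) t"
  by (simp add: exp_eq_polar rcis_def)

text \<open>The class of the normalised functions \<open>f \<circ> \<phi>\<close>. Bounds uniform
  over it are what makes the final constant independent of \<open>f\<close> and
  \<open>n\<close>.\<close>

definition unit_means :: "real \<Rightarrow> (complex \<Rightarrow> complex) set" where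
  "unit_means p = {g. g holomorphic_on ball 0 1 \<and>
     (\<forall>r. 0 < r \<longrightarrow> r < 1 \<longrightarrow> integral {0..2*pi} (\<lambda>t. norm (g (rcis r t)) powr p) \<le> 2 * pi)}"

text \<open>The only place where the two alternatives of the theorem are distinguished; everything
  afterwards uses just these parameters. The first bound controls the reciprocal of the Hardy-Stein
  weight, the second the reciprocal of the dyadic weight. In both, |\<psi>|^2 and a power of |g|
  must share the available integrability on a circle.\<close>

lemma slice_bounds:
  assumes "(p > 1 \<and> \<psi> \<in> hardy_infinity) \<or> (p > 2 \<and> \<psi> \<in> hardy_space 2)"
  obtains q \<sigma> \<gamma> b1 b2 :: real where "0 < q" "q \<le> 2" "q \<le> p" "2 < \<sigma>" "0 < \<gamma>" "\<gamma> < 1" "0 \<le> b1" "0 \<le> b2"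
    "\<And>g x. g \<in> unit_means p \<Longrightarrow> x < 0 \<Longrightarrow>
       (\<integral>\<^sup>+t\<in>{0..2*pi}. ennreal ((norm (\<psi> (rcis (exp x) t)))\<^sup>2 * (1 + (norm (g (rcis (exp x) t)))\<^sup>2) powr (1 - q / 2)) \<partial>lborel) \<le> ennreal b1"
    "\<And>g x. g \<in> unit_means p \<Longrightarrow> x < 0 \<Longrightarrow>
       (\<integral>\<^sup>+t\<in>{0..2*pi}. ennreal ((norm (\<psi> (rcis (exp x) t)))\<^sup>2 * (1 + (2 * norm (g (rcis (exp x) t))) powr \<sigma>)) \<partial>lborel)
         \<le> ennreal (b2 * (1 + (- x) powr (- \<gamma>)))"
  using assms
proof (elim disjE)
  assume "p > 1 \<and> \<psi> \<in> hardy_infinity"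
  then have p: "p > 1" and hol: "\<psi> holomorphic_on ball 0 1" and "bounded (\<psi> ` ball 0 1)"
    by (auto simp: hardy_infinity_def)
  obtain b where b: "\<And>z. z \<in> ball 0 1 \<Longrightarrow> norm (\<psi> z) \<le> b"
    using \<open>bounded (\<psi> ` ball 0 1)\<close> unfolding bounded_iff by blast
  \<comment> \<open>\<open>\<sigma> = p + 1\<close> splits |g|^\<sigma> into |g|^p, controlled in
    the mean, and a single |g|, controlled by growth; hence \<open>\<gamma> = 1 / p\<close>. Both
    \<open>\<sigma> > 2\<close> and \<open>\<gamma> < 1\<close> say that
    \<open>p > 1\<close>.\<close>
  show thesis
  proof (rule that[of "min p 2" "p + 1" "1 / p" "b\<^sup>2 * (8 * pi)" "b\<^sup>2 * (2 * pi + 2 powr (p + 1) * (24 * pi))"])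
    fix g x assume "g \<in> unit_means p" and x: "x < (0::real)"
    then have g: "g holomorphic_on ball 0 1"
      and I: "\<And>r. 0 < r \<Longrightarrow> r < 1 \<Longrightarrow> integral {0..2*pi} (\<lambda>t. norm (g (rcis r t)) powr p) \<le> 2 * pi"
      by (auto simp: unit_means_def)
    define v where "v = (\<lambda>t. norm (g (rcis (exp x) t)))"
    have v0: "0 \<le> v t" for t by (simp add: v_def)
    have "continuous_on {0..2*pi} v" unfolding v_def
      using x by (intro continuous_intros continuous_on_circle holomorphic_on_imp_continuous_on g) auto
    then have contv: "continuous_on {0..2*pi} (\<lambda>t. v t powr p)"
      using p v0 by (intro continuous_on_powr' continuous_intros) auto
    note intv = integrable_continuous_real[OF contv]
    have Iv: "integral {0..2*pi} (\<lambda>t. v t powr p) \<le> 2 * pi" using I[of "exp x"] x by (simp add: v_def)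
    have b2: "(norm (\<psi> (rcis (exp x) t)))\<^sup>2 \<le> b\<^sup>2" for t
      using b[of "rcis (exp x) t"] x by (intro power_mono) auto
    have main: "(\<integral>\<^sup>+t\<in>{0..2*pi}. ennreal ((norm (\<psi> (rcis (exp x) t)))\<^sup>2 * h t) \<partial>lborel) \<le> ennreal (b\<^sup>2 * (c * (2 * pi) + d * (2 * pi)))"
      if "\<And>t. 0 \<le> h t" "\<And>t. h t \<le> c + d * v t powr p" "0 \<le> c" "0 \<le> d" for h c d
    proof -
      have "(\<integral>\<^sup>+t\<in>{0..2*pi}. ennreal ((norm (\<psi> (rcis (exp x) t)))\<^sup>2 * h t) \<partial>lborel)
         \<le> (\<integral>\<^sup>+t\<in>{0..2*pi}. ennreal (b\<^sup>2 * (c + d * v t powr p)) \<partial>lborel)"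
        using b2 that by (intro nn_integral_mono mult_right_mono ennreal_leI mult_mono) auto
      also have "\<dots> \<le> ennreal (b\<^sup>2 * (c * (2 * pi) + d * (2 * pi)))"
      proof (rule set_nn_integral_le_integral)
        have "((\<lambda>t. b\<^sup>2 * (c + d * v t powr p)) has_integral (b\<^sup>2 * (2 * pi * c + d * integral {0..2*pi} (\<lambda>t. v t powr p)))) {0..2*pi}"
          using has_integral_const_real[of c 0 "2 * pi"]
          by (intro has_integral_mult_right has_integral_add integrable_integral intv) simp
        then have "integral {0..2*pi} (\<lambda>t. b\<^sup>2 * (c + d * v t powr p)) = b\<^sup>2 * (2 * pi * c + d * integral {0..2*pi} (\<lambda>t. v t powr p))"
          by (rule integral_unique)
        also have "\<dots> \<le> b\<^sup>2 * (c * (2 * pi) + d * (2 * pi))"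
          using Iv that by (intro mult_left_mono add_mono) auto
        finally show "integral {0..2*pi} (\<lambda>t. b\<^sup>2 * (c + d * v t powr p)) \<le> b\<^sup>2 * (c * (2 * pi) + d * (2 * pi))" .
      qed (use that in \<open>auto intro!: continuous_intros contv mult_nonneg_nonneg add_nonneg_nonneg\<close>)
      finally show ?thesis .
    qed
    have "(\<integral>\<^sup>+t\<in>{0..2*pi}. ennreal ((norm (\<psi> (rcis (exp x) t)))\<^sup>2 * (1 + (v t)\<^sup>2) powr (1 - min p 2 / 2)) \<partial>lborel)
       \<le> ennreal (b\<^sup>2 * (2 * (2 * pi) + 2 * (2 * pi)))"
      using p v0 by (intro main one_plus_sq_powr_le) (auto simp: min_def field_simps)
    then show "(\<integral>\<^sup>+t\<in>{0..2*pi}. ennreal ((norm (\<psi> (rcis (exp x) t)))\<^sup>2 * (1 + (norm (g (rcis (exp x) t)))\<^sup>2) powr (1 - min p 2 / 2)) \<partial>lborel) \<le> ennreal (b\<^sup>2 * (8 * pi))"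
      by (simp add: v_def)
    define Y where "Y = 1 + (- x) powr (- (1 / p))"
    have Y: "Y \<ge> 1" by (simp add: Y_def)
    \<comment> \<open>The 6 of the growth bound times the 2 lost in passing from
      \<open>1 - exp x\<close> to \<open>- x\<close>.\<close>
    have vle: "v t \<le> 12 * Y" for t
    proof -
      have "v t \<le> 6 * (1 - norm (rcis (exp x) t)) powr (- (1 / p))"
        unfolding v_def using x p by (intro growth_of_bounded_means g I) auto
      also have "\<dots> \<le> 6 * (2 * Y)" unfolding Y_def
        using one_minus_exp_powr_le[OF x, of "1 / p"] p by (intro mult_left_mono) auto
      finally show ?thesis by simp
    qed
    have "(\<integral>\<^sup>+t\<in>{0..2*pi}. ennreal ((norm (\<psi> (rcis (exp x) t)))\<^sup>2 * (1 + (2 * v t) powr (p + 1))) \<partial>lborel)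
       \<le> ennreal (b\<^sup>2 * (1 * (2 * pi) + (2 powr (p + 1) * (12 * Y)) * (2 * pi)))"
    proof (rule main)
      fix t
      have "v t powr (p + 1) = v t powr p * v t" using v0[of t] by (cases "v t = 0") (auto simp: powr_add)
      also have "\<dots> \<le> v t powr p * (12 * Y)" using vle by (intro mult_left_mono) auto
      finally show "1 + (2 * v t) powr (p + 1) \<le> 1 + 2 powr (p + 1) * (12 * Y) * v t powr p"
        using v0[of t] by (simp add: powr_mult mult_ac)
    qed (use Y in auto)
    also have "\<dots> \<le> ennreal (b\<^sup>2 * (2 * pi + 2 powr (p + 1) * (24 * pi)) * Y)"
    proof (rule ennreal_leI)
      have "2 * pi \<le> 2 * pi * Y" using Y by simp
      then have "2 * pi + 2 powr (p + 1) * (12 * Y) * (2 * pi) \<le> (2 * pi + 2 powr (p + 1) * (24 * pi)) * Y"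
        by (simp add: algebra_simps)
      then have "b\<^sup>2 * (2 * pi + 2 powr (p + 1) * (12 * Y) * (2 * pi)) \<le> b\<^sup>2 * ((2 * pi + 2 powr (p + 1) * (24 * pi)) * Y)"
        by (rule mult_left_mono) simp
      then show "b\<^sup>2 * (1 * (2 * pi) + 2 powr (p + 1) * (12 * Y) * (2 * pi)) \<le> b\<^sup>2 * (2 * pi + 2 powr (p + 1) * (24 * pi)) * Y"
        by (simp add: mult_ac)
    qed
    finally show "(\<integral>\<^sup>+t\<in>{0..2*pi}. ennreal ((norm (\<psi> (rcis (exp x) t)))\<^sup>2 * (1 + (2 * norm (g (rcis (exp x) t))) powr (p + 1))) \<partial>lborel)
         \<le> ennreal (b\<^sup>2 * (2 * pi + 2 powr (p + 1) * (24 * pi)) * (1 + (- x) powr (- (1 / p))))"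
      by (simp add: v_def Y_def)
  qed (use p in auto)
next
  assume "p > 2 \<and> \<psi> \<in> hardy_space 2"
  then have p: "p > 2" and hol: "\<psi> holomorphic_on ball 0 1" and "bdd_above (hardy_mean 2 \<psi> ` {0..<1})"
    by (auto simp: hardy_space_def)
  then obtain b where "\<forall>r\<in>{0..<1}. hardy_mean 2 \<psi> r \<le> b" unfolding bdd_above_def by blast
  then have b: "hardy_mean 2 \<psi> r \<le> b" if "0 \<le> r" "r < 1" for r using that by simp
  define K where "K = 2 * pi * b powr 2"
  have "K \<ge> 0" by (simp add: K_def)
  \<comment> \<open>The midpoint of 2 and \<open>p\<close>: above 2 for the dyadic sum, below
    \<open>p\<close> so that \<open>\<gamma> = \<sigma> / p\<close> is less than 1.\<close>
  define \<sigma> where "\<sigma> = (p + 2) / 2"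
  have main: "(\<integral>\<^sup>+t\<in>{0..2*pi}. ennreal ((norm (\<psi> (rcis (exp x) t)))\<^sup>2 * c) \<partial>lborel) \<le> ennreal (K * c)"
    if "x < 0" "0 \<le> c" for x c
  proof (rule set_nn_integral_le_integral)
    show "continuous_on {0..2*pi} (\<lambda>t. (norm (\<psi> (rcis (exp x) t)))\<^sup>2 * c)"
      using that by (intro continuous_intros continuous_on_circle holomorphic_on_imp_continuous_on hol) auto
    have "integral {0..2*pi} (\<lambda>t. (norm (\<psi> (rcis (exp x) t)))\<^sup>2) \<le> K"
      using integral_circle_le_of_hardy_mean[OF hol _ _ _ b, of "exp x"] that by (simp add: K_def)
    then show "integral {0..2*pi} (\<lambda>t. (norm (\<psi> (rcis (exp x) t)))\<^sup>2 * c) \<le> K * c"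
      using that by (simp add: mult_right_mono)
  qed (use that in auto)
  show thesis
  proof (rule that[of 2 \<sigma> "\<sigma> / p" K "K * (1 + 24 powr \<sigma>)"])
    fix g x assume "g \<in> unit_means p" and x: "x < (0::real)"
    then have g: "g holomorphic_on ball 0 1"
      and I: "\<And>r. 0 < r \<Longrightarrow> r < 1 \<Longrightarrow> integral {0..2*pi} (\<lambda>t. norm (g (rcis r t)) powr p) \<le> 2 * pi"
      by (auto simp: unit_means_def)
    \<comment> \<open>With \<open>q = 2\<close> the weight has exponent 0, and \<open>powr\<close>
      then gives 1 only for a nonzero base.\<close>
    have "1 + (norm w)\<^sup>2 \<noteq> 0" for w :: complex by (metis add_pos_nonneg less_irrefl zero_le_power2 zero_less_one)
    then show "(\<integral>\<^sup>+t\<in>{0..2*pi}. ennreal ((norm (\<psi> (rcis (exp x) t)))\<^sup>2 * (1 + (norm (g (rcis (exp x) t)))\<^sup>2) powr (1 - 2 / 2)) \<partial>lborel) \<le> ennreal K"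
      using main[OF x, of 1] by simp
    define Y where "Y = 1 + (- x) powr (- (\<sigma> / p))"
    have Y: "Y \<ge> 1" by (simp add: Y_def)
    \<comment> \<open>Only |\<psi>|^2 is integrated, so g is bounded pointwise. The 24 is 6 from the
      growth bound, 2 from the weight, and the factor 2 of \<open>one_minus_exp_powr_le\<close>
      absorbed into \<open>2 powr \<sigma>\<close>.\<close>
    have le: "1 + (2 * norm (g (rcis (exp x) t))) powr \<sigma> \<le> (1 + 24 powr \<sigma>) * Y" for t
    proof -
      have "norm (g (rcis (exp x) t)) \<le> 6 * (1 - norm (rcis (exp x) t)) powr (- (1 / p))"
        using x p by (intro growth_of_bounded_means g I) auto
      then have "(2 * norm (g (rcis (exp x) t))) powr \<sigma> \<le> (12 * (1 - exp x) powr (- (1 / p))) powr \<sigma>"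
        using p by (intro powr_mono2) (auto simp: \<sigma>_def)
      also have "\<dots> = 12 powr \<sigma> * (1 - exp x) powr (- (\<sigma> / p))"
        by (simp add: powr_mult powr_powr)
      also have "\<dots> \<le> 12 powr \<sigma> * (2 * Y)"
        unfolding Y_def using one_minus_exp_powr_le[OF x, of "\<sigma> / p"] p by (intro mult_left_mono) (auto simp: \<sigma>_def field_simps)
      also have "\<dots> \<le> 24 powr \<sigma> * Y"
      proof -
        have "2 powr 1 \<le> 2 powr \<sigma>" using p by (intro powr_mono) (auto simp: \<sigma>_def)
        moreover have "24 powr \<sigma> = 12 powr \<sigma> * 2 powr \<sigma>" by (simp add: powr_mult[symmetric])
        ultimately have "12 powr \<sigma> * 2 \<le> 24 powr \<sigma>" by simp
        then show ?thesis using Y by (simp add: mult_right_mono flip: mult.assoc)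
      qed
      finally show ?thesis using Y by (simp add: algebra_simps)
    qed
    have "(\<integral>\<^sup>+t\<in>{0..2*pi}. ennreal ((norm (\<psi> (rcis (exp x) t)))\<^sup>2 * (1 + (2 * norm (g (rcis (exp x) t))) powr \<sigma>)) \<partial>lborel)
      \<le> (\<integral>\<^sup>+t\<in>{0..2*pi}. ennreal ((norm (\<psi> (rcis (exp x) t)))\<^sup>2 * ((1 + 24 powr \<sigma>) * Y)) \<partial>lborel)"
      using le by (intro nn_integral_mono mult_right_mono ennreal_leI mult_left_mono) auto
    also have "\<dots> \<le> ennreal (K * ((1 + 24 powr \<sigma>) * Y))" using Y by (intro main x) (simp add: add_nonneg_nonneg)
    finally show "(\<integral>\<^sup>+t\<in>{0..2*pi}. ennreal ((norm (\<psi> (rcis (exp x) t)))\<^sup>2 * (1 + (2 * norm (g (rcis (exp x) t))) powr \<sigma>)) \<partial>lborel)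
      \<le> ennreal (K * (1 + 24 powr \<sigma>) * (1 + (- x) powr (- (\<sigma> / p))))" by (simp add: Y_def mult.assoc)
  qed (use p \<open>K \<ge> 0\<close> in \<open>auto simp: \<sigma>_def add_nonneg_nonneg\<close>)
qed

subsection \<open>Transfer to the strip\<close>

text \<open>One period of the exponential, half-open so that \<open>exp\<close> is injective; the
  image is the disc without its centre.\<close>

definition log_strip :: "complex set" where
  "log_strip = {z. Re z < 0 \<and> 0 \<le> Im z \<and> Im z < 2 * pi}"

lemma sets_log_strip [measurable]: "log_strip \<in> sets borel"
  unfolding log_strip_def by measurable

lemma inj_on_exp_log_strip: "inj_on exp log_strip"
  by (rule inj_onI, rule exp_complex_eqI) (auto simp: log_strip_def)

lemma exp_image_log_strip: "exp ` log_strip = ball 0 1 - {0}"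
proof
  show "exp ` log_strip \<subseteq> ball 0 1 - {0}" by (auto simp: log_strip_def)
  show "ball 0 1 - {0} \<subseteq> exp ` log_strip"
  proof
    fix w assume w: "w \<in> ball (0::complex) 1 - {0}"
    have "w = exp (Complex (ln (cmod w)) (Arg2pi w))"
      using w Arg2pi_eq[of w] by (simp add: exp_Complex rcis_def cis_conv_exp)
    moreover have "Complex (ln (cmod w)) (Arg2pi w) \<in> log_strip"
      using w Arg2pi_ge_0[of w] Arg2pi_lt_2pi[of w] by (auto simp: log_strip_def)
    ultimately show "w \<in> exp ` log_strip" by blast
  qed
qed

lemma nn_integral_log_strip_le:
  assumes h: "h \<in> borel_measurable (restrict_space lborel log_strip)"
    and e: "\<And>x. x < 0 \<Longrightarrow> (\<integral>\<^sup>+t\<in>{0..2*pi}. h (Complex x t) \<partial>lborel) \<le> e x"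
  shows "(\<integral>\<^sup>+z. h z \<partial>restrict_space lborel log_strip) \<le> (\<integral>\<^sup>+x\<in>{..<0}. e x \<partial>lborel)"
proof -
  have [measurable]: "(\<lambda>z. h z * indicator log_strip z) \<in> borel_measurable borel"
    using h by (subst (asm) borel_measurable_restrict_space_iff_ennreal) auto
  have "(\<integral>\<^sup>+z. h z \<partial>restrict_space lborel log_strip) = (\<integral>\<^sup>+z. h z * indicator log_strip z \<partial>lborel)"
    by (subst nn_integral_restrict_space) auto
  also have "\<dots> = (\<integral>\<^sup>+x. \<integral>\<^sup>+t. h (Complex x t) * indicator log_strip (Complex x t) \<partial>lborel \<partial>lborel)"
    by (rule nn_integral_complex_iterated) measurable
  also have "\<dots> \<le> (\<integral>\<^sup>+x\<in>{..<0}. e x \<partial>lborel)"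
  proof (rule nn_integral_mono)
    fix x :: real
    show "(\<integral>\<^sup>+t. h (Complex x t) * indicator log_strip (Complex x t) \<partial>lborel) \<le> e x * indicator {..<0} x"
    proof (cases "x < 0")
      case True
      have "(\<integral>\<^sup>+t. h (Complex x t) * indicator log_strip (Complex x t) \<partial>lborel) \<le> (\<integral>\<^sup>+t\<in>{0..2*pi}. h (Complex x t) \<partial>lborel)"
        by (intro nn_integral_mono mult_left_mono) (auto simp: indicator_def log_strip_def)
      then show ?thesis using e[OF True] True by simp
    qed (simp add: log_strip_def)
  qed
  finally show ?thesis .
qed

lemma borel_measurable_log_strip_continuous:
  fixes h :: "complex \<Rightarrow> 'a::topological_space"
  assumes "continuous_on {z. Re z < 0} h"
  shows "h \<in> borel_measurable (restrict_space lborel log_strip)"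
proof -
  have "continuous_on log_strip h" using assms by (rule continuous_on_subset) (auto simp: log_strip_def)
  then have "h \<in> borel_measurable (restrict_space borel log_strip)" by (rule borel_measurable_continuous_on_restrict)
  then show ?thesis by (simp cong: measurable_cong_sets add: sets_restrict_space)
qed

text \<open>Any positive bound \<open>A\<close> for the Hardy means may replace the norm, which
  permits dividing by it. The Jacobian of \<open>T\<close> is \<open>(w z)\<^sup>2\<close>: one
  factor \<open>w\<close> turns |f'| into A |F'| and the other remains as the weight in the
  Cauchy-Schwarz argument.\<close>

lemma mean_valent_estimate:
  fixes \<phi> f :: "complex \<Rightarrow> complex"
  assumes \<phi>: "\<phi> holomorphic_on ball 0 1" "inj_on \<phi> (ball 0 1)" and G: "\<phi> ` ball 0 1 = G"
    and q: "0 < q" "q \<le> 2" "q \<le> p" and p: "p > 1" and \<sigma>: "2 < \<sigma>" and \<gamma>: "0 < \<gamma>" "\<gamma> < 1" and b: "0 \<le> b1" "0 \<le> b2"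
    and slice1: "\<And>g x. g \<in> unit_means p \<Longrightarrow> x < 0 \<Longrightarrow>
       (\<integral>\<^sup>+t\<in>{0..2*pi}. ennreal ((norm (deriv \<phi> (rcis (exp x) t)))\<^sup>2 * (1 + (norm (g (rcis (exp x) t)))\<^sup>2) powr (1 - q / 2)) \<partial>lborel) \<le> ennreal b1"
    and slice2: "\<And>g x. g \<in> unit_means p \<Longrightarrow> x < 0 \<Longrightarrow>
       (\<integral>\<^sup>+t\<in>{0..2*pi}. ennreal ((norm (deriv \<phi> (rcis (exp x) t)))\<^sup>2 * (1 + (2 * norm (g (rcis (exp x) t))) powr \<sigma>)) \<partial>lborel)
         \<le> ennreal (b2 * (1 + (- x) powr (- \<gamma>)))"
    and n: "n > 0" and mv: "mean_valent n f G" and A: "A > 0" "\<And>r. 0 \<le> r \<Longrightarrow> r < 1 \<Longrightarrow> hardy_mean p (f \<circ> \<phi>) r \<le> A"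
  shows "(\<integral>\<^sup>+w\<in>G. ennreal (norm (deriv f w)) \<partial>lborel) \<le>
    ennreal ((sqrt (8 * pi / q\<^sup>2 * b1 * (2 + 1 / (1 - \<gamma>))) + sqrt (2 * pi * (b2 * (2 / (1 - \<gamma>) + 2)) / (1 - 2 powr (2 - \<sigma>))))
      * sqrt (ln (n + 1)) * A)"
proof -
  let ?H = "{z. Re z < 0}" and ?D = "ball (0::complex) 1"
  let ?N = "restrict_space lborel log_strip"
  define \<psi> where "\<psi> = deriv \<phi>"
  define T where "T = (\<lambda>z. \<phi> (exp z))"
  define g where "g = (\<lambda>w. f (\<phi> w) / A)"
  define F where "F = (\<lambda>z. g (exp z))"
  have oH: "open ?H" by (rule open_halfspace_Re_lt)
  have oG: "open G" using open_mapping_thm3[OF \<phi>(1) open_ball \<phi>(2)] G by simp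
  have f: "f holomorphic_on G" using mv by (simp add: mean_valent_def)
  have expD: "exp z \<in> ?D" if "Re z < 0" for z :: complex using that by simp
  have hol\<psi>: "\<psi> holomorphic_on ?D" unfolding \<psi>_def using \<phi>(1) by (rule holomorphic_deriv) simp
  have f': "deriv f holomorphic_on G" using f oG by (rule holomorphic_deriv)
  have comp: "(\<lambda>w. h (\<phi> w)) holomorphic_on ?D" if "h holomorphic_on G" for h
    using holomorphic_on_compose_gen[OF \<phi>(1) that] G by (simp add: o_def)
  have compe: "(\<lambda>z. h (exp z)) holomorphic_on ?H" if "h holomorphic_on ?D" for h
  proof -
    have "exp ` ?H \<subseteq> ?D" using expD by blast
    from holomorphic_on_compose_gen[OF holomorphic_on_exp that this] show ?thesis by (simp add: o_def)
  qed
  have holg: "g holomorphic_on ?D" unfolding g_def using comp[OF f] A by (intro holomorphic_intros) auto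
  have holF: "F holomorphic_on ?H" unfolding F_def by (rule compe[OF holg])
  have holT: "T holomorphic_on ?H" unfolding T_def by (rule compe[OF \<phi>(1)])
  have TG: "T z \<in> G" if "Re z < 0" for z using expD[OF that] G by (auto simp: T_def)
  have dT: "(T has_field_derivative \<psi> (exp z) * exp z) (at z)" if "Re z < 0" for z
    unfolding T_def
    by (rule DERIV_chain2[OF _ DERIV_exp]) (use expD[OF that] holomorphic_derivI[OF \<phi>(1)] in \<open>auto simp: \<psi>_def\<close>)
  have dF: "(F has_field_derivative deriv f (T z) * (\<psi> (exp z) * exp z) / A) (at z)" if "Re z < 0" for z
  proof -
    have "((\<lambda>z. f (T z)) has_field_derivative deriv f (T z) * (\<psi> (exp z) * exp z)) (at z)"
      by (rule DERIV_chain2[OF _ dT[OF that]]) (use TG[OF that] holomorphic_derivI[OF f oG] in auto)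
    then show ?thesis unfolding F_def g_def T_def by (rule DERIV_cdivide)
  qed
  have Ig: "integral {0..2*pi} (\<lambda>t. norm (g (rcis r t)) powr p) \<le> 2 * pi" if "0 < r" "r < 1" for r
  proof -
    have "(f \<circ> \<phi>) holomorphic_on ?D" using comp[OF f] by (simp add: o_def)
    from integral_circle_le_of_hardy_mean[OF this _ _ _ A(2), of r] that p
    have "integral {0..2*pi} (\<lambda>t. norm ((f \<circ> \<phi>) (rcis r t)) powr p) \<le> 2 * pi * A powr p"
      by simp
    then have "integral {0..2*pi} (\<lambda>t. norm (f (\<phi> (rcis r t))) powr p) / A powr p \<le> 2 * pi"
      using A by (simp add: field_simps)
    then show ?thesis using A by (simp add: g_def norm_divide powr_divide)
  qed
  have g1: "g \<in> unit_means p" using holg Ig by (simp add: unit_means_def)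
  define u where "u = (\<lambda>z. norm (F z))"
  define w where "w = (\<lambda>z. norm (\<psi> (exp z)) * exp (Re z))"
  \<comment> \<open>This is |F'| on the half plane; the explicit product is nonnegative everywhere
    and exhibits the factor \<open>w\<close>.\<close>
  define a where "a = (\<lambda>z. norm (deriv f (T z)) * w z / A)"
  define k where "k = (\<lambda>z. (1 + (u z)\<^sup>2) powr (q / 2 - 1))"
  have u2: "1 + (u z)\<^sup>2 > 0" for z by (simp add: add_pos_nonneg)
  have contu: "continuous_on ?H u" unfolding u_def by (intro continuous_intros holomorphic_on_imp_continuous_on holF)
  have contw: "continuous_on ?H w" unfolding w_def
    by (intro continuous_intros holomorphic_on_imp_continuous_on[OF compe[OF hol\<psi>]])
  have conta: "continuous_on ?H a" unfolding a_def T_def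
    using A by (intro continuous_intros contw holomorphic_on_imp_continuous_on[OF compe[OF comp[OF f']]]) auto
  have contk: "continuous_on ?H k" unfolding k_def
    by (intro continuous_on_powr contu continuous_intros ballI less_imp_neq[OF u2, symmetric])
  note meas [measurable] = borel_measurable_log_strip_continuous[OF contu] borel_measurable_log_strip_continuous[OF contw]
    borel_measurable_log_strip_continuous[OF conta] borel_measurable_log_strip_continuous[OF contk]
  have measRe [measurable]: "(\<lambda>z. - Re z) \<in> borel_measurable ?N"
    by (intro borel_measurable_log_strip_continuous continuous_intros)
  have wT: "norm (deriv T z) = w z" if "Re z < 0" for z
    using DERIV_imp_deriv[OF dT[OF that]] by (simp add: w_def norm_mult)
  have aF: "norm (deriv F z) = a z" if "Re z < 0" for z
    using DERIV_imp_deriv[OF dF[OF that]] A by (simp add: a_def w_def norm_mult norm_divide)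
  have uT: "u z = norm (f (T z)) / A" for z using A by (simp add: u_def F_def g_def T_def norm_divide)
  have w0: "0 \<le> w z" for z by (simp add: w_def)
  have a0: "0 \<le> a z" for z using A w0 by (simp add: a_def)
  \<comment> \<open>The centre of the disc is not a value of \<open>exp\<close>, so the single point
    \<open>\<phi> 0\<close> is missed; it has measure zero.\<close>
  have TS: "T ` log_strip = G - {\<phi> 0}"
  proof -
    have "T ` log_strip = \<phi> ` (?D - {0})" unfolding T_def by (simp flip: exp_image_log_strip add: image_image)
    also have "\<dots> = G - {\<phi> 0}" using inj_on_image_set_diff[OF \<phi>(2), of ?D "{0}"] G by auto
    finally show ?thesis .
  qed
  have injT: "inj_on T log_strip"
  proof -
    have "exp ` log_strip \<subseteq> ?D" by (auto simp: exp_image_log_strip)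
    then have "inj_on \<phi> (exp ` log_strip)" using \<phi>(2) by (rule inj_on_subset[rotated])
    then have "inj_on (\<phi> \<circ> exp) log_strip" by (rule comp_inj_on[OF inj_on_exp_log_strip])
    then show ?thesis by (simp add: T_def o_def)
  qed
  have cov: "(\<integral>\<^sup>+y\<in>G. P y \<partial>lborel) = (\<integral>\<^sup>+z. ennreal ((w z)\<^sup>2) * P (T z) \<partial>?N)"
    if P: "P \<in> borel_measurable borel" for P
  proof -
    have "(\<integral>\<^sup>+y\<in>G. P y \<partial>lborel) = (\<integral>\<^sup>+y\<in>T ` log_strip. P y \<partial>lborel)"
    proof (rule nn_integral_cong_AE)
      show "AE y in lborel. P y * indicator G y = P y * indicator (T ` log_strip) y"
        using AE_lborel_singleton[of "\<phi> 0"] by eventually_elim (auto simp: TS indicator_def)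
    qed
    also have "\<dots> = (\<integral>\<^sup>+z\<in>log_strip. ennreal ((norm (deriv T z))\<^sup>2) * P (T z) \<partial>lborel)"
    proof (rule nn_integral_holomorphic_image[OF sets_log_strip _ holT oH _ injT P])
      show "T ` log_strip \<in> sets borel" unfolding TS using oG by auto
    qed (auto simp: log_strip_def)
    also have "\<dots> = (\<integral>\<^sup>+z\<in>log_strip. ennreal ((w z)\<^sup>2) * P (T z) \<partial>lborel)"
      by (intro nn_integral_cong) (auto simp: indicator_def log_strip_def wT)
    also have "\<dots> = (\<integral>\<^sup>+z. ennreal ((w z)\<^sup>2) * P (T z) \<partial>?N)"
      by (subst nn_integral_restrict_space) auto
    finally show ?thesis .
  qed
  \<comment> \<open>\<open>f\<close> is arbitrary outside \<open>G\<close>. Extending it and its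
    derivative by 0 gives the Borel functions to which \<open>cov\<close> applies.\<close>
  define f0 where "f0 = (\<lambda>y. if y \<in> G then f y else 0)"
  define f1 where "f1 = (\<lambda>y. if y \<in> G then deriv f y else 0)"
  have [measurable]: "f0 \<in> borel_measurable borel" "f1 \<in> borel_measurable borel"
    unfolding f0_def f1_def using oG
    by (intro borel_measurable_continuous_on_if holomorphic_on_imp_continuous_on f f' continuous_intros; simp)+
  have lhs: "(\<integral>\<^sup>+y\<in>G. ennreal (norm (deriv f y)) \<partial>lborel) = ennreal A * (\<integral>\<^sup>+z. ennreal (a z * w z) \<partial>?N)"
  proof -
    have "(\<integral>\<^sup>+y\<in>G. ennreal (norm (deriv f y)) \<partial>lborel) = (\<integral>\<^sup>+y\<in>G. ennreal (norm (f1 y)) \<partial>lborel)"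
      by (intro nn_integral_cong) (auto simp: f1_def indicator_def)
    also have "\<dots> = (\<integral>\<^sup>+z. ennreal ((w z)\<^sup>2) * ennreal (norm (f1 (T z))) \<partial>?N)"
      by (rule cov) measurable
    also have "\<dots> = (\<integral>\<^sup>+z. ennreal A * ennreal (a z * w z) \<partial>?N)"
    proof (rule nn_integral_cong)
      fix z assume "z \<in> space ?N"
      then have "Re z < 0" by (simp add: space_restrict_space log_strip_def)
      then show "ennreal ((w z)\<^sup>2) * ennreal (norm (f1 (T z))) = ennreal A * ennreal (a z * w z)"
        using A w0 TG by (simp add: f1_def a_def power2_eq_square mult_ac flip: ennreal_mult')
    qed
    also have "\<dots> = ennreal A * (\<integral>\<^sup>+z. ennreal (a z * w z) \<partial>?N)" by (rule nn_integral_cmult) measurable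
    finally show ?thesis .
  qed
  \<comment> \<open>The area bound is invariant under scaling: |F| \<le> R means |f| \<le> R A, and
    the resulting factor A^2 cancels against the one in |F'|^2.\<close>
  have mvN: "(\<integral>\<^sup>+z. ennreal ((a z)\<^sup>2) * indicator {y. y \<le> R} (u z) \<partial>?N) \<le> ennreal (pi * n * R\<^sup>2)" if R: "R > 0" for R
  proof -
    define P where "P = (\<lambda>y. ennreal ((norm (f1 y))\<^sup>2 / A\<^sup>2) * indicator {..R * A} (norm (f0 y)))"
    have [measurable]: "P \<in> borel_measurable borel" unfolding P_def by measurable
    have "(\<integral>\<^sup>+z. ennreal ((a z)\<^sup>2) * indicator {y. y \<le> R} (u z) \<partial>?N) = (\<integral>\<^sup>+z. ennreal ((w z)\<^sup>2) * P (T z) \<partial>?N)"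
    proof (rule nn_integral_cong)
      fix z assume "z \<in> space ?N"
      then have "T z \<in> G" using TG by (simp add: space_restrict_space log_strip_def)
      moreover have "u z \<le> R \<longleftrightarrow> norm (f (T z)) \<le> R * A" unfolding uT using A by (simp add: field_simps)
      moreover have "(a z)\<^sup>2 = (w z)\<^sup>2 * ((norm (deriv f (T z)))\<^sup>2 / A\<^sup>2)"
        by (simp add: a_def power_divide power_mult_distrib)
      then have "ennreal ((a z)\<^sup>2) = ennreal ((w z)\<^sup>2) * ennreal ((norm (deriv f (T z)))\<^sup>2 / A\<^sup>2)"
        by (simp only: ennreal_mult' zero_le_power2)
      ultimately show "ennreal ((a z)\<^sup>2) * indicator {y. y \<le> R} (u z) = ennreal ((w z)\<^sup>2) * P (T z)"
        by (simp add: P_def f0_def f1_def indicator_def)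
    qed
    also have "\<dots> = (\<integral>\<^sup>+y\<in>G. P y \<partial>lborel)" by (rule cov[symmetric]) measurable
    also have "\<dots> = (\<integral>\<^sup>+y. ennreal (1 / A\<^sup>2) * (ennreal ((norm (f1 y))\<^sup>2) * indicator {..R * A} (norm (f0 y)) * indicator G y) \<partial>lborel)"
      by (intro nn_integral_cong) (auto simp: P_def indicator_def simp flip: ennreal_mult')
    also have "\<dots> = ennreal (1 / A\<^sup>2) * (\<integral>\<^sup>+y. ennreal ((norm (f1 y))\<^sup>2) * indicator {..R * A} (norm (f0 y)) * indicator G y \<partial>lborel)"
      using oG by (intro nn_integral_cmult) measurable
    also have "(\<integral>\<^sup>+y. ennreal ((norm (f1 y))\<^sup>2) * indicator {..R * A} (norm (f0 y)) * indicator G y \<partial>lborel)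
       = (\<integral>\<^sup>+y\<in>{y\<in>G. norm (f y) \<le> R * A}. ennreal ((norm (deriv f y))\<^sup>2) \<partial>lborel)"
      by (intro nn_integral_cong) (auto simp: f0_def f1_def indicator_def)
    also have "ennreal (1 / A\<^sup>2) * \<dots> \<le> ennreal (1 / A\<^sup>2) * ennreal (pi * n * (R * A)\<^sup>2)"
      using R A by (intro mult_left_mono mean_valent_area[OF mv oG]) auto
    also have "\<dots> = ennreal (pi * n * R\<^sup>2)" using A by (simp add: power_mult_distrib mult.assoc flip: ennreal_mult')
    finally show ?thesis .
  qed
  have circ: "F (Complex x t) = g (rcis (exp x) t)" "\<psi> (exp (Complex x t)) = \<psi> (rcis (exp x) t)" for x t
    by (simp_all add: F_def exp_Complex)
  have msl: "(\<lambda>t. h (Complex x t)) \<in> borel_measurable borel" if "x < 0" "continuous_on ?H h" for h :: "complex \<Rightarrow> real" and x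
    by (intro borel_measurable_continuous_onI continuous_on_compose2[OF that(2)])
      (use that(1) in \<open>auto simp: Complex_eq intro!: continuous_intros\<close>)
  \<comment> \<open>The constant is the Hardy-Stein bound with \<open>B = 8 * pi\<close>: on each
    circle (1 + |F|^2)^(q/2) is at most 2 + 2 |F|^p, and the integral of |F|^p is at most
    \<open>2 * pi\<close>.\<close>
  have H0: "(\<integral>\<^sup>+z. ennreal (- Re z * k z * (a z)\<^sup>2) \<partial>?N) \<le> ennreal (8 * pi / q\<^sup>2)"
  proof -
    have "(\<integral>\<^sup>+z. ennreal (- Re z * k z * (a z)\<^sup>2) \<partial>?N) \<le> (\<integral>\<^sup>+x\<in>{..<0}. (\<integral>\<^sup>+t\<in>{0..2*pi}. ennreal (- x * (1 + (norm (F (Complex x t)))\<^sup>2) powr (q / 2 - 1)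
      * (norm (deriv F (Complex x t)))\<^sup>2) \<partial>lborel) \<partial>lborel)"
      by (rule nn_integral_log_strip_le) (measurable, simp add: aF k_def u_def)
    also have "\<dots> \<le> ennreal (8 * pi / q\<^sup>2)"
    proof (rule hardy_stein_half_plane[OF holF _ q(1,2)])
      show "F (z + 2 * of_real pi * \<i>) = F z" for z by (simp add: F_def exp_add)
      fix x :: real assume x: "x < 0"
      define v where "v = (\<lambda>t. norm (g (rcis (exp x) t)))"
      have contv: "continuous_on {0..2*pi} v" unfolding v_def
        using x by (intro continuous_intros continuous_on_circle holomorphic_on_imp_continuous_on holg) auto
      have v0: "0 \<le> v t" for t by (simp add: v_def)
      have "continuous_on {0..2*pi} (\<lambda>t. v t powr p)"
        using p v0 by (intro continuous_on_powr' contv continuous_intros) auto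
      moreover have "continuous_on {0..2*pi} (\<lambda>t. (1 + (v t)\<^sup>2) powr (q / 2))"
        using q by (intro continuous_on_powr' contv continuous_intros) (auto simp: add_nonneg_nonneg)
      ultimately have int: "(\<lambda>t. v t powr p) integrable_on {0..2*pi}" "(\<lambda>t. (1 + (v t)\<^sup>2) powr (q / 2)) integrable_on {0..2*pi}"
        by (auto intro: integrable_continuous_real)
      have "((\<lambda>t. 2 + 2 * v t powr p) has_integral (4 * pi + 2 * integral {0..2*pi} (\<lambda>t. v t powr p))) {0..2*pi}"
        using has_integral_const_real[of "2::real" 0 "2 * pi"]
        by (intro has_integral_add has_integral_mult_right integrable_integral int(1)) simp
      moreover have "(1 + (v t)\<^sup>2) powr (q / 2) \<le> 2 + 2 * v t powr p" for t
        by (rule one_plus_sq_powr_le) (use q v0 in auto)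
      ultimately have "integral {0..2*pi} (\<lambda>t. (1 + (v t)\<^sup>2) powr (q / 2)) \<le> 4 * pi + 2 * integral {0..2*pi} (\<lambda>t. v t powr p)"
        by (rule has_integral_le[OF integrable_integral[OF int(2)]])
      also have "\<dots> \<le> 8 * pi" using Ig[of "exp x"] x by (simp add: v_def)
      finally show "integral {0..2*pi} (\<lambda>t. (1 + (norm (F (Complex x t)))\<^sup>2) powr (q / 2)) \<le> 8 * pi" by (simp add: circ v_def)
    qed
    finally show ?thesis .
  qed
  \<comment> \<open>Common scheme for \<open>H1\<close> and \<open>outer\<close>: \<open>e\<close>
    is a radial weight, \<open>h\<close> a function of |F|, and \<open>c * l x\<close> bounds the
    integral of |\<psi>|^2 \<open>h\<close> over a circle, so a one-dimensional integral
    remains.\<close>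
  have slices: "(\<integral>\<^sup>+z. ennreal (e (- Re z) * ((norm (\<psi> (exp z)))\<^sup>2 * h z)) * indicator E (- Re z) \<partial>?N)
     \<le> ennreal c * (\<integral>\<^sup>+x\<in>{..<0}. ennreal (e (- x) * l x) * indicator E (- x) \<partial>lborel)"
    if h: "continuous_on ?H h" "\<And>z. 0 \<le> h z" and e: "\<And>s. s > 0 \<Longrightarrow> 0 \<le> e s" "e \<in> borel_measurable borel" 
      and [measurable]: "E \<in> sets borel" "l \<in> borel_measurable borel" and c: "0 \<le> c"
      and le: "\<And>x. x < 0 \<Longrightarrow> (\<integral>\<^sup>+t\<in>{0..2*pi}. ennreal ((norm (\<psi> (exp (Complex x t))))\<^sup>2 * h (Complex x t)) \<partial>lborel) \<le> ennreal (c * l x)"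
    for e h E c l
  proof -
    have conth: "continuous_on ?H (\<lambda>z. (norm (\<psi> (exp z)))\<^sup>2 * h z)"
      by (intro continuous_intros h holomorphic_on_imp_continuous_on[OF compe[OF hol\<psi>]])
    note [measurable] = borel_measurable_log_strip_continuous[OF conth] e(2)
    have "(\<integral>\<^sup>+z. ennreal (e (- Re z) * ((norm (\<psi> (exp z)))\<^sup>2 * h z)) * indicator E (- Re z) \<partial>?N)
      \<le> (\<integral>\<^sup>+x\<in>{..<0}. ennreal c * (ennreal (e (- x) * l x) * indicator E (- x)) \<partial>lborel)"
    proof (rule nn_integral_log_strip_le)
      show "(\<lambda>z. ennreal (e (- Re z) * ((norm (\<psi> (exp z)))\<^sup>2 * h z)) * indicator E (- Re z)) \<in> borel_measurable ?N"
        by measurable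
      fix x :: real assume x: "x < 0"
      have [measurable]: "(\<lambda>t. (norm (\<psi> (exp (Complex x t))))\<^sup>2 * h (Complex x t)) \<in> borel_measurable borel"
        using msl[OF x conth] .
      have "(\<integral>\<^sup>+t\<in>{0..2*pi}. ennreal (e (- Re (Complex x t)) * ((norm (\<psi> (exp (Complex x t))))\<^sup>2 * h (Complex x t))) * indicator E (- Re (Complex x t)) \<partial>lborel)
        = (\<integral>\<^sup>+t. (ennreal (e (- x)) * indicator E (- x)) * (ennreal ((norm (\<psi> (exp (Complex x t))))\<^sup>2 * h (Complex x t)) * indicator {0..2*pi} t) \<partial>lborel)"
        using e(1)[of "- x"] x by (intro nn_integral_cong) (simp add: ennreal_mult' mult_ac)
      also have "\<dots> = (ennreal (e (- x)) * indicator E (- x)) * (\<integral>\<^sup>+t\<in>{0..2*pi}. ennreal ((norm (\<psi> (exp (Complex x t))))\<^sup>2 * h (Complex x t)) \<partial>lborel)"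
        by (rule nn_integral_cmult) measurable
      also have "\<dots> \<le> (ennreal (e (- x)) * indicator E (- x)) * ennreal (c * l x)"
        by (intro mult_left_mono le x) auto
      also have "\<dots> = ennreal c * (ennreal (e (- x) * l x) * indicator E (- x))"
        using ennreal_mult'[OF e(1)[of "- x"], of "l x"] ennreal_mult'[OF c, of "l x"] x by (simp add: mult_ac)
      finally show "(\<integral>\<^sup>+t\<in>{0..2*pi}. ennreal (e (- Re (Complex x t)) * ((norm (\<psi> (exp (Complex x t))))\<^sup>2 * h (Complex x t))) * indicator E (- Re (Complex x t)) \<partial>lborel)
         \<le> ennreal c * (ennreal (e (- x) * l x) * indicator E (- x))" .
    qed
    also have "\<dots> = (\<integral>\<^sup>+x. ennreal c * (ennreal (e (- x) * l x) * indicator E (- x) * indicator {..<0} x) \<partial>lborel)"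
      by (intro nn_integral_cong) (simp add: mult.assoc)
    also have "\<dots> = ennreal c * (\<integral>\<^sup>+x\<in>{..<0}. ennreal (e (- x) * l x) * indicator E (- x) \<partial>lborel)"
      by (rule nn_integral_cmult) measurable
    finally show ?thesis .
  qed
  have exp2: "(exp (Re z))\<^sup>2 = exp (2 * Re z)" for z by (simp add: exp_double)
  have w2: "(w z)\<^sup>2 = exp (2 * Re z) * (norm (\<psi> (exp z)))\<^sup>2" for z
    by (simp add: w_def power_mult_distrib exp2 mult.commute)
  have H1: "(\<integral>\<^sup>+z. ennreal ((w z)\<^sup>2 / (- Re z * k z)) * indicator {\<alpha>..} (- Re z) \<partial>?N) \<le> ennreal (b1 * (1 - ln \<alpha>))"
    if \<alpha>: "0 < \<alpha>" "\<alpha> \<le> 1" for \<alpha>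
  proof -
    have "(\<integral>\<^sup>+z. ennreal ((w z)\<^sup>2 / (- Re z * k z)) * indicator {\<alpha>..} (- Re z) \<partial>?N)
      = (\<integral>\<^sup>+z. ennreal (exp (- 2 * (- Re z)) / (- Re z) * ((norm (\<psi> (exp z)))\<^sup>2 * (1 + (u z)\<^sup>2) powr (1 - q / 2))) * indicator {\<alpha>..} (- Re z) \<partial>?N)"
    proof (rule nn_integral_cong)
      fix z assume "z \<in> space ?N"
      have k_inv: "1 / k z = (1 + (u z)\<^sup>2) powr (1 - q / 2)"
        unfolding k_def by (simp add: powr_minus_divide[symmetric])
      have "(w z)\<^sup>2 / (- Re z * k z) = exp (- 2 * (- Re z)) / (- Re z) * ((norm (\<psi> (exp z)))\<^sup>2 * (1 + (u z)\<^sup>2) powr (1 - q / 2))"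
        unfolding w2 k_inv[symmetric] by simp
      then show "ennreal ((w z)\<^sup>2 / (- Re z * k z)) * indicator {\<alpha>..} (- Re z)
        = ennreal (exp (- 2 * (- Re z)) / (- Re z) * ((norm (\<psi> (exp z)))\<^sup>2 * (1 + (u z)\<^sup>2) powr (1 - q / 2))) * indicator {\<alpha>..} (- Re z)"
        by simp
    qed
    also have "\<dots> \<le> ennreal b1 * (\<integral>\<^sup>+x\<in>{..<0}. ennreal (exp (- 2 * (- x)) / (- x) * 1) * indicator {\<alpha>..} (- x) \<partial>lborel)"
    proof (rule slices)
      show "continuous_on ?H (\<lambda>z. (1 + (u z)\<^sup>2) powr (1 - q / 2))"
        by (intro continuous_on_powr contu continuous_intros ballI less_imp_neq[OF u2, symmetric])
      show "(\<integral>\<^sup>+t\<in>{0..2*pi}. ennreal ((norm (\<psi> (exp (Complex x t))))\<^sup>2 * (1 + (u (Complex x t))\<^sup>2) powr (1 - q / 2)) \<partial>lborel) \<le> ennreal (b1 * 1)"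
        if "x < 0" for x
        using slice1[OF g1 that] by (simp add: circ exp_Complex u_def \<psi>_def)
    qed (use b in auto)
    also have "\<dots> = ennreal b1 * (\<integral>\<^sup>+x\<in>{..<0}. ennreal (exp (2 * x) / (- x)) * indicator {\<alpha>..} (- x) \<partial>lborel)" by simp
    also have "\<dots> \<le> ennreal b1 * ennreal (1 - ln \<alpha>)" by (intro mult_left_mono nn_integral_exp_over_le \<alpha>) simp
    also have "\<dots> = ennreal (b1 * (1 - ln \<alpha>))" using b by (simp add: ennreal_mult')
    finally show ?thesis .
  qed
  have outer: "(\<integral>\<^sup>+z. ennreal ((w z)\<^sup>2 * (1 + (2 * u z) powr \<sigma>)) * indicator E (- Re z) \<partial>?N)
    \<le> ennreal b2 * (\<integral>\<^sup>+x\<in>{..<0}. ennreal (exp (2 * x) * (1 + (- x) powr (- \<gamma>))) * indicator E (- x) \<partial>lborel)"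
    if "E \<in> sets borel" for E
  proof -
    have "(\<integral>\<^sup>+z. ennreal ((w z)\<^sup>2 * (1 + (2 * u z) powr \<sigma>)) * indicator E (- Re z) \<partial>?N)
      = (\<integral>\<^sup>+z. ennreal (exp (- 2 * (- Re z)) * ((norm (\<psi> (exp z)))\<^sup>2 * (1 + (2 * u z) powr \<sigma>))) * indicator E (- Re z) \<partial>?N)"
      unfolding w2 by (simp add: mult.assoc)
    also have "\<dots> \<le> ennreal b2 * (\<integral>\<^sup>+x\<in>{..<0}. ennreal (exp (- 2 * (- x)) * (1 + (- x) powr (- \<gamma>))) * indicator E (- x) \<partial>lborel)"
    proof (rule slices)
      show "continuous_on ?H (\<lambda>z. 1 + (2 * u z) powr \<sigma>)"
        using \<sigma> by (intro continuous_intros continuous_on_powr' contu) (auto simp: u_def)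
      show "(\<integral>\<^sup>+t\<in>{0..2*pi}. ennreal ((norm (\<psi> (exp (Complex x t))))\<^sup>2 * (1 + (2 * u (Complex x t)) powr \<sigma>)) \<partial>lborel)
        \<le> ennreal (b2 * (1 + (- x) powr (- \<gamma>)))" if "x < 0" for x
        using slice2[OF g1 that] by (simp add: circ exp_Complex u_def \<psi>_def)
    qed (use b that in \<open>auto simp: add_nonneg_nonneg\<close>)
    finally show ?thesis by simp
  qed
  \<comment> \<open>The exponent is \<open>\<eta> = 1 - \<gamma>\<close>. The constant is enlarged
    by 2 inside the bracket so that it also serves in \<open>H3\<close>.\<close>
  have H2: "(\<integral>\<^sup>+z. ennreal ((w z)\<^sup>2 * (1 + (2 * u z) powr \<sigma>)) * indicator {..<\<alpha>} (- Re z) \<partial>?N)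
     \<le> ennreal (b2 * (2 / (1 - \<gamma>) + 2) * \<alpha> powr (1 - \<gamma>))" if \<alpha>: "0 < \<alpha>" "\<alpha> \<le> 1" for \<alpha>
  proof -
    have "(\<integral>\<^sup>+z. ennreal ((w z)\<^sup>2 * (1 + (2 * u z) powr \<sigma>)) * indicator {..<\<alpha>} (- Re z) \<partial>?N)
      \<le> ennreal b2 * ennreal (2 / (1 - \<gamma>) * \<alpha> powr (1 - \<gamma>))"
      by (rule order_trans[OF outer mult_left_mono[OF nn_integral_powr_le[OF \<alpha> \<gamma>]]]) auto
    also have "\<dots> \<le> ennreal b2 * ennreal ((2 / (1 - \<gamma>) + 2) * \<alpha> powr (1 - \<gamma>))"
      by (intro mult_left_mono ennreal_leI mult_right_mono) auto
    also have "\<dots> = ennreal (b2 * (2 / (1 - \<gamma>) + 2) * \<alpha> powr (1 - \<gamma>))"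
      using b by (simp add: mult.assoc flip: ennreal_mult')
    finally show ?thesis .
  qed
  have H3: "(\<integral>\<^sup>+z. ennreal ((w z)\<^sup>2 * (1 + (2 * u z) powr \<sigma>)) \<partial>?N) \<le> ennreal (b2 * (2 / (1 - \<gamma>) + 2))"
  proof -
    have "(\<integral>\<^sup>+z. ennreal ((w z)\<^sup>2 * (1 + (2 * u z) powr \<sigma>)) \<partial>?N) \<le> ennreal b2 * ennreal (2 / (1 - \<gamma>) + 2)"
      using outer[of UNIV] mult_left_mono[OF nn_integral_powr_total_le[OF \<gamma>], of "ennreal b2"] by simp
    then show ?thesis using b by (simp add: ennreal_mult')
  qed
  have "(\<integral>\<^sup>+z. ennreal (a z * w z) \<partial>?N)
    \<le> ennreal ((sqrt (8 * pi / q\<^sup>2 * b1 * (2 + 1 / (1 - \<gamma>))) + sqrt (2 * pi * (b2 * (2 / (1 - \<gamma>) + 2)) / (1 - 2 powr (2 - \<sigma>)))) * sqrt (ln (n + 1)))"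
  proof (rule nn_integral_le_sqrt_ln[where u = u and k = k and s = "\<lambda>z. - Re z", OF meas(3,1,2) measRe meas(4) a0 _ w0 _ _ _ _ _ \<sigma> _ n mvN H0 H1 H2 H3])
    show "0 < k z" for z using u2[of z] by (simp add: k_def)
    show "0 \<le> b2 * (2 / (1 - \<gamma>) + 2)" using b \<gamma> by simp
    show "0 < - Re z" if "z \<in> space ?N" for z using that by (simp add: space_restrict_space log_strip_def)
  qed (use b \<gamma> q in \<open>simp_all add: u_def\<close>)
  then have "(\<integral>\<^sup>+w\<in>G. ennreal (norm (deriv f w)) \<partial>lborel) \<le> ennreal A * 
     ennreal ((sqrt (8 * pi / q\<^sup>2 * b1 * (2 + 1 / (1 - \<gamma>))) + sqrt (2 * pi * (b2 * (2 / (1 - \<gamma>) + 2)) / (1 - 2 powr (2 - \<sigma>)))) * sqrt (ln (n + 1)))"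
    unfolding lhs by (rule mult_left_mono) simp
  then show ?thesis using A by (simp add: mult_ac flip: ennreal_mult')
qed

theorem theorem3p2:
  fixes G :: "complex set" and \<phi> :: "complex \<Rightarrow> complex" and p :: real
  assumes "open G" and "connected G" and "G \<noteq> {}" and "bounded G" and "simply_connected G"
    and "conformal_map \<phi> (ball 0 1) G"
    and "(p > 1 \<and> deriv \<phi> \<in> hardy_infinity) \<or> (p > 2 \<and> deriv \<phi> \<in> hardy_space 2)"
  shows "\<exists>C>0. \<forall>n>0. \<forall>f. mean_valent n f G \<and> f \<circ> \<phi> \<in> hardy_space p \<longrightarrow>
           (\<integral>\<^sup>+w\<in>G. ennreal (norm (deriv f w)) \<partial>lborel)
             \<le> ennreal (C * sqrt (ln (n + 1)) * hardy_norm p (f \<circ> \<phi>))"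
proof -
  have \<phi>: "\<phi> holomorphic_on ball 0 1" "inj_on \<phi> (ball 0 1)" "\<phi> ` ball 0 1 = G"
    using assms(6) by (auto simp: conformal_map_def bij_betw_def)
  have p: "p > 1" using assms(7) by auto
  obtain q \<sigma> \<gamma> b1 b2 :: real where q: "0 < q" "q \<le> 2" "q \<le> p" and \<sigma>: "2 < \<sigma>" and \<gamma>: "0 < \<gamma>" "\<gamma> < 1"
    and b: "0 \<le> b1" "0 \<le> b2"
    and slice1: "\<And>g x. g \<in> unit_means p \<Longrightarrow> x < 0 \<Longrightarrow>
       (\<integral>\<^sup>+t\<in>{0..2*pi}. ennreal ((norm (deriv \<phi> (rcis (exp x) t)))\<^sup>2 * (1 + (norm (g (rcis (exp x) t)))\<^sup>2) powr (1 - q / 2)) \<partial>lborel) \<le> ennreal b1"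
    and slice2: "\<And>g x. g \<in> unit_means p \<Longrightarrow> x < 0 \<Longrightarrow>
       (\<integral>\<^sup>+t\<in>{0..2*pi}. ennreal ((norm (deriv \<phi> (rcis (exp x) t)))\<^sup>2 * (1 + (2 * norm (g (rcis (exp x) t))) powr \<sigma>)) \<partial>lborel)
         \<le> ennreal (b2 * (1 + (- x) powr (- \<gamma>)))"
    by (rule slice_bounds[OF assms(7)]) blast
  \<comment> \<open>The summand 1 ensures \<open>C > 0\<close>, since \<open>b1\<close> and
    \<open>b2\<close> may be 0; the estimate itself holds with \<open>C - 1\<close>.\<close>
  define C where "C = sqrt (8 * pi / q\<^sup>2 * b1 * (2 + 1 / (1 - \<gamma>))) + sqrt (2 * pi * (b2 * (2 / (1 - \<gamma>) + 2)) / (1 - 2 powr (2 - \<sigma>))) + 1"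
  have "2 powr (2 - \<sigma>) < (1::real)" using \<sigma> by (simp add: powr_less_one)
  then have C: "C > 0" unfolding C_def using b \<gamma> q by (intro add_nonneg_pos add_nonneg_nonneg real_sqrt_ge_zero) auto
  show ?thesis
  proof (intro exI[of _ C] conjI allI impI C; elim conjE)
    fix n :: real and f assume n: "n > 0" and mv: "mean_valent n f G" and fH: "f \<circ> \<phi> \<in> hardy_space p"
    define A where "A = hardy_norm p (f \<circ> \<phi>)"
    have bdd: "bdd_above (hardy_mean p (f \<circ> \<phi>) ` {0..<1})" using fH by (simp add: hardy_space_def)
    have A_ge: "hardy_mean p (f \<circ> \<phi>) r \<le> A" if "0 \<le> r" "r < 1" for r
      unfolding A_def hardy_norm_def using that by (intro cSUP_upper bdd) auto
    have "0 \<le> hardy_mean p (f \<circ> \<phi>) 0" by (simp add: hardy_mean_def)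
    then have A0: "0 \<le> A" using A_ge[of 0] by linarith
    have L: "sqrt (ln (n + 1)) \<ge> 0" using n by simp
    \<comment> \<open>The Hardy norm may be 0, while \<open>mean_valent_estimate\<close> asks for a
      positive bound; hence \<open>\<epsilon>\<close>, which is sent to 0 at the end.\<close>
    have est: "(\<integral>\<^sup>+w\<in>G. ennreal (norm (deriv f w)) \<partial>lborel) \<le> ennreal (C * sqrt (ln (n + 1)) * (A + \<epsilon>))" if "\<epsilon> > 0" for \<epsilon>
    proof -
      have "hardy_mean p (f \<circ> \<phi>) r \<le> A + \<epsilon>" if "0 \<le> r" "r < 1" for r using A_ge[OF that] \<open>\<epsilon> > 0\<close> by linarith
      from mean_valent_estimate[OF \<phi> q p \<sigma> \<gamma> b slice1 slice2 n mv _ this]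
      have "(\<integral>\<^sup>+w\<in>G. ennreal (norm (deriv f w)) \<partial>lborel) \<le> ennreal ((C - 1) * sqrt (ln (n + 1)) * (A + \<epsilon>))"
        using that A0 by (simp add: C_def)
      also have "\<dots> \<le> ennreal (C * sqrt (ln (n + 1)) * (A + \<epsilon>))"
        using L A0 that by (intro ennreal_leI mult_right_mono) auto
      finally show ?thesis .
    qed
    have lim: "(\<lambda>m. ennreal (C * sqrt (ln (n + 1)) * (A + inverse (real (Suc m))))) \<longlonglongrightarrow> ennreal (C * sqrt (ln (n + 1)) * (A + 0))"
      by (intro tendsto_intros LIMSEQ_inverse_real_of_nat)
    have "(\<integral>\<^sup>+w\<in>G. ennreal (norm (deriv f w)) \<partial>lborel) \<le> ennreal (C * sqrt (ln (n + 1)) * (A + 0))"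
      by (rule LIMSEQ_le_const[OF lim]) (intro exI[of _ 0] allI impI est, simp)
    then show "(\<integral>\<^sup>+w\<in>G. ennreal (norm (deriv f w)) \<partial>lborel) \<le> ennreal (C * sqrt (ln (n + 1)) * hardy_norm p (f \<circ> \<phi>))"
      by (simp add: A_def)
  qed
qed

end
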